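(* Let $\epsilon>0$ be a constant and let $q=7$. There is a positive constant $c_\epsilon$ such that for every triangle-free graph $G$ on $n$ vertices with maximum degree $\Delta\ge \log^{1+\epsilon} n$, the three-stage randomized coloring algorithm described in the context, run on $G$ with parameter $q=7$ and starting with $c_\epsilon\,\Delta/\log\Delta$ colors (i.e. with $\Delta/k=c_\epsilon\Delta/\log\Delta$), finds a proper vertex coloring of $G$ in $O(n\Delta^2\log\Delta)$ time with probability $1-O(1/n)$.
   Context: A proper vertex coloring assigns colors to all vertices so that adjacent vertices get distinct colors. Asymptotics: sequences are indexed by $n$; $x(n)=O(f(n))$ means $|x(n)|\le M|f(n)|$ for some constant $M>0$, which may depend on $\epsilon$; each occurrence has its own constant. Notation. The input is a triangle-free graph $G$ on $n$ vertices, its maximum degree $\Delta$, and the number of colors $\Delta/k$, $k>0$. $q>1$ is a constant. The algorithm proceeds in rounds $t=0,1,2,\dots$; initially all vertices are uncolored. $G_t$ is the subgraph induced by the vertices uncolored at the beginning of round $t$; $N_t(u)$ is the set of neighbors of $u$ in $G_t$; $S_t(u)$ is the palette of $u$ (list of colors that may be assigned to $u$ in round $t$), with $S_0(u)=\{1,\dots,\Delta/k\}$; $D_t(u,c)=\{v\in N_t(u): c\in S_t(v)\}$. Put $\eta_t(u)=|N_t(u)|$, $s_t(u)=|S_t(u)|$, $d_t(u,c)=|D_t(u,c)|$. Deterministic sequences: $\eta_0=d_0=\Delta$, $s_0=\Delta/k$. During the first stage $\eta_{t+1}=\eta_t\big(1-\frac{q-1}{2q^3}e^{-1/q}\frac{s_t}{d_t}\big)$,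 $d_{t+1}=d_t\big(1-\frac{q-1}{2q^3}e^{-1/q}\frac{s_t}{d_t}\big)e^{-1/q}$, $s_{t+1}=s_te^{-1/q}$. During the second stage $\eta_{t+1}=\eta_t\big(1-\frac{q-1}{2q^3}e^{-\frac1q\frac{d_t}{s_t}}\big)$, $d_{t+1}=d_t\big(1-\frac{q-1}{2q^3}e^{-\frac1q\frac{d_t}{s_t}}\big)e^{-\frac1q\frac{d_t}{s_t}}$, $s_{t+1}=s_te^{-\frac1q\frac{d_t}{s_t}}$. First stage: repeat the following round until $d_t/s_t<1/q^2$. Put $p_t=\frac1{q^2d_t}$ and $\delta_t=e^{-1/q}$. Phase I (coloring attempt): for each vertex $u$ of $G_t$ and each color $c\in S_t(u)$, independently assign $c$ to $u$ with probability $p_t$. Phase II (conflict resolution): for each vertex $u$ of $G_t$: (II.1) remove from $S_t(u)$ all colors assigned to adjacent vertices; (II.2) for each color $c$ remaining in $S_t(u)$, remove $c$ with probability $1-\min\big(1,\delta_t/\Pr(\mathcal F_t(u,c))\big)$, where $\mathcal F_t(u,c)$ is the event that $c$ is not assigned to any vertex adjacent to $u$ in round $t$ (probability given the state at the beginning of the round). If $S_t(u)$ then contains at least one color assigned to $u$, pick arbitrarily one such color and permanently color $u$ with it. Phase III (cleanup): for each vertex $u$ of $G_t$: set $S_{t+1}(u)=S_t(u)$ (the current palette); let $\alpha=1-|S_{t+1}(u)|/s_{t+1}$, replaced by $0$ if $\alpha<0$ and by $1/q$ if $\alpha>1/q$; let $\gamma$ be the smallest number in $[1,\infty)$ such that the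 average of $d_{t+1}(u,c)$ over $c\in S_{t+1}(u)$ is at most $\frac{1-q\alpha}{1-\alpha}\gamma d_{t+1}$; remove from $S_{t+1}(u)$ all colors $c$ with $d_{t+1}(u,c)\ge q\gamma d_{t+1}$. Second stage: the same rounds, but with the second-stage recursions, $p_t=\frac1{q^2s_t}$ and $\delta_t=e^{-\frac1q\frac{d_t}{s_t}}$, repeated until $\eta_t<\frac{q-1}{q}s_t$. Third (greedy) stage: color each uncolored vertex $u$ with an arbitrary color from its palette that has not been used to color an adjacent vertex. *)

theory Defs
  imports "HOL-Probability.Probability"
begin

section \<open>Graphs\<close>

text \<open>
  A graph is a set \<open>V\<close> of vertices with an adjacency relation \<open>E\<close>. Vertices are
  natural numbers, which is no restriction on finite graphs.
\<close>

definition simple_graph :: "nat set \<Rightarrow> (nat \<Rightarrow> nat \<Rightarrow> bool) \<Rightarrow> bool" where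
  "simple_graph V E \<longleftrightarrow>
     finite V \<and> (\<forall>u v. E u v \<longrightarrow> u \<in> V \<and> v \<in> V \<and> u \<noteq> v \<and> E v u)"

definition triangle_free :: "(nat \<Rightarrow> nat \<Rightarrow> bool) \<Rightarrow> bool" where
  "triangle_free E \<longleftrightarrow> \<not> (\<exists>u v w. E u v \<and> E v w \<and> E u w)"

definition max_degree :: "nat set \<Rightarrow> (nat \<Rightarrow> nat \<Rightarrow> bool) \<Rightarrow> nat" where
  "max_degree V E = Max ((\<lambda>u. card {v. E u v}) ` V)"

text \<open>A partial coloring maps uncolored vertices to \<^const>\<open>None\<close>.\<close>

definition proper_coloring ::
    "nat set \<Rightarrow> (nat \<Rightarrow> nat \<Rightarrow> bool) \<Rightarrow> (nat \<Rightarrow> nat option) \<Rightarrow> bool" where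
  "proper_coloring V E f \<longleftrightarrow>
     (\<forall>u\<in>V. f u \<noteq> None) \<and> (\<forall>u\<in>V. \<forall>v\<in>V. E u v \<longrightarrow> f u \<noteq> f v)"


section \<open>Randomized programs with a clock\<close>

text \<open>
  A program receives the current clock reading and yields a subdistribution over pairs of a
  result and the new clock reading; the missing mass is the probability of divergence.

  The clock counts steps of a unit-cost machine with real arithmetic. One unit pays for a bounded
  number of elementary operations: arithmetic, exponentials and comparisons of reals, a biased
  coin flip, and lookups and updates of tables (adjacency, colors, palette membership,
  assigned colors). Everything that is not bounded is a loop or is charged explicitly, so that
  a \<open>return\<close> and the pure terms of bounded size in a loop body are paid for by that loop's own unit
  per iteration.
\<close>

type_synonym 'a timed = "nat \<Rightarrow> ('a \<times> nat) spmf"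

definition ret :: "'a \<Rightarrow> 'a timed" where
  "ret x = (\<lambda>t. return_spmf (x, t))"

definition bind_timed :: "'a timed \<Rightarrow> ('a \<Rightarrow> 'b timed) \<Rightarrow> 'b timed" where
  "bind_timed m f = (\<lambda>t. bind_spmf (m t) (\<lambda>(x, t'). f x t'))"

adhoc_overloading Monad_Syntax.bind \<rightleftharpoons> bind_timed

definition charge :: "nat \<Rightarrow> unit timed" where
  "charge k = (\<lambda>t. return_spmf ((), t + k))"

definition flip :: "real \<Rightarrow> bool timed" where
  "flip p = (\<lambda>t. map_spmf (\<lambda>b. (b, t + 1)) (spmf_of_pmf (bernoulli_pmf p)))"

text \<open>Draw from \<open>P\<close> at the price of \<open>k\<close> units, for a \<open>P\<close> that is the joint law of \<open>k\<close> coin flips.\<close>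

definition draw :: "nat \<Rightarrow> 'a pmf \<Rightarrow> 'a timed" where
  "draw k P = (\<lambda>t. map_spmf (\<lambda>x. (x, t + k)) (spmf_of_pmf P))"

primrec for_each :: "'x list \<Rightarrow> ('x \<Rightarrow> 's \<Rightarrow> 's timed) \<Rightarrow> 's \<Rightarrow> 's timed" where
  "for_each [] f s = ret s"
| "for_each (x # xs) f s = do { charge 1; s' \<leftarrow> f x s; for_each xs f s' }"

primrec filter_timed :: "('x \<Rightarrow> bool timed) \<Rightarrow> 'x list \<Rightarrow> 'x list timed" where
  "filter_timed P [] = ret []"
| "filter_timed P (x # xs) = do {
     charge 1;
     b \<leftarrow> P x;
     ys \<leftarrow> filter_timed P xs;
     ret (if b then x # ys else ys) }"

abbreviation select :: "('x \<Rightarrow> bool) \<Rightarrow> 'x list \<Rightarrow> 'x list timed" where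
  "select P xs \<equiv> filter_timed (\<lambda>x. ret (P x)) xs"

partial_function (spmf) while_timed ::
    "('s \<Rightarrow> bool) \<Rightarrow> ('s \<Rightarrow> 's timed) \<Rightarrow> 's \<Rightarrow> nat \<Rightarrow> ('s \<times> nat) spmf" where
  "while_timed g f s t =
     (if g s then bind_spmf (f s (t + 1)) (\<lambda>(s', t'). while_timed g f s' t')
      else return_spmf (s, t + 1))"

abbreviation enum :: "nat set \<Rightarrow> nat list" where
  "enum A \<equiv> sorted_list_of_set A"


section \<open>The coloring algorithm\<close>

text \<open>
  The state at the beginning of round \<open>t\<close>: the deterministic numbers \<open>\<eta>\<^sub>t, d\<^sub>t, s\<^sub>t\<close>, the partial
  coloring, and the palettes \<open>S\<^sub>t(u)\<close>. The graph \<open>G\<^sub>t\<close> is induced by the vertices of \<open>V\<close>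
  that \<open>col\<close> leaves uncolored.
\<close>

record state =
  eta :: real
  dd :: real
  ss :: real
  col :: "nat \<Rightarrow> nat option"
  pal :: "nat \<Rightarrow> nat set"

text \<open>
  A rule for the ``arbitrary'' choices of the algorithm: in a given state, for a given vertex, it
  picks an element of a given nonempty set of admissible colors.
\<close>

type_synonym choice_rule = "state \<Rightarrow> nat \<Rightarrow> nat set \<Rightarrow> nat"

definition choice_rule :: "choice_rule \<Rightarrow> bool" where
  "choice_rule pick \<longleftrightarrow> (\<forall>st u X. finite X \<and> X \<noteq> {} \<longrightarrow> pick st u X \<in> X)"

text \<open>
  The joint law of the color assignments in Phase I; \<open>A (u, c)\<close> says that \<open>c\<close> is assigned to \<open>u\<close>.
\<close>

definition attempts_index :: "nat set \<Rightarrow> state \<Rightarrow> (nat \<times> nat) set" where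
  "attempts_index V st = {(u, c). u \<in> V \<and> col st u = None \<and> c \<in> pal st u}"

definition attempts :: "nat set \<Rightarrow> real \<Rightarrow> state \<Rightarrow> (nat \<times> nat \<Rightarrow> bool) pmf" where
  "attempts V p st = Pi_pmf (attempts_index V st) False (\<lambda>_. bernoulli_pmf p)"

text \<open>\<open>Pr(\<F>\<^sub>t(u,c))\<close>\<close>

definition prob_unassigned ::
    "nat set \<Rightarrow> (nat \<Rightarrow> nat \<Rightarrow> bool) \<Rightarrow> real \<Rightarrow> state \<Rightarrow> nat \<Rightarrow> nat \<Rightarrow> real" where
  "prob_unassigned V E p st u c =
     measure_pmf.prob (attempts V p st) {A. \<forall>v. E u v \<longrightarrow> \<not> A (v, c)}"

text \<open>
  One pass over the neighbors of \<open>u\<close> in \<open>G\<^sub>t\<close> suffices to compute this probability, as it is a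
  power of \<open>1 - p\<close> with exponent \<open>d\<^sub>t(u,c)\<close>. This is what the algorithm is charged for it.
\<close>

lemma prob_unassigned_eq:
  assumes G: "simple_graph V E" and fin: "\<And>v. v \<in> V \<Longrightarrow> finite (pal st v)"
    and p: "0 \<le> p" "p \<le> 1"
  shows "prob_unassigned V E p st u c =
           (1 - p) ^ card {v. E u v \<and> col st v = None \<and> c \<in> pal st v}"
proof -
  define I where "I = attempts_index V st"
  define B where "B = (\<lambda>i :: nat \<times> nat. if E u (fst i) \<and> snd i = c then {False} else UNIV)"
  define D where "D = {v. E u v \<and> col st v = None \<and> c \<in> pal st v}"
  have "I \<subseteq> (SIGMA v:V. pal st v)"
    by (auto simp: I_def attempts_index_def)
  moreover have "finite (SIGMA v:V. pal st v)"
    using G fin by (auto simp: simple_graph_def)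
  ultimately have finI: "finite I"
    by (rule finite_subset)
  have sub: "{i \<in> I. E u (fst i) \<and> snd i = c} = (\<lambda>v. (v, c)) ` D"
    using G by (auto simp: I_def attempts_index_def D_def simple_graph_def)
  have "prob_unassigned V E p st u c = measure_pmf.prob (attempts V p st) (Pi I B)"
    unfolding prob_unassigned_def
  proof (rule measure_pmf.finite_measure_eq_AE)
    show "AE A in measure_pmf (attempts V p st).
            (A \<in> {A. \<forall>v. E u v \<longrightarrow> \<not> A (v, c)}) = (A \<in> Pi I B)"
    proof (rule AE_pmfI)
      fix A assume "A \<in> set_pmf (attempts V p st)"
      then have "A i = False" if "i \<notin> I" for i
        using set_Pi_pmf_subset[OF finI, of False "\<lambda>_. bernoulli_pmf p"] that
        unfolding attempts_def I_def[symmetric] by blast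
      then show "(A \<in> {A. \<forall>v. E u v \<longrightarrow> \<not> A (v, c)}) = (A \<in> Pi I B)"
        by (fastforce simp: B_def Pi_def)
    qed
  qed auto
  also have "\<dots> = (\<Prod>i\<in>I. measure_pmf.prob (bernoulli_pmf p) (B i))"
    unfolding attempts_def I_def[symmetric] by (rule measure_Pi_pmf_Pi[OF finI])
  also have "\<dots> = (\<Prod>i\<in>I. if E u (fst i) \<and> snd i = c then 1 - p else 1)"
    using p by (intro prod.cong) (auto simp: B_def measure_pmf_single)
  also have "\<dots> = (\<Prod>i\<in>{i \<in> I. E u (fst i) \<and> snd i = c}. 1 - p)"
    by (rule prod.inter_filter[OF finI, symmetric])
  also have "\<dots> = (1 - p) ^ card ((\<lambda>v. (v, c)) ` D)"
    unfolding sub by simp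
  also have "card ((\<lambda>v. (v, c)) ` D) = card D"
    by (intro card_image) (auto simp: inj_on_def)
  finally show ?thesis
    unfolding D_def .
qed

text \<open>
  \<open>\<gamma>\<close> is the smallest number in \<open>[1, \<infinity>)\<close> such that the average \<open>avg\<close> is at most
  \<open>(1 - q\<alpha>)/(1 - \<alpha>) \<gamma> d\<close>. There is none if \<open>\<alpha> = 1/q\<close> and \<open>avg > 0\<close>; Phase III then removes nothing,
  as for \<open>\<gamma> = \<infinity>\<close>.
\<close>

definition is_gamma :: "real \<Rightarrow> real \<Rightarrow> real \<Rightarrow> real \<Rightarrow> real \<Rightarrow> bool" where
  "is_gamma q \<alpha> avg d \<gamma> \<longleftrightarrow>
     1 \<le> \<gamma> \<and> avg \<le> (1 - q * \<alpha>) / (1 - \<alpha>) * \<gamma> * d \<and>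
     (\<forall>\<gamma>'. 1 \<le> \<gamma>' \<and> avg \<le> (1 - q * \<alpha>) / (1 - \<alpha>) * \<gamma>' * d \<longrightarrow> \<gamma> \<le> \<gamma>')"

lemma is_gamma_eq:
  assumes "q > 1" "0 \<le> \<alpha>" "\<alpha> < 1 / q" "d > 0"
  shows "is_gamma q \<alpha> avg d \<gamma> \<longleftrightarrow> \<gamma> = max 1 (avg * (1 - \<alpha>) / ((1 - q * \<alpha>) * d))"
proof -
  have "q * \<alpha> < 1"
    using assms by (simp add: field_simps)
  moreover have "\<alpha> < 1"
    using assms by (smt (verit) divide_le_eq_1_pos)
  ultimately have *: "avg \<le> (1 - q * \<alpha>) / (1 - \<alpha>) * x * d \<longleftrightarrow>
      avg * (1 - \<alpha>) / ((1 - q * \<alpha>) * d) \<le> x" for x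
    using assms by (simp add: field_simps)
  show ?thesis
    unfolding is_gamma_def * by (auto simp: max_def intro: antisym)
qed

text \<open>
  Palettes, assignments and probabilities in Phase II refer to the state \<open>st\<close> at the beginning of
  the round; \<open>st'\<close> accumulates the new coloring and palettes.
\<close>

definition phase_two ::
    "nat set \<Rightarrow> (nat \<Rightarrow> nat \<Rightarrow> bool) \<Rightarrow> choice_rule \<Rightarrow> real \<Rightarrow> real \<Rightarrow> nat list \<Rightarrow>
     (nat \<times> nat \<Rightarrow> bool) \<Rightarrow> state \<Rightarrow> state timed" where
  "phase_two V E pick p \<delta> U A st =
     for_each U (\<lambda>u st'. do {
       N \<leftarrow> select (\<lambda>v. col st v = None) (enum {v. E u v});
       C \<leftarrow> filter_timed (\<lambda>c. do {
              X \<leftarrow> select (\<lambda>v. A (v, c)) N;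
              ret (X = []) }) (enum (pal st u));
       R \<leftarrow> filter_timed (\<lambda>c. do {
              charge (length N);
              flip (min 1 (\<delta> / prob_unassigned V E p st u c)) }) C;
       X \<leftarrow> select (\<lambda>c. A (u, c)) R;
       ret (st'\<lparr>pal := (pal st')(u := set R),
                col := (if X = [] then col st'
                        else (col st')(u := Some (pick st' u (set X))))\<rparr>) }) st"

text \<open>
  Phase III is simultaneous: the numbers \<open>d\<^sub>t\<^sub>+\<^sub>1(u,c)\<close> refer to the coloring and the palettes left by
  Phase II, which \<open>st\<close> holds here, for all vertices. The arguments \<open>d'\<close> and \<open>s'\<close> are \<open>d\<^sub>t\<^sub>+\<^sub>1\<close> and
  \<open>s\<^sub>t\<^sub>+\<^sub>1\<close>.
\<close>

definition phase_three ::
    "(nat \<Rightarrow> nat \<Rightarrow> bool) \<Rightarrow> real \<Rightarrow> real \<Rightarrow> real \<Rightarrow> nat list \<Rightarrow> state \<Rightarrow> state timed" where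
  "phase_three E q d' s' U st =
     for_each U (\<lambda>u st'. do {
       N \<leftarrow> select (\<lambda>v. col st v = None) (enum {v. E u v});
       total \<leftarrow> for_each (enum (pal st u)) (\<lambda>c a. do {
              D \<leftarrow> select (\<lambda>v. c \<in> pal st v) N;
              ret (a + length D) }) 0;
       let \<alpha> = max 0 (min (1 / q) (1 - real (card (pal st u)) / s'));
       let avg = real total / real (card (pal st u));
       R \<leftarrow> filter_timed (\<lambda>c. do {
              D \<leftarrow> select (\<lambda>v. c \<in> pal st v) N;
              ret (\<not> (\<exists>\<gamma>. is_gamma q \<alpha> avg d' \<gamma> \<and> real (length D) \<ge> q * \<gamma> * d')) })
            (enum (pal st u));
       ret (st'\<lparr>pal := (pal st')(u := set R)\<rparr>) }) st"

definition round_timed ::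
    "nat set \<Rightarrow> (nat \<Rightarrow> nat \<Rightarrow> bool) \<Rightarrow> real \<Rightarrow> choice_rule \<Rightarrow> real \<Rightarrow> real \<Rightarrow>
     real \<Rightarrow> real \<Rightarrow> real \<Rightarrow> state \<Rightarrow> state timed" where
  "round_timed V E q pick p \<delta> \<eta>' d' s' st = do {
     U \<leftarrow> select (\<lambda>u. col st u = None) (enum V);
     A \<leftarrow> draw (card (attempts_index V st)) (attempts V p st);
     st \<leftarrow> phase_two V E pick p \<delta> U A st;
     st \<leftarrow> phase_three E q d' s' U st;
     ret (st\<lparr>eta := \<eta>', dd := d', ss := s'\<rparr>) }"

definition first_stage_round ::
    "nat set \<Rightarrow> (nat \<Rightarrow> nat \<Rightarrow> bool) \<Rightarrow> real \<Rightarrow> choice_rule \<Rightarrow> state \<Rightarrow> state timed" where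
  "first_stage_round V E q pick st =
     (let a = 1 - (q - 1) / (2 * q ^ 3) * exp (- 1 / q) * (ss st / dd st);
          \<delta> = exp (- 1 / q)
      in round_timed V E q pick (1 / (q\<^sup>2 * dd st)) \<delta> (eta st * a) (dd st * a * \<delta>) (ss st * \<delta>) st)"

definition second_stage_round ::
    "nat set \<Rightarrow> (nat \<Rightarrow> nat \<Rightarrow> bool) \<Rightarrow> real \<Rightarrow> choice_rule \<Rightarrow> state \<Rightarrow> state timed" where
  "second_stage_round V E q pick st =
     (let \<delta> = exp (- 1 / q * (dd st / ss st));
          a = 1 - (q - 1) / (2 * q ^ 3) * \<delta>
      in round_timed V E q pick (1 / (q\<^sup>2 * ss st)) \<delta> (eta st * a) (dd st * a * \<delta>) (ss st * \<delta>) st)"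

text \<open>A vertex for which no admissible color is left stays uncolored.\<close>

definition greedy_stage ::
    "nat set \<Rightarrow> (nat \<Rightarrow> nat \<Rightarrow> bool) \<Rightarrow> choice_rule \<Rightarrow> state \<Rightarrow> state timed" where
  "greedy_stage V E pick st = do {
     U \<leftarrow> select (\<lambda>u. col st u = None) (enum V);
     for_each U (\<lambda>u st. do {
       C \<leftarrow> filter_timed (\<lambda>c. do {
              X \<leftarrow> select (\<lambda>v. col st v = Some c) (enum {v. E u v});
              ret (X = []) }) (enum (pal st u));
       ret (if C = [] then st
            else st\<lparr>col := (col st)(u := Some (pick st u (set C)))\<rparr>) }) st }"

text \<open>
  The input is the graph, its maximum degree \<open>\<Delta>\<close>, and the number \<open>K\<close> of colors,
  so \<open>k = \<Delta> / K\<close>. The first charge is for writing down the initial palettes.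
\<close>

definition coloring_algorithm ::
    "nat set \<Rightarrow> (nat \<Rightarrow> nat \<Rightarrow> bool) \<Rightarrow> nat \<Rightarrow> nat \<Rightarrow> real \<Rightarrow> choice_rule \<Rightarrow>
     (nat \<Rightarrow> nat option) timed" where
  "coloring_algorithm V E \<Delta> K q pick = do {
     charge (card V * (K + 1));
     st \<leftarrow> while_timed (\<lambda>st. \<not> dd st / ss st < 1 / q\<^sup>2) (first_stage_round V E q pick)
            \<lparr>eta = real \<Delta>, dd = real \<Delta>, ss = real K, col = (\<lambda>_. None), pal = (\<lambda>_. {1..K})\<rparr>;
     st \<leftarrow> while_timed (\<lambda>st. \<not> eta st < (q - 1) / q * ss st) (second_stage_round V E q pick) st;
     st \<leftarrow> greedy_stage V E pick st;
     ret (col st) }"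

text \<open>The joint law of the output and the running time.\<close>

definition run :: "'a timed \<Rightarrow> ('a \<times> nat) spmf" where
  "run m = m 0"

end

theory Submission
  imports Defs "HOL-Real_Asymp.Real_Asymp"
begin

text \<open>
  For an uncolored vertex \<open>u\<close> let its \<^emph>\<open>weight\<close> be the sum of \<open>max 0 (q d\<^sub>t - d\<^sub>t(u,c))\<close> over the
  palette \<open>S\<^sub>t(u)\<close>. The proof maintains, for a number \<open>x\<close> that starts at \<open>1\<close> and drops by a
  polynomially small \<open>e'\<close> per round, that every uncolored \<open>u\<close> has weight at least
  \<open>(q - 1) x d\<^sub>t s\<^sub>t\<close> and at most \<open>x \<eta>\<^sub>t\<close> uncolored neighbors (\<open>balanced\<close>). Since one color contributes
  at most \<open>q d\<^sub>t\<close>, a large weight forces at least \<open>(q - 1)/q x s\<^sub>t\<close> colors with \<open>d\<^sub>t(u,c) \<le> q d\<^sub>t\<close>. Such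
  a color survives Phase II with probability almost exactly \<open>\<delta>\<^sub>t\<close>, whence a vertex is colored in
  the round with probability at least \<open>1.1 a\<close>, where \<open>a\<close> is the relative decrease of \<open>\<eta>\<^sub>t\<close> that the
  recursion prescribes. This slack absorbs the errors in the degrees. The weight has no slack, but
  it decreases by the expected factor up to a polynomially small error, which is what the drop of
  \<open>x\<close> pays for. Phase III removes only colors with \<open>d\<^sub>t\<^sub>+\<^sub>1(u,c) \<ge> q d\<^sub>t\<^sub>+\<^sub>1\<close>, because \<open>\<gamma> \<ge> 1\<close>; they contribute
  nothing to the weight of \<open>u\<close>, and their removal can only raise the weights of the neighbors.

  For the concentration, absence of triangles is decisive: \<open>N\<^sub>t(u)\<close> is an independent set, so
  whether a neighbor \<open>v\<close> of \<open>u\<close> keeps a color depends on coins outside \<open>N\<^sub>t(u)\<close>. Once these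
  \<^emph>\<open>early\<close> coins are revealed, the events that \<open>v\<close> stays uncolored are independent over the neighbors
  \<open>v\<close>, as each depends on the tries at \<open>v\<close> itself, and the events that \<open>u\<close> keeps \<open>c\<close> are independent
  over the colors \<open>c\<close>. What the vertices keep of one color is independent of what they keep of
  another, which controls the early coins. All deviations are thereby bounded by Hoeffding's
  inequality for functions of disjoint blocks of coins (\<open>Hoeffding_blocks_upper\<close>,
  \<open>prob_bad_early\<close>, \<open>prob_fails_late\<close>), with an exponent \<open>H\<close> that is at least \<open>\<Delta>\<close> to a power
  as close to \<open>1\<close> as needed. That beats \<open>ln n \<le> \<Delta> powr (1 / (1 + \<epsilon>))\<close> in a union bound.

  Both stages satisfy \<open>\<delta>\<^sub>t = exp (- q p\<^sub>t d\<^sub>t)\<close>, \<open>a = 3/7 \<delta>\<^sub>t p\<^sub>t s\<^sub>t\<close> and \<open>d\<^sub>t / s\<^sub>t = \<eta>\<^sub>t / s\<^sub>0\<close>, so one analysis of a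
  round serves both. In the first stage \<open>d\<^sub>t / s\<^sub>t\<close> drops by a constant per round, hence the stage
  takes \<open>O(ln \<Delta> / c)\<close> rounds and costs \<open>s\<^sub>t\<close> only a factor \<open>\<Delta> powr (- O(1/c))\<close>, where \<open>c\<close> is the
  constant in the number of colors, to be chosen large. In the second stage \<open>d\<^sub>t / s\<^sub>t\<close> decays
  geometrically, so \<open>s\<^sub>t\<close> loses only a constant factor until \<open>\<eta>\<^sub>t < 6/7 s\<^sub>t\<close>. Then the two halves of the
  invariant say that every uncolored vertex has fewer uncolored neighbors than colors, and the
  greedy stage succeeds.

  The program flips coins lazily and interleaved with its bookkeeping. It is compared with the
  product measure by drawing the table of all coins in advance (\<open>filter_flips\<close>, \<open>for_each_flips\<close>,
  \<open>round_eval\<close>); rounds are composed by Hoare-like rules that add up failure probabilities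
  (\<open>achieves_bind\<close>, \<open>achieves_while\<close>).
\<close>


section \<open>Independent blocks of coordinates and Hoeffding's inequality\<close>

lemma indep_vars_Pi_pmf_blocks:
  fixes X :: "'c \<Rightarrow> ('i \<Rightarrow> bool) \<Rightarrow> real"
  assumes J: "finite J" and disj: "disjoint_family_on blk C"
    and sub: "\<And>c. c \<in> C \<Longrightarrow> blk c \<subseteq> J"
    and dep: "\<And>c \<omega> \<omega>'. c \<in> C \<Longrightarrow> (\<And>j. j \<in> blk c \<Longrightarrow> \<omega> j = \<omega>' j) \<Longrightarrow> X c \<omega> = X c \<omega>'"
  shows "prob_space.indep_vars (measure_pmf (Pi_pmf J False P)) (\<lambda>_. borel) X C"
proof -
  let ?M = "measure_pmf (Pi_pmf J False P)"
  have 1: "prob_space.indep_vars ?M (\<lambda>c. PiM (blk c) (\<lambda>_. count_space UNIV))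
             (\<lambda>c \<omega>. restrict (\<lambda>j. \<omega> j) (blk c)) C"
    by (rule prob_space.indep_vars_restrict[OF prob_space_measure_pmf indep_vars_Pi_pmf[OF J]])
      (use sub disj in auto)
  have 2: "prob_space.indep_vars ?M (\<lambda>_. borel) (\<lambda>c \<omega>. X c (restrict (\<lambda>j. \<omega> j) (blk c))) C"
  proof (rule prob_space.indep_vars_compose2[OF prob_space_measure_pmf 1])
    fix c assume "c \<in> C"
    have "finite (blk c)" using sub[OF \<open>c \<in> C\<close>] J by (rule finite_subset)
    then have "PiM (blk c) (\<lambda>_. count_space (UNIV :: bool set))
        = count_space (PiE (blk c) (\<lambda>_. UNIV))"
      by (intro count_space_PiM_finite) auto
    then show "X c \<in> PiM (blk c) (\<lambda>_. count_space UNIV) \<rightarrow>\<^sub>M borel"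
      by simp
  qed
  have "X c (restrict (\<lambda>j. \<omega> j) (blk c)) = X c \<omega>" if "c \<in> C" for c \<omega>
    by (rule dep[OF that]) auto
  then show ?thesis
    by (intro iffD1[OF prob_space.indep_vars_cong[OF prob_space_measure_pmf refl] 2]) auto
qed

text \<open>
  \<open>W\<close> need only dominate the sum of the squared ranges: the number of blocks is random in the
  applications, whereas the exponent has to be explicit.
\<close>

lemma Hoeffding_blocks_upper:
  fixes X :: "'c \<Rightarrow> ('i \<Rightarrow> bool) \<Rightarrow> real"
  assumes J: "finite J" and C: "finite C" and disj: "disjoint_family_on blk C"
    and sub: "\<And>c. c \<in> C \<Longrightarrow> blk c \<subseteq> J"
    and dep: "\<And>c \<omega> \<omega>'. c \<in> C \<Longrightarrow> (\<And>j. j \<in> blk c \<Longrightarrow> \<omega> j = \<omega>' j) \<Longrightarrow> X c \<omega> = X c \<omega>'"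
    and bnd: "\<And>c \<omega>. c \<in> C \<Longrightarrow> 0 \<le> X c \<omega>" "\<And>c \<omega>. c \<in> C \<Longrightarrow> X c \<omega> \<le> b"
    and mean: "(\<Sum>c\<in>C. measure_pmf.expectation (Pi_pmf J False P) (X c)) \<le> \<mu>"
    and lam: "0 < l" and W: "real (card C) * b\<^sup>2 \<le> W" "0 < W"
  shows "measure_pmf.prob (Pi_pmf J False P) {\<omega>. \<mu> + l \<le> (\<Sum>c\<in>C. X c \<omega>)} \<le> exp (- 2 * l\<^sup>2 / W)"
proof -
  let ?M = "measure_pmf (Pi_pmf J False P)"
  let ?\<mu> = "\<Sum>c\<in>C. measure_pmf.expectation (Pi_pmf J False P) (X c)"
  interpret Hoeffding_ineq ?M C X "\<lambda>_. 0" "\<lambda>_. b" ?\<mu>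
    using indep_vars_Pi_pmf_blocks[OF J disj sub dep] bnd C
    by unfold_locales auto
  show ?thesis
  proof (cases "real (card C) * b\<^sup>2 = 0")
    case True
    then consider "C = {}" | "b = 0" using C by auto
    then have "X c = (\<lambda>_. 0)" if "c \<in> C" for c
      by cases (use that bnd[OF that] in \<open>auto intro!: ext antisym\<close>)
    then have "?\<mu> = 0" "\<And>\<omega>. (\<Sum>c\<in>C. X c \<omega>) = 0"
      by (auto intro!: sum.neutral)
    then have "{\<omega>. \<mu> + l \<le> (\<Sum>c\<in>C. X c \<omega>)} = {}"
      using mean lam by auto
    then show ?thesis by simp
  next
    case False
    then have pos: "0 < real (card C) * b\<^sup>2"
      by (metis less_eq_real_def mult_nonneg_nonneg of_nat_0_le_iff zero_le_power2)
    have "measure_pmf.prob (Pi_pmf J False P) {\<omega>. \<mu> + l \<le> (\<Sum>c\<in>C. X c \<omega>)} \<le> measure ?M {\<omega> \<in> space ?M. ?\<mu> + l \<le> (\<Sum>c\<in>C. X c \<omega>)}"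
      using mean by (intro measure_pmf.finite_measure_mono) auto
    also have "\<dots> \<le> exp (- 2 * l\<^sup>2 / (\<Sum>c\<in>C. (b - 0)\<^sup>2))"
      using pos lam by (intro Hoeffding_ineq_ge) auto
    also have "\<dots> \<le> exp (- 2 * l\<^sup>2 / W)"
      using pos W lam by (simp add: frac_le)
    finally show ?thesis .
  qed
qed

lemma Hoeffding_blocks_lower:
  fixes X :: "'c \<Rightarrow> ('i \<Rightarrow> bool) \<Rightarrow> real"
  assumes J: "finite J" and C: "finite C" and disj: "disjoint_family_on blk C"
    and sub: "\<And>c. c \<in> C \<Longrightarrow> blk c \<subseteq> J"
    and dep: "\<And>c \<omega> \<omega>'. c \<in> C \<Longrightarrow> (\<And>j. j \<in> blk c \<Longrightarrow> \<omega> j = \<omega>' j) \<Longrightarrow> X c \<omega> = X c \<omega>'"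
    and bnd: "\<And>c \<omega>. c \<in> C \<Longrightarrow> 0 \<le> X c \<omega>" "\<And>c \<omega>. c \<in> C \<Longrightarrow> X c \<omega> \<le> b"
    and mean: "\<mu> \<le> (\<Sum>c\<in>C. measure_pmf.expectation (Pi_pmf J False P) (X c))"
    and lam: "0 < l" and W: "real (card C) * b\<^sup>2 \<le> W" "0 < W"
  shows "measure_pmf.prob (Pi_pmf J False P) {\<omega>. (\<Sum>c\<in>C. X c \<omega>) \<le> \<mu> - l} \<le> exp (- 2 * l\<^sup>2 / W)"
proof -
  let ?M = "Pi_pmf J False P"
  have int: "integrable (measure_pmf ?M) (X c)" if "c \<in> C" for c
    using bnd[OF that] by (intro measure_pmf.integrable_const_bound[of _ b]) auto
  have "{\<omega>. (\<Sum>c\<in>C. X c \<omega>) \<le> \<mu> - l} = {\<omega>. (real (card C) * b - \<mu>) + l \<le> (\<Sum>c\<in>C. b - X c \<omega>)}"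
    by (auto simp: sum_subtractf)
  also have "measure_pmf.prob ?M \<dots> \<le> exp (- 2 * l\<^sup>2 / W)"
  proof (rule Hoeffding_blocks_upper[OF J C disj sub _ _ _ _ lam W])
    fix c and \<omega> \<omega>' :: "'i \<Rightarrow> bool" assume "c \<in> C" "\<And>j. j \<in> blk c \<Longrightarrow> \<omega> j = \<omega>' j"
    then show "b - X c \<omega> = b - X c \<omega>'" using dep[of c \<omega> \<omega>'] by simp
  next
    have "(\<Sum>c\<in>C. measure_pmf.expectation ?M (\<lambda>\<omega>. b - X c \<omega>)) =
        (\<Sum>c\<in>C. b - measure_pmf.expectation ?M (X c))"
      using int by (intro sum.cong) (auto simp: Bochner_Integration.integral_diff)
    then show "(\<Sum>c\<in>C. measure_pmf.expectation ?M (\<lambda>\<omega>. b - X c \<omega>)) \<le> real (card C) * b - \<mu>"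
      using mean by (simp add: sum_subtractf)
  qed (use bnd in auto)
  finally show ?thesis .
qed

text \<open>
  Two-step exposure: with \<open>B\<close> the failure in the first group of coordinates, it suffices to bound
  the failure \<open>Q\<close> over the second group for each fixed outcome of the first that avoids \<open>B\<close>.
\<close>

lemma prob_Pi_pmf_union_le:
  assumes J: "finite J1" "finite J2" "J1 \<inter> J2 = {}" and r: "0 \<le> r1" "0 \<le> r2"
    and B1: "measure_pmf.prob (Pi_pmf J1 False P) {\<omega>. B \<omega>} \<le> r1"
    and B2: "\<And>\<omega>\<^sub>1. \<not> B \<omega>\<^sub>1 \<Longrightarrow> measure_pmf.prob (Pi_pmf J2 False P)
        {\<omega>\<^sub>2. Q (\<lambda>j. if j \<in> J1 then \<omega>\<^sub>1 j else \<omega>\<^sub>2 j)} \<le> r2"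
  shows "measure_pmf.prob (Pi_pmf (J1 \<union> J2) False P) {\<omega>. Q \<omega>} \<le> r1 + r2"
proof -
  let ?P1 = "Pi_pmf J1 False P" and ?P2 = "Pi_pmf J2 False P"
  let ?m = "\<lambda>\<omega>\<^sub>1 \<omega>\<^sub>2 j. if j \<in> J1 then \<omega>\<^sub>1 j else \<omega>\<^sub>2 j"
  have eq: "Pi_pmf (J1 \<union> J2) False P = bind_pmf ?P1 (\<lambda>\<omega>\<^sub>1. map_pmf (?m \<omega>\<^sub>1) ?P2)"
    by (subst Pi_pmf_union[OF J])
      (simp add: pair_pmf_def map_pmf_def bind_assoc_pmf bind_return_pmf)
  have "measure_pmf.prob (Pi_pmf (J1 \<union> J2) False P) {\<omega>. Q \<omega>} =
      (\<integral>\<omega>\<^sub>1. measure_pmf.prob ?P2 {\<omega>\<^sub>2. Q (?m \<omega>\<^sub>1 \<omega>\<^sub>2)} \<partial>measure_pmf ?P1)"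
    unfolding eq by (subst measure_pmf_bind, subst measure_pmf.measure_bind[where N = "count_space UNIV"])
       (auto simp: space_subprob_algebra measure_pmf.subprob_space_axioms vimage_def)
  also have "\<dots> \<le> (\<integral>\<omega>\<^sub>1. indicator {\<omega>. B \<omega>} \<omega>\<^sub>1 + r2 \<partial>measure_pmf ?P1)"
  proof (rule integral_mono)
    show "integrable (measure_pmf ?P1) (\<lambda>\<omega>\<^sub>1. measure_pmf.prob ?P2 {\<omega>\<^sub>2. Q (?m \<omega>\<^sub>1 \<omega>\<^sub>2)})"
      by (intro measure_pmf.integrable_const_bound[of _ 1]) auto
    show "integrable (measure_pmf ?P1) (\<lambda>\<omega>\<^sub>1. indicator {\<omega>. B \<omega>} \<omega>\<^sub>1 + r2)"
      by (intro measure_pmf.integrable_const_bound[of _ "1 + r2"]) (use r in \<open>auto split: split_indicator\<close>)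
    show "measure_pmf.prob ?P2 {\<omega>\<^sub>2. Q (?m \<omega>\<^sub>1 \<omega>\<^sub>2)} \<le> indicator {\<omega>. B \<omega>} \<omega>\<^sub>1 + r2" for \<omega>\<^sub>1
      using B2[of \<omega>\<^sub>1] r by (cases "B \<omega>\<^sub>1") (auto intro: order_trans[OF measure_pmf.prob_le_1])
  qed
  also have "\<dots> = measure_pmf.prob ?P1 {\<omega>. B \<omega>} + r2"
    by (subst Bochner_Integration.integral_add) 
      (auto intro!: measure_pmf.integrable_const_bound[of _ 1])
  finally show ?thesis using B1 by simp
qed


section \<open>The random experiment of one round\<close>

lemma prob_Pi_pmf_cylinder:
  assumes J: "finite J" and A: "A \<subseteq> J"
  shows "measure_pmf.prob (Pi_pmf J False P) {\<omega>. \<forall>j\<in>A. \<omega> j = g j} = (\<Prod>j\<in>A. pmf (P j) (g j))"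
proof -
  let ?B = "\<lambda>j. if j \<in> A then {g j} else UNIV"
  have "{\<omega>. \<forall>j\<in>A. \<omega> j = g j} = Pi J ?B"
    using A by (auto simp: Pi_def split: if_splits)
  then have "measure_pmf.prob (Pi_pmf J False P) {\<omega>. \<forall>j\<in>A. \<omega> j = g j} =
      (\<Prod>j\<in>J. measure_pmf.prob (P j) (?B j))"
    using measure_Pi_pmf_Pi[OF J] by simp
  also have "\<dots> = (\<Prod>j\<in>J. if j \<in> A then pmf (P j) (g j) else 1)"
    by (intro prod.cong) (auto simp: measure_pmf_single)
  also have "\<dots> = (\<Prod>j\<in>J \<inter> A. pmf (P j) (g j))"
    by (rule prod.inter_restrict[OF J, symmetric])
  also have "J \<inter> A = A" using A by auto
  finally show ?thesis .
qed

abbreviation key :: "'a + 'a \<Rightarrow> 'a" where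
  "key \<equiv> case_sum id id"

text \<open>
  All coins of a round as one product measure on functions \<open>\<omega>\<close>: \<open>\<omega> (Inl (v, c))\<close> says that \<open>c\<close> is
  assigned to \<open>v\<close> in Phase I, and \<open>\<omega> (Inr (v, c))\<close> that \<open>c\<close> would not be removed from the palette of
  \<open>v\<close> in step II.2. The set \<open>U\<close> is the vertex set of \<open>G\<^sub>t\<close>, \<open>S v\<close> the palette, \<open>nbc u c\<close> is
  \<open>D\<^sub>t(u,c)\<close>, and \<open>\<sigma> v c\<close> turns out to be the probability that \<open>v\<close> keeps \<open>c\<close> in Phase II.
\<close>

locale nibble =
  fixes U :: "nat set" and E :: "nat \<Rightarrow> nat \<Rightarrow> bool" and S :: "nat \<Rightarrow> nat set"
    and p \<delta> :: real
  assumes finite_U: "finite U" and finite_S: "\<And>u. u \<in> U \<Longrightarrow> finite (S u)"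
    and E_sym: "\<And>u v. E u v \<Longrightarrow> E v u" and E_irrefl: "\<And>u. \<not> E u u"
    and triangle_free: "triangle_free E"
    and p: "0 < p" "p < 1" and \<delta>: "0 < \<delta>" "\<delta> \<le> 1"
begin

definition nb :: "nat \<Rightarrow> nat set" where "nb u = {v \<in> U. E u v}"
definition nbc :: "nat \<Rightarrow> nat \<Rightarrow> nat set" where "nbc u c = {v \<in> nb u. c \<in> S v}"
definition keys :: "(nat \<times> nat) set" where "keys = (SIGMA u:U. S u)"
definition \<sigma> :: "nat \<Rightarrow> nat \<Rightarrow> real" where "\<sigma> u c = min ((1 - p) ^ card (nbc u c)) \<delta>"
definition coin :: "nat \<times> nat \<Rightarrow> real" where
  "coin = (\<lambda>(u, c). min 1 (\<delta> / (1 - p) ^ card (nbc u c)))"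
definition J :: "(nat \<times> nat + nat \<times> nat) set" where "J = keys <+> keys"
definition P :: "nat \<times> nat + nat \<times> nat \<Rightarrow> bool pmf" where
  "P = case_sum (\<lambda>_. bernoulli_pmf p) (\<lambda>i. bernoulli_pmf (coin i))"
definition keeps :: "(nat \<times> nat + nat \<times> nat \<Rightarrow> bool) \<Rightarrow> nat \<Rightarrow> nat \<Rightarrow> bool" where
  "keeps \<omega> v c \<longleftrightarrow> c \<in> S v \<and> (\<forall>w\<in>nbc v c. \<not> \<omega> (Inl (w, c))) \<and> \<omega> (Inr (v, c))"
definition stays :: "(nat \<times> nat + nat \<times> nat \<Rightarrow> bool) \<Rightarrow> nat \<Rightarrow> bool" where
  "stays \<omega> v \<longleftrightarrow> (\<forall>c. keeps \<omega> v c \<longrightarrow> \<not> \<omega> (Inl (v, c)))"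

definition keep_keys :: "nat \<Rightarrow> nat \<Rightarrow> (nat \<times> nat + nat \<times> nat) set" where
  "keep_keys v c = insert (Inr (v, c)) ((\<lambda>w. Inl (w, c)) ` nbc v c)"

lemma finite_nb [simp]: "finite (nb u)" "finite (nbc u c)"
  using finite_U by (auto simp: nb_def nbc_def)

lemma nb_subset: "v \<in> nb u \<Longrightarrow> v \<in> U" "v \<in> nbc u c \<Longrightarrow> v \<in> nb u" "v \<in> nbc u c \<Longrightarrow> c \<in> S v"
  by (auto simp: nb_def nbc_def)

lemma finite_J: "finite J"
  using finite_U finite_S by (auto simp: J_def keys_def)

lemma keeps_cong:
  assumes "\<And>j. j \<in> keep_keys v c \<Longrightarrow> \<omega> j = \<omega>' j"
  shows "keeps \<omega> v c = keeps \<omega>' v c"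
  using assms by (auto simp: keeps_def keep_keys_def)

lemma keep_keys_subset: "v \<in> U \<Longrightarrow> c \<in> S v \<Longrightarrow> keep_keys v c \<subseteq> J"
  by (auto simp: keep_keys_def J_def keys_def nbc_def nb_def)

lemma keep_keys_color: "j \<in> keep_keys v c \<Longrightarrow> snd (key j) = c"
  by (auto simp: keep_keys_def)

lemma keeps_cong_color:
  assumes "keep_keys v c \<subseteq> J'" "\<And>j. j \<in> {j \<in> J'. snd (key j) = c} \<Longrightarrow> \<omega> j = \<omega>' j"
  shows "keeps \<omega> v c = keeps \<omega>' v c"
proof (rule keeps_cong)
  fix j assume "j \<in> keep_keys v c"
  then show "\<omega> j = \<omega>' j" using assms(1) keep_keys_color by (intro assms(2)) auto
qed

lemma coin_01: "0 \<le> coin i" "coin i \<le> 1"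
  using p \<delta> by (auto simp: coin_def split: prod.splits)

lemma \<sigma>_bounds: "0 \<le> \<sigma> u c" "\<sigma> u c \<le> \<delta>"
  using p \<delta> by (auto simp: \<sigma>_def)

lemma prob_keeps:
  assumes J': "finite J'" "keep_keys v c \<subseteq> J'" and c: "c \<in> S v"
  shows "measure_pmf.prob (Pi_pmf J' False P) {\<omega>. keeps \<omega> v c} = \<sigma> v c"
proof -
  let ?g = "\<lambda>j. j = Inr (v, c)"
  have "{\<omega>. keeps \<omega> v c} = {\<omega>. \<forall>j\<in>keep_keys v c. \<omega> j = ?g j}"
    using c by (auto simp: keeps_def keep_keys_def)
  then have "measure_pmf.prob (Pi_pmf J' False P) {\<omega>. keeps \<omega> v c} =
      (\<Prod>j\<in>keep_keys v c. pmf (P j) (?g j))"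
    using prob_Pi_pmf_cylinder[OF J', of P ?g] by simp
  also have "\<dots> = pmf (P (Inr (v, c))) True *
      (\<Prod>j\<in>(\<lambda>w. Inl (w, c)) ` nbc v c. pmf (P j) (?g j))"
    unfolding keep_keys_def by (subst prod.insert) auto
  also have "(\<Prod>j\<in>(\<lambda>w. Inl (w, c)) ` nbc v c. pmf (P j) (?g j)) = (\<Prod>w\<in>nbc v c. 1 - p)"
    using p by (subst prod.reindex) (auto simp: inj_on_def P_def)
  also have "pmf (P (Inr (v, c))) True = coin (v, c)"
    using coin_01 by (simp add: P_def)
  also have "coin (v, c) * (\<Prod>w\<in>nbc v c. 1 - p) = \<sigma> v c"
    using p by (auto simp: coin_def \<sigma>_def min_def field_simps)
  finally show ?thesis .
qed

lemma expectation_keeps: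
  assumes "finite J'" "keep_keys v c \<subseteq> J'" "c \<in> S v"
  shows "measure_pmf.expectation (Pi_pmf J' False P) (\<lambda>\<omega>. of_bool (keeps \<omega> v c)) = \<sigma> v c"
proof -
  have "(\<lambda>\<omega>. of_bool (keeps \<omega> v c) :: real) = indicator {\<omega>. keeps \<omega> v c}"
    by (auto simp: indicator_def)
  then show ?thesis using prob_keeps[OF assms] by simp
qed

lemma card_eq_sum_of_bool: "finite A \<Longrightarrow> real (card {x\<in>A. Q x}) = (\<Sum>x\<in>A. of_bool (Q x))"
  by (simp add: sum.If_cases of_bool_def Int_def)

text \<open>
  Whether \<open>v\<close> keeps \<open>c\<close> depends on coins of color \<open>c\<close> only, so the colors form independent blocks.
  The index set \<open>J'\<close> is left open because the bound is needed for the early coins alone.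
\<close>

lemma many_kept:
  assumes v: "v \<in> U" and J': "finite J'" "\<And>c. c \<in> S v \<Longrightarrow> keep_keys v c \<subseteq> J'"
    and \<mu>: "\<mu> \<le> (\<Sum>c\<in>S v. \<sigma> v c)" and l: "0 < l" and W: "real (card (S v)) \<le> W" "0 < W"
  shows "measure_pmf.prob (Pi_pmf J' False P) {\<omega>. real (card {c\<in>S v. keeps \<omega> v c}) \<le> \<mu> - l}
     \<le> exp (- 2 * l\<^sup>2 / W)"
proof -
  let ?X = "\<lambda>c \<omega>. of_bool (keeps \<omega> v c) :: real"
  have fin: "finite (S v)" using finite_S v by blast
  have "measure_pmf.prob (Pi_pmf J' False P) {\<omega>. (\<Sum>c\<in>S v. ?X c \<omega>) \<le> \<mu> - l} \<le> exp (- 2 * l\<^sup>2 / W)"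
  proof (rule Hoeffding_blocks_lower[where blk = "\<lambda>c. {j \<in> J'. snd (key j) = c}" and b = 1])
    show "?X c \<omega> = ?X c \<omega>'"
      if "c \<in> S v" "\<And>j. j \<in> {j \<in> J'. snd (key j) = c} \<Longrightarrow> \<omega> j = \<omega>' j" for c \<omega> \<omega>'
      by (intro arg_cong[where f = of_bool] keeps_cong_color[OF J'(2)[OF that(1)]] that(2))
    show "\<mu> \<le> (\<Sum>c\<in>S v. measure_pmf.expectation (Pi_pmf J' False P) (?X c))"
      using \<mu> J' by (simp add: expectation_keeps cong: sum.cong)
  qed (use fin J' l W in \<open>auto simp: disjoint_family_on_def\<close>)
  then show ?thesis using fin by (simp add: card_eq_sum_of_bool)
qed

text \<open>
  Neighbors of \<open>u\<close> are strongly dependent within one color: they may all share the neighbor to which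
  \<open>c\<close> is assigned. Only the sum over the colors concentrates, with one block per color.
\<close>

lemma few_neighbours_keep:
  assumes J': "finite J'" "\<And>v c. v \<in> nb u \<Longrightarrow> c \<in> S v \<Longrightarrow> keep_keys v c \<subseteq> J'"
    and G: "finite G" "\<And>c. c \<in> G \<Longrightarrow> real (card (nbc u c)) \<le> b"
    and l: "0 < l" and W: "real (card G) * b\<^sup>2 \<le> W" "0 < W"
  shows "measure_pmf.prob (Pi_pmf J' False P)
       {\<omega>. (\<Sum>c\<in>G. \<delta> * card (nbc u c)) + l \<le> (\<Sum>c\<in>G. real (card {v\<in>nbc u c. keeps \<omega> v c}))}
     \<le> exp (- 2 * l\<^sup>2 / W)"
proof (rule Hoeffding_blocks_upper[where blk = "\<lambda>c. {j \<in> J'. snd (key j) = c}" and b = b])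
  let ?X = "\<lambda>c \<omega>. real (card {v\<in>nbc u c. keeps \<omega> v c})"
  show "?X c \<omega> = ?X c \<omega>'"
    if "c \<in> G" "\<And>j. j \<in> {j \<in> J'. snd (key j) = c} \<Longrightarrow> \<omega> j = \<omega>' j" for c \<omega> \<omega>'
  proof -
    have "keeps \<omega> v c = keeps \<omega>' v c" if "v \<in> nbc u c" for v
      by (rule keeps_cong_color[OF J'(2)[OF nb_subset(2,3)[OF that]]]) (rule \<open>\<And>j. _ \<Longrightarrow> \<omega> j = \<omega>' j\<close>)
    then show ?thesis by (intro arg_cong[where f = "\<lambda>A. real (card A)"]) auto
  qed
  show "?X c \<omega> \<le> b" if "c \<in> G" for c \<omega>
  proof -
    have "?X c \<omega> \<le> real (card (nbc u c))" by (intro of_nat_mono card_mono) auto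
    then show ?thesis using G(2)[OF that] by simp
  qed
  show "(\<Sum>c\<in>G. measure_pmf.expectation (Pi_pmf J' False P) (?X c)) \<le> (\<Sum>c\<in>G. \<delta> * card (nbc u c))"
  proof (rule sum_mono)
    fix c assume "c \<in> G"
    have "measure_pmf.expectation (Pi_pmf J' False P) (?X c) =
        (\<Sum>v\<in>nbc u c. measure_pmf.expectation (Pi_pmf J' False P) (\<lambda>\<omega>. of_bool (keeps \<omega> v c)))"
      unfolding card_eq_sum_of_bool[OF finite_nb(2)]
      by (rule Bochner_Integration.integral_sum) (auto intro!: measure_pmf.integrable_const_bound[of _ 1])
    also have "\<dots> = (\<Sum>v\<in>nbc u c. \<sigma> v c)"
      using J' nb_subset by (intro sum.cong refl expectation_keeps) auto
    also have "\<dots> \<le> (\<Sum>v\<in>nbc u c. \<delta>)" by (intro sum_mono \<sigma>_bounds)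
    finally show "measure_pmf.expectation (Pi_pmf J' False P) (?X c) \<le> \<delta> * card (nbc u c)"
      by (simp add: mult.commute)
  qed
qed (use J' G l W in \<open>auto simp: disjoint_family_on_def\<close>)

text \<open>
  The late coins for \<open>u\<close> are the tries at the neighbors of \<open>u\<close> and the survival coins of \<open>u\<close>. They
  decide which neighbors stay uncolored and which colors \<open>u\<close> keeps.
\<close>

definition late :: "nat \<Rightarrow> (nat \<times> nat + nat \<times> nat) set" where
  "late u = {j \<in> J. case j of Inl i \<Rightarrow> fst i \<in> nb u | Inr i \<Rightarrow> fst i = u}"

definition early :: "nat \<Rightarrow> (nat \<times> nat + nat \<times> nat) set" where
  "early u = J - late u"

lemma late_early: "finite (late u)" "finite (early u)" "early u \<inter> late u = {}" "early u \<union> late u = J"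
  using finite_J by (auto simp: late_def early_def)

text \<open>
  The only use of triangle-freeness: a neighbor \<open>w\<close> of a neighbor \<open>v\<close> of \<open>u\<close> is not a neighbor of
  \<open>u\<close>, so the early coins decide what \<open>v\<close> keeps.
\<close>

lemma keep_keys_early:
  assumes "v \<in> nb u" "c \<in> S v"
  shows "keep_keys v c \<subseteq> early u"
proof -
  have "w \<notin> nb u" if "w \<in> nb v" for w
    using assms that triangle_free E_sym unfolding nb_def triangle_free_def by blast
  moreover have "v \<noteq> u" using assms E_irrefl by (auto simp: nb_def)
  ultimately show ?thesis
    using assms keep_keys_subset[of v c] nb_subset
    by (fastforce simp: early_def late_def keep_keys_def)
qed

lemma keep_keys_late: "u \<in> U \<Longrightarrow> c \<in> S u \<Longrightarrow> keep_keys u c \<subseteq> late u"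
  using keep_keys_subset[of u c] nb_subset by (fastforce simp: late_def keep_keys_def)

definition glue :: "nat \<Rightarrow> (nat \<times> nat + nat \<times> nat \<Rightarrow> bool) \<Rightarrow> (nat \<times> nat + nat \<times> nat \<Rightarrow> bool) \<Rightarrow>
    nat \<times> nat + nat \<times> nat \<Rightarrow> bool" where
  "glue u \<omega>\<^sub>1 \<omega>\<^sub>2 = (\<lambda>j. if j \<in> early u then \<omega>\<^sub>1 j else \<omega>\<^sub>2 j)"

lemma keeps_glue_nb: "v \<in> nb u \<Longrightarrow> keeps (glue u \<omega>\<^sub>1 \<omega>\<^sub>2) v c = keeps \<omega>\<^sub>1 v c"
proof (cases "c \<in> S v")
  case True
  assume "v \<in> nb u"
  then show ?thesis using keep_keys_early[OF _ True] by (intro keeps_cong) (auto simp: glue_def)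
qed (auto simp: keeps_def)

lemma keeps_glue_self: "u \<in> U \<Longrightarrow> keeps (glue u \<omega>\<^sub>1 \<omega>\<^sub>2) u c = keeps \<omega>\<^sub>2 u c"
proof (cases "c \<in> S u")
  case True
  assume "u \<in> U"
  then show ?thesis using keep_keys_late[OF _ True] late_early(3)
    by (intro keeps_cong) (auto simp: glue_def)
qed (auto simp: keeps_def)

lemma stays_glue_nb:
  assumes v: "v \<in> nb u"
  shows "stays (glue u \<omega>\<^sub>1 \<omega>\<^sub>2) v \<longleftrightarrow> (\<forall>c\<in>{c\<in>S v. keeps \<omega>\<^sub>1 v c}. \<omega>\<^sub>2 (Inl (v, c)) = False)"
proof -
  have "Inl (v, c) \<notin> early u" if "c \<in> S v" for c
    using that v nb_subset(1)[OF v] by (auto simp: early_def late_def J_def keys_def)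
  moreover have "keeps \<omega>\<^sub>1 v c \<Longrightarrow> c \<in> S v" for c by (auto simp: keeps_def)
  ultimately show ?thesis
    unfolding stays_def keeps_glue_nb[OF v] by (auto simp: glue_def)
qed

text \<open>
  Given the early coins, \<open>v\<close> stays uncolored iff none of the colors it keeps is tried at \<open>v\<close>, which
  has probability \<open>(1 - p) ^ k\<close> for \<open>k \<ge> z\<close> kept colors and is independent over \<open>v\<close>.
\<close>

lemma few_stay:
  assumes u: "u \<in> U" and T: "T \<subseteq> nb u"
    and z: "\<And>v. v \<in> nb u \<Longrightarrow> z \<le> real (card {c\<in>S v. keeps \<omega>\<^sub>1 v c})"
    and l: "0 < l" and W: "real (card T) \<le> W" "0 < W"
  shows "measure_pmf.prob (Pi_pmf (late u) False P)
     {\<omega>\<^sub>2. exp (- p * z) * card T + l \<le> real (card {v\<in>T. stays (glue u \<omega>\<^sub>1 \<omega>\<^sub>2) v})}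
   \<le> exp (- 2 * l\<^sup>2 / W)"
proof -
  let ?K = "\<lambda>v. {c\<in>S v. keeps \<omega>\<^sub>1 v c}"
  let ?X = "\<lambda>v \<omega>. of_bool (\<forall>c\<in>?K v. \<omega> (Inl (v, c)) = False) :: real"
  have fin: "finite T" using T finite_nb(1) by (rule finite_subset)
  have late: "(\<lambda>c. Inl (v, c)) ` ?K v \<subseteq> late u" if "v \<in> T" for v
    using that T nb_subset by (auto simp: late_def J_def keys_def)
  have "measure_pmf.prob (Pi_pmf (late u) False P)
      {\<omega>. exp (- p * z) * card T + l \<le> (\<Sum>v\<in>T. ?X v \<omega>)} \<le> exp (- 2 * l\<^sup>2 / W)"
  proof (rule Hoeffding_blocks_upper[where blk = "\<lambda>v. {j \<in> late u. fst (key j) = v}" and b = 1])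
    show "?X v \<omega> = ?X v \<omega>'"
      if "v \<in> T" "\<And>j. j \<in> {j \<in> late u. fst (key j) = v} \<Longrightarrow> \<omega> j = \<omega>' j" for v and \<omega> \<omega>' :: "_ \<Rightarrow> bool"
    proof -
      have "\<omega> (Inl (v, c)) = \<omega>' (Inl (v, c))" if "c \<in> ?K v" for c
        using late[OF \<open>v \<in> T\<close>] that by (intro \<open>\<And>j. _ \<Longrightarrow> \<omega> j = \<omega>' j\<close>) auto
      then show ?thesis by simp
    qed
    have "measure_pmf.expectation (Pi_pmf (late u) False P) (?X v) \<le> exp (- p * z)" if v: "v \<in> T" for v
    proof -
      have "measure_pmf.expectation (Pi_pmf (late u) False P) (?X v) =
          measure_pmf.prob (Pi_pmf (late u) False P) {\<omega>. \<forall>j\<in>(\<lambda>c. Inl (v, c)) ` ?K v. \<omega> j = False}"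
      proof -
        have "?X v = indicator {\<omega>. \<forall>j\<in>(\<lambda>c. Inl (v, c)) ` ?K v. \<omega> j = False}"
          by (auto simp: indicator_def)
        then have "measure_pmf.expectation (Pi_pmf (late u) False P) (?X v) =
            measure_pmf.expectation (Pi_pmf (late u) False P)
              (indicator {\<omega>. \<forall>j\<in>(\<lambda>c. Inl (v, c)) ` ?K v. \<omega> j = False})"
          by (rule arg_cong)
        also have "\<dots> = measure_pmf.prob (Pi_pmf (late u) False P)
            {\<omega>. \<forall>j\<in>(\<lambda>c. Inl (v, c)) ` ?K v. \<omega> j = False}"
          by simp
        finally show ?thesis .
      qed
      also have "\<dots> = (\<Prod>j\<in>(\<lambda>c. Inl (v, c)) ` ?K v. pmf (P j) False)"
        using late[OF v] late_early(1) by (intro prob_Pi_pmf_cylinder) auto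
      also have "\<dots> = (1 - p) ^ card (?K v)"
        using p by (subst prod.reindex) (auto simp: inj_on_def P_def)
      also have "\<dots> \<le> exp (- p) ^ card (?K v)"
        using p exp_ge_add_one_self[of "- p"] by (intro power_mono) auto
      also have "\<dots> = exp (- p * card (?K v))"
        using exp_of_nat_mult[of "card (?K v)" "- p"] by (simp add: mult.commute)
      also have "\<dots> \<le> exp (- p * z)"
        using z[of v] v T p by (auto intro!: mult_left_mono)
      finally show ?thesis .
    qed
    from sum_mono[of T, OF this] show "(\<Sum>v\<in>T. measure_pmf.expectation (Pi_pmf (late u) False P) (?X v))
        \<le> exp (- p * z) * real (card T)"
      by (simp add: mult.commute)
  qed (use fin late_early(1) l W in \<open>auto simp: disjoint_family_on_def\<close>)
  moreover have "(\<Sum>v\<in>T. ?X v \<omega>\<^sub>2) = real (card {v\<in>T. stays (glue u \<omega>\<^sub>1 \<omega>\<^sub>2) v})" for \<omega>\<^sub>2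
    using T by (subst card_eq_sum_of_bool[OF fin]) (auto intro!: sum.cong simp: stays_glue_nb subset_iff)
  ultimately show ?thesis by simp
qed

text \<open>
  The values \<open>y c\<close> stand for quantities determined by the early coins; \<open>u\<close> keeps different colors
  independently.
\<close>

lemma palette_weight_kept:
  assumes u: "u \<in> U" and G: "G \<subseteq> S u" and y: "\<And>c. c \<in> G \<Longrightarrow> 0 \<le> y c" "\<And>c. c \<in> G \<Longrightarrow> y c \<le> b"
    and \<mu>: "\<mu> \<le> (\<Sum>c\<in>G. \<sigma> u c * y c)" and l: "0 < l" and W: "real (card G) * b\<^sup>2 \<le> W" "0 < W"
  shows "measure_pmf.prob (Pi_pmf (late u) False P)
     {\<omega>\<^sub>2. (\<Sum>c\<in>G. of_bool (keeps (glue u \<omega>\<^sub>1 \<omega>\<^sub>2) u c) * y c) \<le> \<mu> - l}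
   \<le> exp (- 2 * l\<^sup>2 / W)"
  unfolding keeps_glue_self[OF u]
proof (rule Hoeffding_blocks_lower[where blk = "\<lambda>c. {j \<in> late u. snd (key j) = c}" and b = b])
  let ?X = "\<lambda>c \<omega>. of_bool (keeps \<omega> u c) * y c :: real"
  show "finite G" using G finite_S[OF u] by (rule finite_subset)
  show "?X c \<omega> = ?X c \<omega>'"
    if "c \<in> G" "\<And>j. j \<in> {j \<in> late u. snd (key j) = c} \<Longrightarrow> \<omega> j = \<omega>' j" for c \<omega> \<omega>'
    by (intro arg_cong[where f = "\<lambda>b. of_bool b * _"] keeps_cong_color[OF keep_keys_late[OF u]] that(2))
      (use that(1) G in auto)
  show "0 \<le> ?X c \<omega>" "?X c \<omega> \<le> b" if "c \<in> G" for c \<omega>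
    using y[OF that] by auto
  have "measure_pmf.expectation (Pi_pmf (late u) False P) (?X c) = \<sigma> u c * y c" if "c \<in> G" for c
    using that G keep_keys_late[OF u, of c] late_early(1) expectation_keeps[of "late u" u c] by auto
  then have "(\<Sum>c\<in>G. measure_pmf.expectation (Pi_pmf (late u) False P) (?X c)) = (\<Sum>c\<in>G. \<sigma> u c * y c)"
    by (rule sum.cong[OF refl])
  then show "\<mu> \<le> (\<Sum>c\<in>G. measure_pmf.expectation (Pi_pmf (late u) False P) (?X c))"
    using \<mu> by linarith
qed (use late_early(1) l W in \<open>auto simp: disjoint_family_on_def\<close>)

end


section \<open>One round: arithmetic of the invariant\<close>

text \<open>
  A color with at most \<open>7 d\<close> competitors survives the conflicts with probability at least
  \<open>\<delta> = exp (- 7 p d)\<close> up to the factor \<open>1 - p\<close>; this is the reason for the threshold \<open>q d\<^sub>t\<close>.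
\<close>

lemma power_one_minus_lower:
  fixes p d :: real
  assumes p: "0 < p" "p \<le> 1/2" and pd: "p * d \<le> 1/49" and m: "real m \<le> 7 * d"
  shows "exp (- 7 * p * d) * (1 - p) \<le> (1 - p) ^ m"
proof -
  have "p + 2 * p\<^sup>2 \<ge> 0" using p by simp
  then have "real m * (p + 2 * p\<^sup>2) \<le> 7 * d * (p + 2 * p\<^sup>2)"
    using m by (intro mult_right_mono) auto
  moreover have "real m * (- p - 2 * p\<^sup>2) \<le> real m * ln (1 - p)"
    using p by (intro mult_left_mono ln_one_minus_pos_lower_bound) auto
  ultimately have "- 7 * p * d - 14 * p * (p * d) \<le> real m * ln (1 - p)"
    by (simp add: algebra_simps power2_eq_square)
  moreover have "p * (p * d) \<le> p * (1/49)"
    using p pd by (intro mult_left_mono) auto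
  ultimately have *: "- 7 * p * d - p \<le> real m * ln (1 - p)"
    using p by linarith
  have "exp (- 7 * p * d) * (1 - p) \<le> exp (- 7 * p * d) * exp (- p)"
    using exp_ge_add_one_self[of "- p"] by (intro mult_left_mono) auto
  also have "\<dots> = exp (- 7 * p * d - p)" by (simp add: exp_diff exp_minus field_simps)
  also have "\<dots> \<le> exp (real m * ln (1 - p))" using * by simp
  also have "\<dots> = (1 - p) ^ m" using p by (simp add: exp_of_nat_mult)
  finally show ?thesis .
qed

text \<open>
  The expected number of successful tries at a vertex is about \<open>2 a\<close>, and \<open>y\<close> will be a lower bound
  on it that allows for deviations. The vertex then stays uncolored with probability at most
  \<open>exp (- y)\<close>, which is still below the \<open>1 - a\<close> of the recursions.
\<close>

lemma exp_minus_upper: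
  fixes a :: real
  assumes "0 \<le> a" "a \<le> 3/7" "9/5 * a \<le> y"
  shows "exp (- y) \<le> 1 - 11/10 * a"
proof -
  have "exp (- y) \<le> exp (- (9/5 * a))" using assms by simp
  also have "\<dots> \<le> 1 - 9/5 * a + (9/5 * a)\<^sup>2 / 2"
  proof -
    let ?x = "9/5 * a"
    have "1 \<le> (1 - ?x + ?x\<^sup>2 / 2) * (1 + ?x + ?x\<^sup>2 / 2)"
      using assms(1) by (simp add: algebra_simps power2_eq_square)
    also have "\<dots> \<le> (1 - ?x + ?x\<^sup>2 / 2) * exp ?x"
    proof (intro mult_left_mono exp_lower_Taylor_quadratic)
      show "0 \<le> 1 - ?x + ?x\<^sup>2 / 2" using assms by simp
    qed (use assms in simp)
    finally show ?thesis by (simp add: exp_minus field_simps)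
  qed
  also have "(9/5 * a)\<^sup>2 / 2 \<le> 7/10 * a"
    using assms mult_left_mono[of a "3/7" a] by (simp add: power2_eq_square)
  finally show ?thesis by simp
qed

text \<open>
  The number \<open>x\<close> is the quality of the invariant before the round and \<open>x - e'\<close> after it, \<open>e\<close> is the
  relative deviation admitted in the Hoeffding bounds, and \<open>H\<close> a common lower bound on their
  exponents. The equations for \<open>\<delta>\<close> and \<open>a\<close> hold in the first stage with \<open>p = 1 / (49 d)\<close> and in the
  second with \<open>p = 1 / (49 s)\<close>. The number \<open>K\<close> bounds the palettes; since \<open>s\<close> falls below it,
  \<open>e'\<close> has to exceed \<open>e\<close> by the factor \<open>2 K / s\<close>.
\<close>

locale nibble_round = nibble U E S "p :: real" \<delta>
  for U E S p \<delta> +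
  fixes d s \<eta> K a x e e' H :: real
  assumes pos: "0 < d" "0 < s" "s \<le> K" "0 < e" "0 < \<eta>"
    and p_half: "p \<le> 1/2" and pd: "p * d \<le> 1/49" and ps: "p * s \<le> 1"
    and \<delta>_eq: "\<delta> = exp (- 7 * p * d)" and a_eq: "a = 3/7 * \<delta> * p * s"
    and x: "95/100 \<le> x" "x \<le> 1"
    and err: "p + 2 * e * K / s \<le> e'" "e + e' \<le> a / 20"
    and H: "H \<le> 2 * e\<^sup>2 * s\<^sup>2 / (49 * K)" "H \<le> 2 * e\<^sup>2 * d / 7" "H \<le> 2 * e\<^sup>2 * \<eta>"
    and card_S: "\<And>v. v \<in> U \<Longrightarrow> real (card (S v)) \<le> K"
    and weight: "\<And>v. v \<in> U \<Longrightarrow> 6 * x * d * s \<le> (\<Sum>c\<in>S v. max 0 (7 * d - card (nbc v c)))"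
    and degree: "\<And>v. v \<in> U \<Longrightarrow> real (card (nb v)) \<le> x * \<eta>"
begin

definition good :: "nat \<Rightarrow> nat set" where "good u = {c \<in> S u. real (card (nbc u c)) \<le> 7 * d}"

lemma \<delta>_lower: "6/7 \<le> \<delta>"
proof -
  have "1 + (- 7 * p * d) \<le> \<delta>" unfolding \<delta>_eq by (rule exp_ge_add_one_self)
  then show ?thesis using pd by simp
qed

lemma a_bounds: "0 < a" "a \<le> 3/7"
proof -
  have "a = 3/7 * (\<delta> * (p * s))" by (simp add: a_eq)
  moreover have "\<delta> * (p * s) \<le> 1 * 1" using ps \<delta> p pos by (intro mult_mono) auto
  moreover have "0 < \<delta> * (p * s)" using ps \<delta> p pos by simp
  ultimately show "0 < a" "a \<le> 3/7" by auto
qed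

lemma e'_bounds: "p \<le> e'" "0 < e'" "e + e' \<le> 3/140"
proof -
  have "0 < 2 * e * K / s" using pos by simp
  then show "p \<le> e'" "0 < e'" using err p by linarith+
  show "e + e' \<le> 3/140" using err a_bounds by simp
qed

lemma \<sigma>_good: "c \<in> good u \<Longrightarrow> \<delta> * (1 - p) \<le> \<sigma> u c"
proof -
  assume "c \<in> good u"
  then have "exp (- 7 * p * d) * (1 - p) \<le> (1 - p) ^ card (nbc u c)"
    by (intro power_one_minus_lower[OF p(1) p_half pd]) (auto simp: good_def)
  moreover have "\<delta> * (1 - p) \<le> \<delta>" using p \<delta> by simp
  ultimately show ?thesis unfolding \<sigma>_def using \<delta>_eq by simp
qed

lemma finite_good: "u \<in> U \<Longrightarrow> finite (good u)"
  using finite_S by (auto simp: good_def)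

lemma weight_good: "u \<in> U \<Longrightarrow> 6 * x * d * s \<le> (\<Sum>c\<in>good u. 7 * d - card (nbc u c))"
proof -
  assume u: "u \<in> U"
  have "(\<Sum>c\<in>S u. max 0 (7 * d - card (nbc u c))) = (\<Sum>c\<in>good u. max 0 (7 * d - card (nbc u c)))"
    using finite_S[OF u] by (intro sum.mono_neutral_right) (auto simp: good_def)
  also have "\<dots> = (\<Sum>c\<in>good u. 7 * d - card (nbc u c))"
    by (intro sum.cong) (auto simp: good_def)
  finally show ?thesis using weight[OF u] by simp
qed

lemma card_good: "u \<in> U \<Longrightarrow> 6/7 * x * s \<le> card (good u)" "u \<in> U \<Longrightarrow> card (good u) \<le> K"
proof -
  assume u: "u \<in> U"
  have "(\<Sum>c\<in>good u. 7 * d - card (nbc u c)) \<le> (\<Sum>c\<in>good u. 7 * d)"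
    by (intro sum_mono) auto
  then have "d * (6 * x * s) \<le> d * (7 * card (good u))"
    using weight_good[OF u] by (simp add: algebra_simps)
  then show "6/7 * x * s \<le> card (good u)" using pos by simp
  have "card (good u) \<le> card (S u)" using finite_S[OF u] by (intro card_mono) (auto simp: good_def)
  then show "card (good u) \<le> K" using card_S[OF u] by simp
qed

text \<open>
  The early coins leave at least \<open>z\<close> colors at each vertex. The constant is chosen such that
  \<open>p z = 9/5 a\<close>; the expectation is about \<open>6/7 x \<delta> s\<close>, and \<open>27/35 = 9/10 * 6/7\<close> leaves room for the
  deviation \<open>e s\<close> because \<open>x \<ge> 95/100\<close>.
\<close>

definition z :: real where "z = 27/35 * \<delta> * s"

lemma mean_kept: "v \<in> U \<Longrightarrow> z + e * s \<le> (\<Sum>c\<in>S v. \<sigma> v c)"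
proof -
  assume v: "v \<in> U"
  have "z + e * s \<le> \<delta> * (1 - p) * (6/7 * x * s)"
  proof -
    have "27/35 * \<delta> + e \<le> \<delta> * (1 - p) * (6/7 * x)"
    proof -
      have "e \<le> 7/6 * e * \<delta>" using \<delta>_lower pos by simp
      have "1 - p \<ge> 0" using p by simp
      then have "(1 - p) * (6/7 * (95/100)) \<le> (1 - p) * (6/7 * x)"
        using x by (intro mult_left_mono) auto
      moreover have "27/35 + 7/6 * e \<le> (1 - p) * (6/7 * (95/100))"
        using e'_bounds by (simp add: field_simps)
      ultimately have "\<delta> * (27/35 + 7/6 * e) \<le> \<delta> * ((1 - p) * (6/7 * x))"
        using \<delta> by (intro mult_left_mono) auto
      then show ?thesis using \<open>e \<le> 7/6 * e * \<delta>\<close> by (simp add: algebra_simps)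
    qed
    from mult_right_mono[OF this, of s] show ?thesis
      using pos by (simp add: z_def algebra_simps)
  qed
  also have "\<dots> \<le> \<delta> * (1 - p) * card (good v)"
    using card_good(1)[OF v] \<delta> p by (intro mult_left_mono) auto
  also have "\<dots> = (\<Sum>c\<in>good v. \<delta> * (1 - p))" by simp
  also have "\<dots> \<le> (\<Sum>c\<in>good v. \<sigma> v c)" by (intro sum_mono \<sigma>_good)
  also have "\<dots> \<le> (\<Sum>c\<in>S v. \<sigma> v c)"
    using finite_S[OF v] \<sigma>_bounds by (intro sum_mono2) (auto simp: good_def)
  finally show ?thesis .
qed

lemma exp_H:
  assumes "H \<le> y" shows "exp (- y) \<le> exp (- H)"
  using assms by simp

definition stay_bound :: real where "stay_bound = exp (- p * z)"

lemma stay_bound_le: "0 \<le> stay_bound" "stay_bound \<le> 1 - 11/10 * a"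
  unfolding stay_bound_def using exp_minus_upper[of a "p * z"] a_bounds by (auto simp: z_def a_eq)

text \<open>
  The gain of \<open>a / 10\<close> per vertex over the recursion for \<open>\<eta>\<close> pays for the deviation \<open>e \<eta>\<close> and for
  the drop of \<open>x\<close>.
\<close>

lemma degree_step:
  assumes "r < stay_bound * m + e * \<eta>" "m \<le> x * \<eta>" "0 \<le> m"
  shows "r \<le> (x - e') * (\<eta> * (1 - a))"
proof -
  have "stay_bound * m \<le> (1 - 11/10 * a) * (x * \<eta>)"
    using assms stay_bound_le x pos a_bounds by (intro mult_mono) auto
  moreover have "(1 - 11/10 * a) * x + e \<le> (x - e') * (1 - a)"
  proof -
    have "a * (95/100) \<le> a * x" using x a_bounds by (intro mult_left_mono) auto
    then have "10 * e + 10 * e' \<le> a * x" using err(2) a_bounds by linarith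
    moreover have "0 \<le> a * e'" using a_bounds e'_bounds by simp
    ultimately show ?thesis by (simp add: algebra_simps)
  qed
  from mult_right_mono[OF this, of \<eta>] have "(1 - 11/10 * a) * (x * \<eta>) + e * \<eta> \<le> (x - e') * (\<eta> * (1 - a))"
    using pos by (simp add: algebra_simps)
  ultimately show ?thesis using assms by simp
qed

abbreviation d' :: real where "d' \<equiv> d * (1 - a) * \<delta>"

text \<open>
  Here \<open>m c\<close> is the number of vertices of \<open>nbc u c\<close> that keep \<open>c\<close>, of which a fraction \<open>stay_bound\<close>
  stays uncolored. Expanding the sum, the main term is \<open>\<delta>\<^sup>2 (1 - a)\<close> times the old weight, as in the
  recursions for \<open>d\<close> and \<open>s\<close>; everything else is at most a multiple of \<open>e d K\<close>.
\<close>

lemma weight_step: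
  assumes u: "u \<in> U"
    and m: "(\<Sum>c\<in>good u. m c) \<le> (\<Sum>c\<in>good u. \<delta> * card (nbc u c)) + e * d * s"
    and r: "(\<Sum>c\<in>good u. \<sigma> u c * max 0 (7 * d' - stay_bound * m c - e * d)) - e * d * s \<le> r"
  shows "6 * (x - e') * d' * (s * \<delta>) \<le> r"
proof -
  let ?G = "good u" and ?y = "\<lambda>c. 7 * d' - stay_bound * m c - e * d"
  have a: "0 < a" "a \<le> 3/7" by (rule a_bounds)+
  have "\<delta> * (1 - p) * (\<Sum>c\<in>?G. ?y c) = (\<Sum>c\<in>?G. \<delta> * (1 - p) * ?y c)"
    by (rule sum_distrib_left)
  also have "\<dots> \<le> (\<Sum>c\<in>?G. \<sigma> u c * max 0 (?y c))"
  proof (rule sum_mono)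
    fix c assume "c \<in> ?G"
    have "\<delta> * (1 - p) * ?y c \<le> \<delta> * (1 - p) * max 0 (?y c)"
      using \<delta> p by (intro mult_left_mono) auto
    also have "\<dots> \<le> \<sigma> u c * max 0 (?y c)"
      using \<sigma>_good[OF \<open>c \<in> ?G\<close>] by (intro mult_right_mono) auto
    finally show "\<delta> * (1 - p) * ?y c \<le> \<sigma> u c * max 0 (?y c)" .
  qed
  finally have 1: "\<delta> * (1 - p) * (\<Sum>c\<in>?G. ?y c) - e * d * s \<le> r" using r by simp
  have eds: "e * d * s \<le> e * d * K" using pos by (intro mult_left_mono) auto
  have "(\<Sum>c\<in>?G. ?y c) = card ?G * (7 * d') - stay_bound * (\<Sum>c\<in>?G. m c) - card ?G * (e * d)"
    by (simp add: sum_subtractf sum_distrib_left)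
  moreover have "stay_bound * (\<Sum>c\<in>?G. m c) \<le> stay_bound * ((\<Sum>c\<in>?G. \<delta> * card (nbc u c)) + e * d * s)"
    using stay_bound_le m by (intro mult_left_mono) auto
  moreover have "stay_bound * (\<Sum>c\<in>?G. \<delta> * card (nbc u c)) \<le> (1 - a) * (\<Sum>c\<in>?G. \<delta> * card (nbc u c))"
    using stay_bound_le a \<delta> by (intro mult_right_mono sum_nonneg) auto
  moreover have "stay_bound * (e * d * s) \<le> 1 * (e * d * s)"
    using stay_bound_le a pos by (intro mult_right_mono) auto
  moreover have "card ?G * (e * d) \<le> K * (e * d)"
    using card_good(2)[OF u] pos by (intro mult_right_mono) auto
  moreover have "\<delta> * (1 - a) * (6 * x * d * s) \<le> \<delta> * (1 - a) * (\<Sum>c\<in>?G. 7 * d - card (nbc u c))"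
    using weight_good[OF u] \<delta> a by (intro mult_left_mono) auto
  moreover have "\<delta> * (1 - a) * (\<Sum>c\<in>?G. 7 * d - card (nbc u c)) =
      card ?G * (7 * d') - (1 - a) * (\<Sum>c\<in>?G. \<delta> * card (nbc u c))"
  proof -
    have "(\<Sum>c\<in>?G. 7 * d - card (nbc u c)) = card ?G * (7 * d) - (\<Sum>c\<in>?G. real (card (nbc u c)))"
      by (simp add: sum_subtractf)
    moreover have "(\<Sum>c\<in>?G. \<delta> * card (nbc u c)) = \<delta> * (\<Sum>c\<in>?G. real (card (nbc u c)))"
      by (simp add: sum_distrib_left)
    ultimately show ?thesis by (simp only:) (simp add: algebra_simps)
  qed
  ultimately have "\<delta> * (1 - a) * (6 * x * d * s) - 2 * (e * d * K) \<le> (\<Sum>c\<in>?G. ?y c)"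
    using eds by (simp add: algebra_simps)
  then have "\<delta> * (1 - p) * (\<delta> * (1 - a) * (6 * x * d * s) - 2 * (e * d * K)) \<le> \<delta> * (1 - p) * (\<Sum>c\<in>?G. ?y c)"
    using \<delta> p by (intro mult_left_mono) auto
  moreover have "\<delta> * (1 - p) * (2 * (e * d * K)) \<le> 1 * (2 * (e * d * K))"
    using \<delta> p pos by (intro mult_right_mono) (auto intro: mult_le_one)
  ultimately have 2: "(1 - p) * (\<delta> * \<delta> * (1 - a) * (6 * x * d * s)) - 3 * (e * d * K) \<le> r"
    using 1 eds by (simp add: algebra_simps)
  \<comment> \<open>the drop from \<open>x\<close> to \<open>x - e'\<close> pays for all error terms\<close>
  have c: "1/4 \<le> \<delta> * \<delta> * (1 - a)"
  proof -
    have "6/7 * (6/7) * (4/7) \<le> \<delta> * \<delta> * (1 - a)"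
      using \<delta>_lower a by (intro mult_mono) auto
    then show ?thesis by simp
  qed
  have "p * x \<le> p * 1" using x p by (intro mult_left_mono) auto
  then have "2 * e * K / s \<le> e' - p * x" using err(1) by linarith
  then have "2 * e * K \<le> (e' - p * x) * s" using pos by (simp add: field_simps)
  then have "(6 * d) * (2 * e * K) \<le> (6 * d) * ((e' - p * x) * s)"
    using pos by (intro mult_left_mono) auto
  moreover have "0 \<le> (6 * d) * (2 * e * K)" using pos by simp
  ultimately have "1/4 * ((6 * d) * (2 * e * K)) \<le> \<delta> * \<delta> * (1 - a) * ((6 * d) * ((e' - p * x) * s))"
    by (intro mult_mono[OF c]) (use c in linarith)+
  then have "3 * (e * d * K) \<le> \<delta> * \<delta> * (1 - a) * (6 * (e' - p * x) * d * s)"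
    by (simp add: algebra_simps)
  then show ?thesis using 2 by (simp add: algebra_simps)
qed

end


section \<open>One round: probability of failure\<close>

lemma prob_Bex_le:
  fixes r :: real
  assumes "finite I" "\<And>i. i \<in> I \<Longrightarrow> measure_pmf.prob M {\<omega>. Q i \<omega>} \<le> r"
  shows "measure_pmf.prob M {\<omega>. \<exists>i\<in>I. Q i \<omega>} \<le> card I * r"
proof -
  have "{\<omega>. \<exists>i\<in>I. Q i \<omega>} = (\<Union>i\<in>I. {\<omega>. Q i \<omega>})" by auto
  then have "measure_pmf.prob M {\<omega>. \<exists>i\<in>I. Q i \<omega>} \<le> (\<Sum>i\<in>I. measure_pmf.prob M {\<omega>. Q i \<omega>})"
    using measure_pmf.finite_measure_subadditive_finite[of I "\<lambda>i. {\<omega>. Q i \<omega>}"] assms(1) by simp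
  also have "\<dots> \<le> (\<Sum>i\<in>I. r)" by (intro sum_mono assms(2))
  finally show ?thesis by simp
qed

lemma prob_disj_le:
  assumes "measure_pmf.prob M {\<omega>. Q \<omega>} \<le> r1" "measure_pmf.prob M {\<omega>. R \<omega>} \<le> r2"
  shows "measure_pmf.prob M {\<omega>. Q \<omega> \<or> R \<omega>} \<le> r1 + r2"
proof -
  have "{\<omega>. Q \<omega> \<or> R \<omega>} = {\<omega>. Q \<omega>} \<union> {\<omega>. R \<omega>}" by auto
  then show ?thesis using measure_Un_le[of "{\<omega>. Q \<omega>}" M "{\<omega>. R \<omega>}"] assms by simp
qed

context nibble_round
begin

text \<open>
  The two halves of the invariant after Phase II, as conditions on the coins of the round.
\<close>

definition succeeds :: "nat \<Rightarrow> (nat \<times> nat + nat \<times> nat \<Rightarrow> bool) \<Rightarrow> bool" where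
  "succeeds u \<omega> \<longleftrightarrow> real (card {v\<in>nb u. stays \<omega> v}) \<le> (x - e') * (\<eta> * (1 - a)) \<and>
     6 * (x - e') * d' * (s * \<delta>) \<le>
       (\<Sum>c\<in>S u. of_bool (keeps \<omega> u c) * max 0 (7 * d' - card {v\<in>nbc u c. stays \<omega> v \<and> keeps \<omega> v c}))"

definition bad_early :: "nat \<Rightarrow> (nat \<times> nat + nat \<times> nat \<Rightarrow> bool) \<Rightarrow> bool" where
  "bad_early u \<omega> \<longleftrightarrow> (\<exists>v\<in>nb u. real (card {c\<in>S v. keeps \<omega> v c}) \<le> z) \<or>
     (\<Sum>c\<in>good u. \<delta> * card (nbc u c)) + e * d * s \<le> (\<Sum>c\<in>good u. real (card {v\<in>nbc u c. keeps \<omega> v c}))"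

lemma degree_le: "u \<in> U \<Longrightarrow> card (nb u) \<le> \<eta>"
proof -
  assume u: "u \<in> U"
  have "x * \<eta> \<le> 1 * \<eta>" using x pos by (intro mult_right_mono) auto
  then show ?thesis using degree[OF u] by linarith
qed

lemma K_pos: "0 < K" using pos by linarith

lemma d'_bounds: "0 \<le> d'" "d' \<le> d"
proof -
  show "0 \<le> d'" using pos a_bounds \<delta> by simp
  have "d * ((1 - a) * \<delta>) \<le> d * 1" using pos a_bounds \<delta> by (intro mult_left_mono mult_le_one) auto
  then show "d' \<le> d" by (simp add: mult.assoc)
qed

lemma prob_bad_early:
  assumes u: "u \<in> U"
  shows "measure_pmf.prob (Pi_pmf (early u) False P) {\<omega>. bad_early u \<omega>} \<le> card (nb u) * exp (- H) + exp (- H)"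
  unfolding bad_early_def
proof (intro prob_disj_le prob_Bex_le)
  fix v assume v: "v \<in> nb u"
  then have vU: "v \<in> U" using nb_subset by blast
  have "measure_pmf.prob (Pi_pmf (early u) False P) {\<omega>. real (card {c\<in>S v. keeps \<omega> v c}) \<le> z + e * s - e * s}
      \<le> exp (- 2 * (e * s)\<^sup>2 / K)"
    using pos K_pos v by (intro many_kept vU late_early keep_keys_early mean_kept card_S) auto
  also have "\<dots> \<le> exp (- (2 * e\<^sup>2 * s\<^sup>2 / (49 * K)))"
    using pos K_pos by (simp add: power_mult_distrib field_simps)
  also have "\<dots> \<le> exp (- H)" by (rule exp_H[OF H(1)])
  finally show "measure_pmf.prob (Pi_pmf (early u) False P) {\<omega>. real (card {c\<in>S v. keeps \<omega> v c}) \<le> z} \<le> exp (- H)"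
    by simp
next
  have "measure_pmf.prob (Pi_pmf (early u) False P) {\<omega>. (\<Sum>c\<in>good u. \<delta> * card (nbc u c)) + e * d * s
       \<le> (\<Sum>c\<in>good u. real (card {v\<in>nbc u c. keeps \<omega> v c}))} \<le> exp (- 2 * (e * d * s)\<^sup>2 / (K * (7 * d)\<^sup>2))"
  proof (rule few_neighbours_keep[where b = "7 * d"])
    show "real (card (good u)) * (7 * d)\<^sup>2 \<le> K * (7 * d)\<^sup>2"
      using card_good[OF u] by (intro mult_right_mono) auto
  qed (use pos K_pos late_early keep_keys_early finite_good[OF u] in \<open>auto simp: good_def\<close>)
  also have "\<dots> = exp (- (2 * e\<^sup>2 * s\<^sup>2 / (49 * K)))"
    using pos K_pos by (simp add: power_mult_distrib field_simps)
  also have "\<dots> \<le> exp (- H)" by (rule exp_H[OF H(1)])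
  finally show "measure_pmf.prob (Pi_pmf (early u) False P) {\<omega>. (\<Sum>c\<in>good u. \<delta> * card (nbc u c)) + e * d * s
       \<le> (\<Sum>c\<in>good u. real (card {v\<in>nbc u c. keeps \<omega> v c}))} \<le> exp (- H)" .
qed simp

text \<open>
  The degrees \<open>card {v\<in>T c. stays v}\<close> are bounded for each color separately, regardless of whether \<open>u\<close>
  keeps \<open>c\<close>. This avoids the dependence between the two kinds of late events: after it, the new
  weight of \<open>u\<close> is at least a sum over colors in which only \<open>keeps u c\<close> is random.
\<close>

lemma prob_fails_late:
  assumes u: "u \<in> U" and \<omega>\<^sub>1: "\<not> bad_early u \<omega>\<^sub>1"
  shows "measure_pmf.prob (Pi_pmf (late u) False P) {\<omega>\<^sub>2. \<not> succeeds u (glue u \<omega>\<^sub>1 \<omega>\<^sub>2)}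
    \<le> exp (- H) + (card (good u) * exp (- H) + exp (- H))"
proof -
  define T where "T = (\<lambda>c. {v\<in>nbc u c. keeps \<omega>\<^sub>1 v c})"
  define y where "y = (\<lambda>c. max 0 (7 * d' - stay_bound * card (T c) - e * d))"
  let ?\<mu> = "\<Sum>c\<in>good u. \<sigma> u c * y c"
  define B1 where "B1 = (\<lambda>\<omega>\<^sub>2. stay_bound * card (nb u) + e * \<eta> \<le> real (card {v\<in>nb u. stays (glue u \<omega>\<^sub>1 \<omega>\<^sub>2) v}))"
  define B2 where "B2 = (\<lambda>c \<omega>\<^sub>2. stay_bound * card (T c) + e * d \<le> real (card {v\<in>T c. stays (glue u \<omega>\<^sub>1 \<omega>\<^sub>2) v}))"
  define B3 where "B3 = (\<lambda>\<omega>\<^sub>2. (\<Sum>c\<in>good u. of_bool (keeps (glue u \<omega>\<^sub>1 \<omega>\<^sub>2) u c) * y c) \<le> ?\<mu> - e * d * s)"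
  have zl: "z \<le> real (card {c\<in>S v. keeps \<omega>\<^sub>1 v c})" if "v \<in> nb u" for v
  proof (rule ccontr)
    assume "\<not> ?thesis"
    then have "real (card {c\<in>S v. keeps \<omega>\<^sub>1 v c}) \<le> z" by linarith
    then show False using \<omega>\<^sub>1 that unfolding bad_early_def by blast
  qed
  have Tsub: "T c \<subseteq> nb u" "T c \<subseteq> nbc u c" for c using nb_subset by (auto simp: T_def)
  have "measure_pmf.prob (Pi_pmf (late u) False P) {\<omega>\<^sub>2. B1 \<omega>\<^sub>2 \<or> (\<exists>c\<in>good u. B2 c \<omega>\<^sub>2) \<or> B3 \<omega>\<^sub>2}
      \<le> exp (- H) + (card (good u) * exp (- H) + exp (- H))"
  proof (intro prob_disj_le prob_Bex_le finite_good u)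
    have "card (nb u) \<le> \<eta>" by (rule degree_le[OF u])
    then have "measure_pmf.prob (Pi_pmf (late u) False P) {\<omega>\<^sub>2. B1 \<omega>\<^sub>2} \<le> exp (- 2 * (e * \<eta>)\<^sup>2 / \<eta>)"
      unfolding B1_def stay_bound_def using pos by (intro few_stay u zl) auto
    also have "\<dots> = exp (- (2 * e\<^sup>2 * \<eta>))" using pos by (simp add: power2_eq_square)
    also have "\<dots> \<le> exp (- H)" by (rule exp_H[OF H(3)])
    finally show "measure_pmf.prob (Pi_pmf (late u) False P) {\<omega>\<^sub>2. B1 \<omega>\<^sub>2} \<le> exp (- H)" .
  next
    fix c assume c: "c \<in> good u"
    have "card (T c) \<le> card (nbc u c)" using Tsub by (intro card_mono) auto
    then have "card (T c) \<le> 7 * d" using c by (auto simp: good_def)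
    then have "measure_pmf.prob (Pi_pmf (late u) False P) {\<omega>\<^sub>2. B2 c \<omega>\<^sub>2} \<le> exp (- 2 * (e * d)\<^sup>2 / (7 * d))"
      unfolding B2_def stay_bound_def using pos by (intro few_stay u zl Tsub) auto
    also have "\<dots> = exp (- (2 * e\<^sup>2 * d / 7))" using pos by (simp add: power2_eq_square)
    also have "\<dots> \<le> exp (- H)" by (rule exp_H[OF H(2)])
    finally show "measure_pmf.prob (Pi_pmf (late u) False P) {\<omega>\<^sub>2. B2 c \<omega>\<^sub>2} \<le> exp (- H)" .
  next
    have "y c \<le> 7 * d" for c
    proof -
      have "0 \<le> stay_bound * card (T c)" "0 \<le> e * d" using stay_bound_le pos by auto
      then show ?thesis using d'_bounds unfolding y_def by linarith
    qed
    then have "measure_pmf.prob (Pi_pmf (late u) False P) {\<omega>\<^sub>2. B3 \<omega>\<^sub>2} \<le> exp (- 2 * (e * d * s)\<^sup>2 / (K * (7 * d)\<^sup>2))"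
      unfolding B3_def
    proof (intro palette_weight_kept[where b = "7 * d"] u)
      show "real (card (good u)) * (7 * d)\<^sup>2 \<le> K * (7 * d)\<^sup>2"
        using card_good[OF u] by (intro mult_right_mono) auto
    qed (use pos K_pos in \<open>auto simp: good_def y_def\<close>)
    also have "\<dots> = exp (- (2 * e\<^sup>2 * s\<^sup>2 / (49 * K)))"
      using pos K_pos by (simp add: power_mult_distrib field_simps)
    also have "\<dots> \<le> exp (- H)" by (rule exp_H[OF H(1)])
    finally show "measure_pmf.prob (Pi_pmf (late u) False P) {\<omega>\<^sub>2. B3 \<omega>\<^sub>2} \<le> exp (- H)" .
  qed
  moreover have "succeeds u (glue u \<omega>\<^sub>1 \<omega>\<^sub>2)"
    if no: "\<not> B1 \<omega>\<^sub>2" "\<forall>c\<in>good u. \<not> B2 c \<omega>\<^sub>2" "\<not> B3 \<omega>\<^sub>2" for \<omega>\<^sub>2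
  proof -
    let ?\<omega> = "glue u \<omega>\<^sub>1 \<omega>\<^sub>2"
    have "real (card {v\<in>nb u. stays ?\<omega> v}) \<le> (x - e') * (\<eta> * (1 - a))"
      using no(1) degree[OF u] by (intro degree_step[of _ "card (nb u)"]) (auto simp: B1_def)
    moreover have "6 * (x - e') * d' * (s * \<delta>) \<le>
        (\<Sum>c\<in>S u. of_bool (keeps ?\<omega> u c) * max 0 (7 * d' - card {v\<in>nbc u c. stays ?\<omega> v \<and> keeps ?\<omega> v c}))"
    proof (rule weight_step[OF u, of "\<lambda>c. card (T c)"])
      show "(\<Sum>c\<in>good u. real (card (T c))) \<le> (\<Sum>c\<in>good u. \<delta> * card (nbc u c)) + e * d * s"
        using \<omega>\<^sub>1 unfolding bad_early_def T_def by linarith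
      have "?\<mu> - e * d * s \<le> (\<Sum>c\<in>good u. of_bool (keeps ?\<omega> u c) * y c)"
        using no(3) by (simp add: B3_def)
      also have "\<dots> \<le> (\<Sum>c\<in>good u. of_bool (keeps ?\<omega> u c) * max 0 (7 * d' - card {v\<in>nbc u c. stays ?\<omega> v \<and> keeps ?\<omega> v c}))"
      proof (intro sum_mono mult_left_mono)
        fix c assume c: "c \<in> good u"
        have "{v\<in>nbc u c. stays ?\<omega> v \<and> keeps ?\<omega> v c} = {v\<in>T c. stays ?\<omega> v}"
          using keeps_glue_nb nb_subset(2) by (auto simp: T_def)
        then show "y c \<le> max 0 (7 * d' - card {v\<in>nbc u c. stays ?\<omega> v \<and> keeps ?\<omega> v c})"
          using no(2) c by (auto simp: y_def B2_def)
      qed auto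
      also have "\<dots> \<le> (\<Sum>c\<in>S u. of_bool (keeps ?\<omega> u c) * max 0 (7 * d' - card {v\<in>nbc u c. stays ?\<omega> v \<and> keeps ?\<omega> v c}))"
        using finite_S[OF u] by (intro sum_mono2) (auto simp: good_def)
      finally show "(\<Sum>c\<in>good u. \<sigma> u c * max 0 (7 * d' - stay_bound * card (T c) - e * d)) - e * d * s \<le>
          (\<Sum>c\<in>S u. of_bool (keeps ?\<omega> u c) * max 0 (7 * d' - card {v\<in>nbc u c. stays ?\<omega> v \<and> keeps ?\<omega> v c}))"
        by (simp add: y_def)
    qed
    ultimately show ?thesis by (simp add: succeeds_def)
  qed
  then have "{\<omega>\<^sub>2. \<not> succeeds u (glue u \<omega>\<^sub>1 \<omega>\<^sub>2)} \<subseteq> {\<omega>\<^sub>2. B1 \<omega>\<^sub>2 \<or> (\<exists>c\<in>good u. B2 c \<omega>\<^sub>2) \<or> B3 \<omega>\<^sub>2}"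
    by auto
  then have "measure_pmf.prob (Pi_pmf (late u) False P) {\<omega>\<^sub>2. \<not> succeeds u (glue u \<omega>\<^sub>1 \<omega>\<^sub>2)} \<le>
      measure_pmf.prob (Pi_pmf (late u) False P) {\<omega>\<^sub>2. B1 \<omega>\<^sub>2 \<or> (\<exists>c\<in>good u. B2 c \<omega>\<^sub>2) \<or> B3 \<omega>\<^sub>2}"
    by (intro measure_pmf.finite_measure_mono) auto
  ultimately show ?thesis by linarith
qed

lemma prob_round_fails:
  "measure_pmf.prob (Pi_pmf J False P) {\<omega>. \<exists>u\<in>U. \<not> succeeds u \<omega>} \<le> card U * ((\<eta> + K + 3) * exp (- H))"
proof (intro prob_Bex_le finite_U)
  fix u assume u: "u \<in> U"
  have "measure_pmf.prob (Pi_pmf (early u \<union> late u) False P) {\<omega>. \<not> succeeds u \<omega>} \<le>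
      (card (nb u) * exp (- H) + exp (- H)) + (exp (- H) + (card (good u) * exp (- H) + exp (- H)))"
    using prob_fails_late[OF u] prob_bad_early[OF u]
    by (intro prob_Pi_pmf_union_le[where B = "bad_early u"] late_early) (auto simp: glue_def)
  also have "\<dots> = (card (nb u) + card (good u) + 3) * exp (- H)" by (simp add: algebra_simps)
  also have "\<dots> \<le> (\<eta> + K + 3) * exp (- H)"
  proof (intro mult_right_mono)
    have "card (nb u) \<le> \<eta>" by (rule degree_le[OF u])
    then show "real (card (nb u) + card (good u) + 3) \<le> \<eta> + K + 3"
      using card_good(2)[OF u] by simp
  qed auto
  finally show "measure_pmf.prob (Pi_pmf J False P) {\<omega>. \<not> succeeds u \<omega>} \<le> (\<eta> + K + 3) * exp (- H)"
    by (simp add: late_early)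
qed

end


section \<open>Evaluating randomized programs with a clock\<close>

lemma ret_eval: "ret x t = return_spmf (x, t)" by (simp add: ret_def)
lemma charge_eval: "charge k t = return_spmf ((), t + k)" by (simp add: charge_def)

lemma bind_timed_eval: "m t = return_spmf (x, t') \<Longrightarrow> bind_timed m f t = f x t'"
  by (simp add: bind_timed_def)

lemma bind_timed_pmf:
  assumes "m t = bind_pmf M (\<lambda>\<omega>. return_spmf (h \<omega>, k \<omega>))"
  shows "bind_timed m f t = bind_pmf M (\<lambda>\<omega>. f (h \<omega>) (k \<omega>))"
  using assms by (simp add: bind_timed_def bind_spmf_def bind_assoc_pmf bind_return_pmf)

lemma filter_timed_det:
  assumes "\<And>x t. x \<in> set xs \<Longrightarrow> Q x t = return_spmf (b x, t + k)"
  shows "filter_timed Q xs t = return_spmf (filter b xs, t + length xs * (k + 1))"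
  using assms
proof (induction xs arbitrary: t)
  case (Cons x xs)
  have "filter_timed Q xs t' = return_spmf (filter b xs, t' + length xs * (k + 1))" for t'
    using Cons by simp
  then show ?case using Cons.prems[of x]
    by (simp add: bind_timed_def charge_eval ret_eval algebra_simps)
qed (simp add: ret_eval)

lemma select_eval: "select b xs t = return_spmf (filter b xs, t + length xs)"
  using filter_timed_det[of xs "\<lambda>x. ret (b x)" b 0 t] by (simp add: ret_eval)

lemma for_each_det:
  assumes "\<And>x s t. x \<in> set xs \<Longrightarrow> f x s t = return_spmf (g x s, t + k x)"
  shows "for_each xs f s t = return_spmf (fold g xs s, t + (\<Sum>x\<leftarrow>xs. k x + 1))"
  using assms
proof (induction xs arbitrary: s t)
  case (Cons x xs)
  have "for_each xs f s' t' = return_spmf (fold g xs s', t' + (\<Sum>x\<leftarrow>xs. k x + 1))" for s' t'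
    using Cons by simp
  then show ?case using Cons.prems[of x]
    by (simp add: bind_timed_def charge_eval algebra_simps)
qed (simp add: ret_eval)

text \<open>
  Flipping coins one after the other amounts to reading them off a table drawn in advance. The table
  may have more entries than are read.
\<close>

lemma filter_flips:
  fixes C :: "'b list"
  assumes "finite I" "inj_on \<kappa> (set C)" "\<kappa> ` set C \<subseteq> I" "distinct C"
  shows "filter_timed (\<lambda>c. bind_timed (charge k) (\<lambda>_. flip (b (\<kappa> c)))) C t =
    bind_pmf (Pi_pmf I False (\<lambda>i. bernoulli_pmf (b i)))
      (\<lambda>B. return_spmf (filter (\<lambda>c. B (\<kappa> c)) C, t + length C * (k + 2)))"
  using assms
proof (induction C arbitrary: t I)
  case (Cons c C)
  let ?P = "\<lambda>i. bernoulli_pmf (b i)"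
  define I' where "I' = I - {\<kappa> c}"
  have I: "I = insert (\<kappa> c) I'" "\<kappa> c \<notin> I'" "finite I'" using Cons.prems by (auto simp: I'_def)
  have c: "\<kappa> c' \<noteq> \<kappa> c" if "c' \<in> set C" for c'
    using that Cons.prems by (auto simp: inj_on_def)
  then have "\<kappa> ` set C \<subseteq> I'" using Cons.prems by (auto simp: I'_def)
  then have IH: "filter_timed (\<lambda>c. bind_timed (charge k) (\<lambda>_. flip (b (\<kappa> c)))) C t' =
    bind_pmf (Pi_pmf I' False ?P) (\<lambda>B. return_spmf (filter (\<lambda>c. B (\<kappa> c)) C, t' + length C * (k + 2)))" for t'
    using Cons.prems I by (intro Cons.IH) auto
  have filt: "filter (\<lambda>c'. (f(\<kappa> c := y)) (\<kappa> c')) C = filter (\<lambda>c'. f (\<kappa> c')) C" for f y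
    using c by (intro filter_cong) auto
  have flip: "bind_timed (bind_timed (charge k) (\<lambda>_. flip r)) F t' =
      bind_pmf (bernoulli_pmf r) (\<lambda>y. F y (t' + k + 1))" for r t' and F :: "bool \<Rightarrow> 'b list timed"
    by (rule bind_timed_pmf[where h = "\<lambda>y. y" and k = "\<lambda>_. t' + k + 1"])
      (simp add: bind_timed_eval[OF charge_eval] flip_def map_spmf_conv_bind_spmf)
  have rest: "bind_timed (filter_timed (\<lambda>c. bind_timed (charge k) (\<lambda>_. flip (b (\<kappa> c)))) C) F t' =
      bind_pmf (Pi_pmf I' False ?P) (\<lambda>B. F (filter (\<lambda>c. B (\<kappa> c)) C) (t' + length C * (k + 2)))"
    for t' and F :: "'b list \<Rightarrow> 'b list timed"
    by (rule bind_timed_pmf) (rule IH)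
  have "filter_timed (\<lambda>c. bind_timed (charge k) (\<lambda>_. flip (b (\<kappa> c)))) (c # C) t =
     bind_pmf (bernoulli_pmf (b (\<kappa> c))) (\<lambda>y. bind_pmf (Pi_pmf I' False ?P) (\<lambda>f.
       return_spmf (if y then c # filter (\<lambda>c. f (\<kappa> c)) C else filter (\<lambda>c. f (\<kappa> c)) C,
         t + length (c # C) * (k + 2))))"
    unfolding filter_timed.simps bind_timed_eval[OF charge_eval] flip rest
    by (simp add: ret_eval algebra_simps)
  also have "\<dots> = bind_pmf (Pi_pmf I False ?P)
      (\<lambda>B. return_spmf (filter (\<lambda>c. B (\<kappa> c)) (c # C), t + length (c # C) * (k + 2)))"
    unfolding I(1) Pi_pmf_insert'[OF I(3,2)]
    by (simp add: bind_assoc_pmf bind_return_pmf filt del: fun_upd_apply) 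
       (intro bind_pmf_cong refl, auto intro!: filter_cong simp: c)
  finally show ?case .
qed (simp add: ret_eval bind_pmf_const)

text \<open>
  If each iteration reads its own part of the table of coins, the table for the whole loop can be
  drawn in advance. The cost of an iteration is allowed to depend on the coins.
\<close>

lemma for_each_flips:
  assumes "\<And>x. x \<in> set xs \<Longrightarrow> finite (I x)" "disjoint_family_on I (set xs)" "distinct xs"
    and f: "\<And>x s t. x \<in> set xs \<Longrightarrow> f x s t =
       bind_pmf (Pi_pmf (I x) False P) (\<lambda>B. return_spmf (g B x s, t + k B x))"
    and dep: "\<And>x B B'. x \<in> set xs \<Longrightarrow> (\<And>i. i \<in> I x \<Longrightarrow> B i = B' i) \<Longrightarrow> g B x = g B' x \<and> k B x = k B' x"
  shows "for_each xs f s t = bind_pmf (Pi_pmf (\<Union>x\<in>set xs. I x) False P)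
     (\<lambda>B. return_spmf (fold (g B) xs s, t + (\<Sum>x\<leftarrow>xs. k B x + 1)))"
  using assms
proof (induction xs arbitrary: s t)
  case Nil
  show ?case by (simp add: ret_eval bind_pmf_const)
next
  case (Cons x xs)
  define I' where "I' = (\<Union>x\<in>set xs. I x)"
  have fin: "finite (I x)" "finite I'" using Cons.prems(1) by (auto simp: I'_def)
  have disj: "I x \<inter> I' = {}" using Cons.prems(2,3) by (auto simp: I'_def disjoint_family_on_def)
  have disj': "disjoint_family_on I (set xs)" using Cons.prems(2) by (auto simp: disjoint_family_on_def)
  have IH: "for_each xs f s t = bind_pmf (Pi_pmf I' False P)
     (\<lambda>B. return_spmf (fold (g B) xs s, t + (\<Sum>x\<leftarrow>xs. k B x + 1)))" for s t
    unfolding I'_def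
  proof (rule Cons.IH[OF _ disj'])
    show "g B y = g B' y \<and> k B y = k B' y" if "y \<in> set xs" "\<And>i. i \<in> I y \<Longrightarrow> B i = B' i" for y B B'
      by (rule Cons.prems(5)) (use that in auto)
  qed (use Cons.prems(1,3,4) in auto)
  let ?m = "\<lambda>B B' i. if i \<in> I x then B i else B' i"
  have rest: "g (?m B B') y = g B' y \<and> k (?m B B') y = k B' y" if "y \<in> set xs" for B B' y
    by (rule Cons.prems(5)) (use that disj in \<open>auto simp: I'_def\<close>)
  have fold: "fold (g (?m B B')) xs s = fold (g B') xs s" for B B' s
    by (intro fold_cong refl) (use rest in blast)
  have kk: "(\<Sum>y\<leftarrow>xs. k (?m B B') y + 1) = (\<Sum>y\<leftarrow>xs. k B' y + 1)" for B B'
    by (intro arg_cong[where f = sum_list] map_cong refl arg_cong2[where f = "(+)"]) (use rest in blast)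
  have "g (?m B B') x = g B x \<and> k (?m B B') x = k B x" for B B'
    by (rule Cons.prems(5)) auto
  then have x: "g (?m B B') x = g B x" "k (?m B B') x = k B x" for B B'
    by blast+
  have "for_each (x # xs) f s t = bind_pmf (Pi_pmf (I x) False P) (\<lambda>B.
     bind_pmf (Pi_pmf I' False P) (\<lambda>B'.
       return_spmf (fold (g B') xs (g B x s), t + (k B x + 1 + (\<Sum>x\<leftarrow>xs. k B' x + 1)))))"
    using Cons.prems(4)[of x]
    by (simp add: bind_timed_def charge_eval IH bind_spmf_def bind_assoc_pmf bind_return_pmf algebra_simps)
  also have "\<dots> = bind_pmf (Pi_pmf (I x \<union> I') False P)
     (\<lambda>B. return_spmf (fold (g B) (x # xs) s, t + (\<Sum>x\<leftarrow>x # xs. k B x + 1)))"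
    unfolding Pi_pmf_union[OF fin disj] pair_pmf_def map_pmf_def
    by (simp only: bind_assoc_pmf bind_return_pmf prod.case fold list.map sum_list.Cons kk x fold_simps)
  also have "I x \<union> I' = (\<Union>x\<in>set (x # xs). I x)" by (simp add: I'_def)
  finally show ?case .
qed

lemma Pi_pmf_Plus:
  assumes "finite A" "finite B"
  shows "Pi_pmf (A <+> B) d (case_sum f g) =
    map_pmf (\<lambda>(x, y). case_sum x y) (pair_pmf (Pi_pmf A d f) (Pi_pmf B d g))"
proof (rule pmf_eqI)
  fix h :: "'a + 'b \<Rightarrow> 'c"
  let ?M = "pair_pmf (Pi_pmf A d f) (Pi_pmf B d g)" and ?c = "\<lambda>(x, y). case_sum x y"
  have inj: "inj (?c :: ('a \<Rightarrow> 'c) \<times> ('b \<Rightarrow> 'c) \<Rightarrow> _)"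
  proof (rule injI)
    fix x y :: "('a \<Rightarrow> 'c) \<times> ('b \<Rightarrow> 'c)" assume "?c x = ?c y"
    then have "?c x (Inl i) = ?c y (Inl i)" "?c x (Inr j) = ?c y (Inr j)" for i j by auto
    then have "fst x i = fst y i" "snd x j = snd y j" for i j
      by (simp_all add: case_prod_beta)
    then show "x = y" by (simp add: prod_eq_iff fun_eq_iff)
  qed
  have h: "h = ?c (h \<circ> Inl, h \<circ> Inr)" by (auto simp: fun_eq_iff split: sum.splits)
  have "pmf (map_pmf ?c ?M) h = pmf ?M (h \<circ> Inl, h \<circ> Inr)"
    by (subst h) (rule pmf_map_inj'[OF inj])
  also have "\<dots> = pmf (Pi_pmf (A <+> B) d (case_sum f g)) h"
  proof -
    have "(\<Prod>x\<in>A <+> B. pmf (case_sum f g x) (h x)) = (\<Prod>x\<in>A. pmf (f x) (h (Inl x))) * (\<Prod>x\<in>B. pmf (g x) (h (Inr x)))"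
      using assms unfolding Plus_def
      by (subst prod.union_disjoint) (auto simp: prod.reindex)
    moreover have "(\<forall>x. x \<notin> A <+> B \<longrightarrow> h x = d) \<longleftrightarrow> (\<forall>x. x \<notin> A \<longrightarrow> h (Inl x) = d) \<and> (\<forall>x. x \<notin> B \<longrightarrow> h (Inr x) = d)"
      by (metis Inl_Inr_False PlusE InlI InrI sum.exhaust sum.inject)
    ultimately show ?thesis
      using assms by (auto simp: pmf_pair pmf_Pi)
  qed
  finally show "pmf (Pi_pmf (A <+> B) d (case_sum f g)) h = pmf (map_pmf ?c ?M) h" ..
qed

text \<open>
  A judgement on results and clock readings that permits failure, including divergence, with
  probability \<open>r\<close>.
\<close>

definition achieves :: "'a timed \<Rightarrow> nat \<Rightarrow> ('a \<Rightarrow> nat \<Rightarrow> bool) \<Rightarrow> real \<Rightarrow> bool" where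
  "achieves m t Q r \<longleftrightarrow> measure (measure_spmf (m t)) {(x, t'). Q x t'} \<ge> 1 - r"

lemma achieves_return:
  assumes "m t = return_spmf (x, t')" "Q x t'" "0 \<le> r"
  shows "achieves m t Q r"
  using assms by (simp add: achieves_def measure_spmf_return_spmf measure_return)

lemma achieves_pmf:
  assumes "m t = bind_pmf M (\<lambda>\<omega>. return_spmf (h \<omega>, k \<omega>))"
    and "measure_pmf.prob M {\<omega>. \<not> Q (h \<omega>) (k \<omega>)} \<le> r"
  shows "achieves m t Q r"
proof -
  have "measure (measure_spmf (m t)) {(x, t'). Q x t'} = measure_pmf.prob M {\<omega>. Q (h \<omega>) (k \<omega>)}"
    unfolding assms(1) bind_pmf_return_spmf by (simp add: vimage_def)
  also have "\<dots> = 1 - measure_pmf.prob M {\<omega>. \<not> Q (h \<omega>) (k \<omega>)}"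
  proof -
    have "{\<omega>. Q (h \<omega>) (k \<omega>)} = space (measure_pmf M) - {\<omega>. \<not> Q (h \<omega>) (k \<omega>)}" by auto
    then show ?thesis
      using measure_pmf.prob_compl[of "{\<omega>. \<not> Q (h \<omega>) (k \<omega>)}" M] by simp
  qed
  finally show ?thesis using assms(2) by (simp add: achieves_def)
qed

lemma achieves_mono:
  assumes "achieves m t Q r" "\<And>x t'. Q x t' \<Longrightarrow> Q' x t'" "r \<le> r'"
  shows "achieves m t Q' r'"
proof -
  have "measure (measure_spmf (m t)) {(x, t'). Q x t'} \<le> measure (measure_spmf (m t)) {(x, t'). Q' x t'}"
    using assms(2) by (intro measure_spmf.finite_measure_mono) auto
  then show ?thesis using assms(1,3) by (simp add: achieves_def)
qed

lemma achieves_bind_spmf: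
  fixes m :: "('a \<times> nat) spmf"
  assumes 1: "measure (measure_spmf m) {(x, t'). Q x t'} \<ge> 1 - r1"
    and 2: "\<And>x t'. Q x t' \<Longrightarrow> measure (measure_spmf (f x t')) A \<ge> 1 - r2" and r: "0 \<le> r2"
  shows "measure (measure_spmf (bind_spmf m (\<lambda>(x, t'). f x t'))) A \<ge> 1 - (r1 + r2)"
proof -
  let ?S = "{(x, t'). Q x t'}" and ?f = "\<lambda>(x, t'). f x t'"
  have le1: "measure (measure_spmf m) ?S \<le> 1" by (rule measure_spmf.subprob_measure_le_1)
  show ?thesis
  proof (cases "r2 \<le> 1")
    case True
    have "1 - (r1 + r2) \<le> (1 - r2) * measure (measure_spmf m) ?S"
    proof -
      have "(1 - r2) * (1 - r1) \<le> (1 - r2) * measure (measure_spmf m) ?S"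
        using True 1 by (intro mult_left_mono) auto
      moreover have "0 \<le> r1 * r2" using 1 le1 r by simp
      ultimately show ?thesis by (simp add: algebra_simps)
    qed
    also have "\<dots> = (\<integral>y. (1 - r2) * indicator ?S y \<partial>measure_spmf m)" by simp
    also have "\<dots> \<le> (\<integral>y. measure (measure_spmf (?f y)) A \<partial>measure_spmf m)"
    proof (rule integral_mono)
      show "integrable (measure_spmf m) (\<lambda>y. (1 - r2) * indicator ?S y)"
        by (intro measure_spmf.integrable_const_bound[of _ "1"]) (use r True in \<open>auto split: split_indicator\<close>)
      show "integrable (measure_spmf m) (\<lambda>y. measure (measure_spmf (?f y)) A)"
        by (intro measure_spmf.integrable_const_bound[of _ "1"]) (auto simp: measure_spmf.subprob_measure_le_1)
      show "(1 - r2) * indicator ?S y \<le> measure (measure_spmf (?f y)) A" for y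
        using 2 by (cases y) (auto split: split_indicator)
    qed
    also have "\<dots> = measure (measure_spmf (bind_spmf m ?f)) A"
      by (simp add: measure_spmf_bind o_def measure_spmf.measure_bind[where N = "count_space UNIV"])
    finally show ?thesis .
  next
    case False
    moreover have "0 \<le> r1" using 1 le1 by simp
    ultimately have "1 - (r1 + r2) \<le> 0" by simp
    then show ?thesis by (meson measure_nonneg order_trans)
  qed
qed

lemma achieves_bind:
  assumes "achieves m t Q r1" "\<And>x t'. Q x t' \<Longrightarrow> achieves (f x) t' R r2" "0 \<le> r2"
  shows "achieves (bind_timed m f) t R (r1 + r2)"
  unfolding achieves_def bind_timed_def
  by (rule achieves_bind_spmf[where Q = Q]) (use assms in \<open>auto simp: achieves_def\<close>)

lemma while_timed_stop: "\<not> g s \<Longrightarrow> while_timed g f s t = return_spmf (s, t + 1)"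
  by (subst while_timed.simps) simp

text \<open>
  The invariant counts the rounds; \<open>T\<close> bounds the count whenever the guard holds. The last unit of
  time is the charge for the failing test.
\<close>

lemma achieves_while:
  assumes step: "\<And>i s t. i < T \<Longrightarrow> Inv i s t \<Longrightarrow> g s \<Longrightarrow> achieves (f s) (t + 1) (Inv (Suc i)) r"
    and bound: "\<And>i s t. Inv i s t \<Longrightarrow> g s \<Longrightarrow> i < T" and r: "0 \<le> r"
    and init: "Inv i s t" "i \<le> T"
  shows "achieves (while_timed g f s) t (\<lambda>s' t'. \<exists>j\<le>T. \<exists>t0. Inv j s' t0 \<and> \<not> g s' \<and> t' = t0 + 1) (real (T - i) * r)"
  using init
proof (induction "T - i" arbitrary: i s t)
  case 0
  then have "\<not> g s" using bound by fastforce
  then show ?case using 0 by (intro achieves_return[OF while_timed_stop]) auto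
next
  case (Suc n)
  show ?case
  proof (cases "g s")
    case False
    then show ?thesis using Suc.prems r by (intro achieves_return[OF while_timed_stop]) auto
  next
    case True
    then have i: "i < T" using bound Suc.prems by blast
    let ?Q = "\<lambda>s' t'. \<exists>j\<le>T. \<exists>t0. Inv j s' t0 \<and> \<not> g s' \<and> t' = t0 + 1"
    have "while_timed g f s t = bind_spmf (f s (t + 1)) (\<lambda>(s', t'). while_timed g f s' t')"
      using True by (subst while_timed.simps) simp
    moreover have "achieves (while_timed g f s') t' ?Q (real (T - Suc i) * r)" if "Inv (Suc i) s' t'" for s' t'
      using Suc.hyps i that by (intro Suc.hyps(1)) auto
    then have "measure (measure_spmf (bind_spmf (f s (t + 1)) (\<lambda>(s', t'). while_timed g f s' t'))) {(s', t'). ?Q s' t'}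
        \<ge> 1 - (r + real (T - Suc i) * r)"
      using step[OF i Suc.prems(1) True] r unfolding achieves_def
      by (intro achieves_bind_spmf[where Q = "Inv (Suc i)"]) auto
    moreover have "r + real (T - Suc i) * r = real (T - i) * r"
      using i by (simp add: Suc_diff_Suc of_nat_diff algebra_simps)
    ultimately show ?thesis by (simp add: achieves_def)
  qed
qed


section \<open>Effect of the phases on the state\<close>

text \<open>
  The coloring is proper so far, and a color that has been used at a vertex is missing from the
  palettes of its uncolored neighbors.
\<close>

definition valid :: "(nat \<Rightarrow> nat \<Rightarrow> bool) \<Rightarrow> nat \<Rightarrow> state \<Rightarrow> bool" where
  "valid E K st \<longleftrightarrow> (\<forall>u. pal st u \<subseteq> {1..K}) \<and>
     (\<forall>u v c. E u v \<longrightarrow> col st u = Some c \<longrightarrow> col st v \<noteq> Some c \<and> (col st v = None \<longrightarrow> c \<notin> pal st v))"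

lemma validD:
  assumes "valid E K st"
  shows "pal st u \<subseteq> {1..K}" "finite (pal st u)" "card (pal st u) \<le> K"
proof -
  show *: "pal st u \<subseteq> {1..K}" using assms by (auto simp: valid_def)
  then show "finite (pal st u)" by (rule finite_subset) simp
  show "card (pal st u) \<le> K" using card_mono[OF _ *] by simp
qed

lemma fold_assign_colors:
  fixes R X :: "nat \<Rightarrow> nat list"
  assumes "distinct us" "choice_rule pick"
  defines "g \<equiv> (\<lambda>u st'. st'\<lparr>pal := (pal st')(u := set (R u)),
       col := (if X u = [] then col st' else (col st')(u := Some (pick st' u (set (X u)))))\<rparr>)"
  shows "pal (fold g us st) u = (if u \<in> set us then set (R u) else pal st u)"
    and "u \<notin> set us \<Longrightarrow> col (fold g us st) u = col st u"
    and "X u = [] \<Longrightarrow> col (fold g us st) u = col st u"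
    and "u \<in> set us \<Longrightarrow> X u \<noteq> [] \<Longrightarrow> \<exists>c\<in>set (X u). col (fold g us st) u = Some c"
proof -
  have "pal (fold g us st) u = (if u \<in> set us then set (R u) else pal st u) \<and>
    (u \<notin> set us \<longrightarrow> col (fold g us st) u = col st u) \<and>
    (X u = [] \<longrightarrow> col (fold g us st) u = col st u) \<and>
    (u \<in> set us \<longrightarrow> X u \<noteq> [] \<longrightarrow> (\<exists>c\<in>set (X u). col (fold g us st) u = Some c))"
    using assms(1)
  proof (induction us arbitrary: st)
    case (Cons w us)
    have pick: "pick st w (set (X w)) \<in> set (X w)" if "X w \<noteq> []"
      using assms(2) that by (auto simp: choice_rule_def)
    have gp: "pal (g w st) = (pal st)(w := set (R w))" by (simp add: g_def)
    have gc: "col (g w st) = (if X w = [] then col st else (col st)(w := Some (pick st w (set (X w)))))"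
      by (simp add: g_def)
    have d: "w \<notin> set us" "distinct us" using Cons.prems by auto
    note IH = Cons.IH[OF d(2), of "g w st"]
    show ?case
    proof (cases "u = w")
      case True
      then show ?thesis using IH d(1) pick unfolding gp gc by (cases "X w = []") auto
    next
      case False
      then have "pal (g w st) u = pal st u" "col (g w st) u = col st u" unfolding gp gc by auto
      then show ?thesis using IH False by simp
    qed
  qed simp
  then show "pal (fold g us st) u = (if u \<in> set us then set (R u) else pal st u)"
    and "u \<notin> set us \<Longrightarrow> col (fold g us st) u = col st u"
    and "X u = [] \<Longrightarrow> col (fold g us st) u = col st u"
    and "u \<in> set us \<Longrightarrow> X u \<noteq> [] \<Longrightarrow> \<exists>c\<in>set (X u). col (fold g us st) u = Some c"
    by blast+
qed

lemma fold_set_palettes: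
  fixes st :: state
  assumes "distinct us"
  shows "pal (fold (\<lambda>u st'. st'\<lparr>pal := (pal st')(u := R u)\<rparr>) us st) u = (if u \<in> set us then R u else pal st u)"
    and "col (fold (\<lambda>u st'. st'\<lparr>pal := (pal st')(u := R u)\<rparr>) us st) = col st"
proof -
  define g :: "nat \<Rightarrow> state \<Rightarrow> state" where "g = (\<lambda>u st'. st'\<lparr>pal := (pal st')(u := R u)\<rparr>)"
  have g: "pal (g w st) = (pal st)(w := R w)" "col (g w st) = col st" for w st by (simp_all add: g_def)
  have "pal (fold g us st) u = (if u \<in> set us then R u else pal st u) \<and> col (fold g us st) = col st"
    using assms
  proof (induction us arbitrary: st)
    case (Cons w us)
    then have "w \<notin> set us" "distinct us" by auto
    then show ?case using Cons.IH[of "g w st"] by (simp add: g)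
  qed simp
  then show "pal (fold (\<lambda>u st'. st'\<lparr>pal := (pal st')(u := R u)\<rparr>) us st) u = (if u \<in> set us then R u else pal st u)"
    and "col (fold (\<lambda>u st'. st'\<lparr>pal := (pal st')(u := R u)\<rparr>) us st) = col st"
    unfolding g_def by blast+
qed

definition free_nbs :: "(nat \<Rightarrow> nat \<Rightarrow> bool) \<Rightarrow> state \<Rightarrow> nat \<Rightarrow> nat set" where
  "free_nbs E st u = {v. E u v \<and> col st v = None}"

text \<open>
  Of the cleanup it matters what it keeps: as \<open>\<gamma> \<ge> 1\<close>, every color with \<open>d(u,c) < q d'\<close>.
\<close>

lemma phase_three_eval:
  assumes E: "\<And>u. finite {v. E u v}" "\<And>u. u \<in> set us \<Longrightarrow> card {v. E u v} \<le> \<Delta>"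
    and pal: "\<And>u. finite (pal st u)" "\<And>u. card (pal st u) \<le> K" and us: "distinct us"
    and q: "0 < q" and d': "0 \<le> d'"
  obtains R k where
    "phase_three E q d' s' us st t =
       return_spmf (fold (\<lambda>u st'. st'\<lparr>pal := (pal st')(u := R u)\<rparr>) us st, t + k)"
    "k \<le> length us * (\<Delta> + 2 * (K * (\<Delta> + 1)) + 1)"
    "\<And>u. R u \<subseteq> pal st u"
    "\<And>u c. c \<in> pal st u \<Longrightarrow> real (card {v \<in> free_nbs E st u. c \<in> pal st v}) < q * d' \<Longrightarrow> c \<in> R u"
proof -
  define N where "N = (\<lambda>u. filter (\<lambda>v. col st v = None) (enum {v. E u v}))"
  define total where "total = (\<lambda>u. fold (\<lambda>c a. a + length (filter (\<lambda>v. c \<in> pal st v) (N u))) (enum (pal st u)) 0)"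
  define al where "al = (\<lambda>u. max 0 (min (1 / q) (1 - real (card (pal st u)) / s')))"
  define avg where "avg = (\<lambda>u. real (total u) / real (card (pal st u)))"
  define L where "L = (\<lambda>u. filter (\<lambda>c. \<not> (\<exists>\<gamma>. is_gamma q (al u) (avg u) d' \<gamma> \<and>
      real (length (filter (\<lambda>v. c \<in> pal st v) (N u))) \<ge> q * \<gamma> * d')) (enum (pal st u)))"
  define k where "k = (\<lambda>u. length (enum {v. E u v}) +
      ((\<Sum>c\<leftarrow>enum (pal st u). length (N u) + 1) + length (enum (pal st u)) * (length (N u) + 1)))"
  have "phase_three E q d' s' us st t =
      return_spmf (fold (\<lambda>u st'. st'\<lparr>pal := (pal st')(u := set (L u))\<rparr>) us st, t + (\<Sum>u\<leftarrow>us. k u + 1))"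
    unfolding phase_three_def
  proof (rule for_each_det, goal_cases)
    case (1 u st' t)
    have N: "filter (\<lambda>v. col st v = None) (enum {v. E u v}) = N u"
      and al: "max 0 (min (1 / q) (1 - real (card (pal st u)) / s')) = al u"
      and avg: "real (total u) / real (card (pal st u)) = avg u"
      by (simp_all add: N_def al_def avg_def)
    have tot: "for_each (enum (pal st u)) (\<lambda>c a. bind_timed (select (\<lambda>v. c \<in> pal st v) (N u)) (\<lambda>D. ret (a + length D))) 0 t' =
        return_spmf (total u, t' + (\<Sum>c\<leftarrow>enum (pal st u). length (N u) + 1))" for t'
      unfolding total_def by (rule for_each_det) (simp add: bind_timed_eval[OF select_eval] ret_eval)
    have flt: "filter_timed (\<lambda>c. bind_timed (select (\<lambda>v. c \<in> pal st v) (N u))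
         (\<lambda>D. ret (\<not> (\<exists>\<gamma>. is_gamma q (al u) (avg u) d' \<gamma> \<and> real (length D) \<ge> q * \<gamma> * d')))) (enum (pal st u)) t' =
        return_spmf (L u, t' + length (enum (pal st u)) * (length (N u) + 1))" for t'
      unfolding L_def by (rule filter_timed_det) (simp add: bind_timed_eval[OF select_eval] ret_eval)
    have tot': "bind_timed (for_each (enum (pal st u)) (\<lambda>c a. bind_timed (select (\<lambda>v. c \<in> pal st v) (N u)) (\<lambda>D. ret (a + length D))) 0) F t' =
        F (total u) (t' + (\<Sum>c\<leftarrow>enum (pal st u). length (N u) + 1))" for t' and F :: "nat \<Rightarrow> state timed"
      by (rule bind_timed_eval) (rule tot)
    have flt': "bind_timed (filter_timed (\<lambda>c. bind_timed (select (\<lambda>v. c \<in> pal st v) (N u))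
         (\<lambda>D. ret (\<not> (\<exists>\<gamma>. is_gamma q (al u) (avg u) d' \<gamma> \<and> real (length D) \<ge> q * \<gamma> * d')))) (enum (pal st u))) F t' =
        F (L u) (t' + length (enum (pal st u)) * (length (N u) + 1))" for t' and F :: "nat list \<Rightarrow> state timed"
      by (rule bind_timed_eval) (rule flt)
    show ?case
      unfolding bind_timed_eval[OF select_eval] N tot' Let_def al avg flt'
      by (simp add: ret_eval k_def)
  qed
  moreover have "(\<Sum>u\<leftarrow>us. k u + 1) \<le> length us * (\<Delta> + 2 * (K * (\<Delta> + 1)) + 1)"
  proof -
    have "k u + 1 \<le> \<Delta> + 2 * (K * (\<Delta> + 1)) + 1" if "u \<in> set us" for u
    proof -
      have e: "length (enum {v. E u v}) \<le> \<Delta>" using E that by simp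
      then have n: "length (N u) + 1 \<le> \<Delta> + 1"
        using le_trans[OF length_filter_le e] by (simp add: N_def)
      have "length (enum (pal st u)) * (length (N u) + 1) \<le> K * (\<Delta> + 1)"
        using n pal(2)[of u] by (intro mult_le_mono) (simp_all only: length_sorted_list_of_set)
      then show ?thesis unfolding k_def using e by (simp add: sum_list_triv)
    qed
    from sum_list_mono[of us "\<lambda>u. k u + 1" "\<lambda>_. \<Delta> + 2 * (K * (\<Delta> + 1)) + 1", OF this]
    show ?thesis by (simp add: sum_list_triv)
  qed
  moreover have "set (L u) \<subseteq> pal st u" for u using pal by (auto simp: L_def)
  moreover have "c \<in> set (L u)"
    if c: "c \<in> pal st u" and lt: "real (card {v \<in> free_nbs E st u. c \<in> pal st v}) < q * d'" for u c
  proof -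
    have "{v \<in> free_nbs E st u. c \<in> pal st v} = set (filter (\<lambda>v. c \<in> pal st v) (N u))"
      using E by (auto simp: N_def free_nbs_def)
    then have "real (length (filter (\<lambda>v. c \<in> pal st v) (N u))) < q * d'"
      using lt distinct_card[of "filter (\<lambda>v. c \<in> pal st v) (N u)"] by (simp add: N_def)
    moreover have "q * d' \<le> q * \<gamma> * d'" if "is_gamma q (al u) (avg u) d' \<gamma>" for \<gamma>
    proof -
      have "1 * (q * d') \<le> \<gamma> * (q * d')" using that q d' by (intro mult_right_mono) (auto simp: is_gamma_def)
      then show ?thesis by (simp add: mult_ac)
    qed
    ultimately show ?thesis using c pal unfolding L_def by fastforce
  qed
  ultimately show ?thesis by (rule that)
qed

locale coloring_round =
  fixes V :: "nat set" and E :: "nat \<Rightarrow> nat \<Rightarrow> bool" and K :: nat and st :: state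
    and p \<delta> :: real and pick :: choice_rule and \<Delta> :: nat
  assumes graph: "simple_graph V E" "triangle_free E" and pick: "choice_rule pick"
    and valid_st: "valid E K st" and p01: "0 < p" "p < 1" and \<delta>01: "0 < \<delta>" "\<delta> \<le> 1"
    and degree_bound: "\<And>u. card {v. E u v} \<le> \<Delta>"
begin

definition uncolored :: "nat set" where "uncolored = {u \<in> V. col st u = None}"

lemma E_V: "E u v \<Longrightarrow> u \<in> V" "E u v \<Longrightarrow> v \<in> V" "E u v \<Longrightarrow> E v u" "\<not> E u u"
  using graph unfolding simple_graph_def by blast+

lemma finite_V: "finite V" using graph by (simp add: simple_graph_def)

lemma finite_E: "finite {v. E u v}"
  by (rule finite_subset[OF _ finite_V]) (use E_V in auto)

lemma in_uncolored: "u \<in> uncolored \<longleftrightarrow> u \<in> V \<and> col st u = None"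
  by (simp add: uncolored_def)

sublocale nibble uncolored E "pal st" p \<delta>
  by unfold_locales
    (use finite_V validD[OF valid_st] E_V graph p01 \<delta>01 in \<open>auto simp: uncolored_def\<close>)

lemma nb_eq: "nb u = free_nbs E st u" "nbc u c = {v \<in> free_nbs E st u. c \<in> pal st v}"
  using E_V by (auto simp: nb_def nbc_def free_nbs_def in_uncolored)

lemma attempts_eq: "attempts V p st = Pi_pmf keys False (\<lambda>_. bernoulli_pmf p)"
proof -
  have "attempts_index V st = keys" by (auto simp: attempts_index_def keys_def in_uncolored)
  then show ?thesis by (simp add: attempts_def)
qed

lemma finite_keys: "finite keys"
  using finite_U finite_S by (auto simp: keys_def)

lemma card_keys: "card keys \<le> card V * K"
proof -
  have "card keys \<le> card (V \<times> {1..K})"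
    using finite_V validD(1)[OF valid_st]
    by (intro card_mono) (auto simp: keys_def in_uncolored)
  then show ?thesis by (simp add: card_cartesian_product)
qed

lemma coin_eq: "min 1 (\<delta> / prob_unassigned V E p st u c) = coin (u, c)"
proof -
  have "{v. E u v \<and> col st v = None \<and> c \<in> pal st v} = nbc u c"
    by (auto simp: nb_eq free_nbs_def)
  then have "prob_unassigned V E p st u c = (1 - p) ^ card (nbc u c)"
    using prob_unassigned_eq[OF graph(1), of st p u c] validD(2)[OF valid_st] p01 by simp
  then show ?thesis by (simp add: coin_def)
qed

text \<open>
  The lists computed by Phase II at a vertex \<open>u\<close>: uncolored neighbors, colors without conflict, colors
  that also survive their coin \<open>B\<close>, and among these the ones assigned to \<open>u\<close>.
\<close>

definition N :: "nat \<Rightarrow> nat list" where "N u = filter (\<lambda>v. col st v = None) (enum {v. E u v})"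
definition C :: "(nat \<times> nat \<Rightarrow> bool) \<Rightarrow> nat \<Rightarrow> nat list" where
  "C A u = filter (\<lambda>c. filter (\<lambda>v. A (v, c)) (N u) = []) (enum (pal st u))"
definition R :: "(nat \<times> nat \<Rightarrow> bool) \<Rightarrow> (nat \<times> nat \<Rightarrow> bool) \<Rightarrow> nat \<Rightarrow> nat list" where
  "R A B u = filter (\<lambda>c. B (u, c)) (C A u)"
definition X :: "(nat \<times> nat \<Rightarrow> bool) \<Rightarrow> (nat \<times> nat \<Rightarrow> bool) \<Rightarrow> nat \<Rightarrow> nat list" where
  "X A B u = filter (\<lambda>c. A (u, c)) (R A B u)"
definition cost2 :: "(nat \<times> nat \<Rightarrow> bool) \<Rightarrow> (nat \<times> nat \<Rightarrow> bool) \<Rightarrow> nat \<Rightarrow> nat" where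
  "cost2 A B u = length (enum {v. E u v}) + (length (enum (pal st u)) * (length (N u) + 1) +
     (length (C A u) * (length (N u) + 2) + length (R A B u)))"
definition assign :: "(nat \<times> nat \<Rightarrow> bool) \<Rightarrow> (nat \<times> nat \<Rightarrow> bool) \<Rightarrow> nat \<Rightarrow> state \<Rightarrow> state" where
  "assign A B = (\<lambda>u st'. st'\<lparr>pal := (pal st')(u := set (R A B u)),
     col := (if X A B u = [] then col st' else (col st')(u := Some (pick st' u (set (X A B u)))))\<rparr>)"

lemma cost2_le: "cost2 A B u + 1 \<le> \<Delta> + K * (2 * \<Delta> + 4) + 1"
proof -
  have e: "length (enum {v. E u v}) \<le> \<Delta>" using degree_bound by simp
  have n: "length (N u) \<le> \<Delta>" using le_trans[OF length_filter_le e] by (simp add: N_def)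
  have s: "length (enum (pal st u)) \<le> K" using validD(3)[OF valid_st] by simp
  have c: "length (C A u) \<le> K" using le_trans[OF length_filter_le s] by (simp add: C_def)
  have r: "length (R A B u) \<le> K" using le_trans[OF length_filter_le c] by (simp add: R_def)
  have "length (enum (pal st u)) * (length (N u) + 1) \<le> K * (\<Delta> + 1)"
    by (intro mult_le_mono s add_mono n order_refl)
  moreover have "length (C A u) * (length (N u) + 2) \<le> K * (\<Delta> + 2)"
    by (intro mult_le_mono c add_mono n order_refl)
  moreover have "K * (2 * \<Delta> + 4) = K * (\<Delta> + 1) + K * (\<Delta> + 2) + K" by (simp add: algebra_simps)
  ultimately show ?thesis unfolding cost2_def using e r by linarith
qed

lemma phase_two_eval:
  assumes us: "distinct us" "set us \<subseteq> uncolored"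
  shows "phase_two V E pick p \<delta> us A st t =
    bind_pmf (Pi_pmf (\<Union>u\<in>set us. Pair u ` pal st u) False (\<lambda>i. bernoulli_pmf (coin i)))
      (\<lambda>B. return_spmf (fold (assign A B) us st, t + (\<Sum>u\<leftarrow>us. cost2 A B u + 1)))"
  unfolding phase_two_def
proof (rule for_each_flips, goal_cases)
  case (1 u)
  then show ?case using validD(2)[OF valid_st] by simp
next
  case 2
  then show ?case by (auto simp: disjoint_family_on_def)
next
  case 3
  then show ?case by (rule us)
next
  case (4 u st' t)
  have ps: "distinct (enum (pal st u))" by simp
  have flt: "bind_timed (filter_timed (\<lambda>c. bind_timed (select (\<lambda>v. A (v, c)) (N u)) (\<lambda>X. ret (X = []))) (enum (pal st u))) F t' =
      F (C A u) (t' + length (enum (pal st u)) * (length (N u) + 1))" for t' and F :: "nat list \<Rightarrow> state timed"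
    unfolding C_def
    by (rule bind_timed_eval, rule filter_timed_det) (simp add: bind_timed_eval[OF select_eval] ret_eval)
  have coins: "bind_timed (filter_timed (\<lambda>c. bind_timed (charge (length (N u))) (\<lambda>_. flip (coin (u, c)))) (C A u)) F t' =
      bind_pmf (Pi_pmf (Pair u ` pal st u) False (\<lambda>i. bernoulli_pmf (coin i)))
        (\<lambda>B. F (R A B u) (t' + length (C A u) * (length (N u) + 2)))" for t' and F :: "nat list \<Rightarrow> state timed"
    unfolding R_def
  proof (rule bind_timed_pmf, rule filter_flips)
    show "Pair u ` set (C A u) \<subseteq> Pair u ` pal st u"
      using validD(2)[OF valid_st, of u] by (auto simp: C_def)
  qed (use validD(2)[OF valid_st, of u] in \<open>auto simp: C_def inj_on_def\<close>)
  have N: "filter (\<lambda>v. col st v = None) (enum {v. E u v}) = N u" by (simp add: N_def)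
  show ?case
    unfolding bind_timed_eval[OF select_eval] N flt coin_eq coins
    by (intro bind_pmf_cong refl)
      (simp add: bind_timed_eval[OF select_eval] ret_eval cost2_def assign_def X_def add_ac)
next
  case (5 u B B')
  have R: "R A B u = R A B' u"
    unfolding R_def
  proof (rule filter_cong[OF refl])
    fix c assume "c \<in> set (C A u)"
    then have "c \<in> pal st u" using validD(2)[OF valid_st, of u] by (auto simp: C_def)
    then show "B (u, c) = B' (u, c)" by (intro 5) auto
  qed
  have X: "X A B u = X A B' u" unfolding X_def R by (rule refl)
  show ?case unfolding assign_def cost2_def R X by simp
qed

text \<open>
  The part of the outcome of a round on which the rest of the argument depends. Palettes are only
  known up to the colors on which the cleanup may act.
\<close>

definition reached :: "(nat \<times> nat + nat \<times> nat \<Rightarrow> bool) \<Rightarrow> real \<Rightarrow> state \<Rightarrow> bool" where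
  "reached \<omega> d' st' \<longleftrightarrow>
    (\<forall>u. u \<notin> uncolored \<longrightarrow> col st' u = col st u \<and> pal st' u = pal st u) \<and>
    (\<forall>u\<in>uncolored. (stays \<omega> u \<longrightarrow> col st' u = None) \<and>
      (\<not> stays \<omega> u \<longrightarrow> (\<exists>c. col st' u = Some c \<and> keeps \<omega> u c \<and> \<omega> (Inl (u, c)))) \<and>
      (\<forall>c\<in>pal st' u. keeps \<omega> u c) \<and>
      (\<forall>c. keeps \<omega> u c \<longrightarrow> real (card {v \<in> nbc u c. stays \<omega> v \<and> keeps \<omega> v c}) < 7 * d' \<longrightarrow> c \<in> pal st' u))"

lemma round_eval:
  assumes d': "0 \<le> d'"
  obtains h k where
    "round_timed V E 7 pick p \<delta> \<eta>' d' s' st t = bind_pmf (Pi_pmf J False P) (\<lambda>\<omega>. return_spmf (h \<omega>, k \<omega>))"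
    "\<And>\<omega>. \<omega> \<in> set_pmf (Pi_pmf J False P) \<Longrightarrow> reached \<omega> d' (h \<omega>)"
    "\<And>\<omega>. eta (h \<omega>) = \<eta>' \<and> dd (h \<omega>) = d' \<and> ss (h \<omega>) = s'"
    "\<And>\<omega>. k \<omega> \<le> t + card V * (2 * \<Delta> + K * (4 * \<Delta> + 7) + 3)"
proof -
  define us where "us = filter (\<lambda>u. col st u = None) (enum V)"
  have us: "distinct us" "set us = uncolored" "length us \<le> card V"
    using finite_V length_filter_le[of _ "enum V"] by (auto simp: us_def uncolored_def)
  have keys_un: "(\<Union>u\<in>set us. Pair u ` pal st u) = keys"
    using us by (auto simp: keys_def)
  define two where "two = (\<lambda>A B. fold (assign A B) us st)"
  define k2 where "k2 = (\<lambda>A B. card V + card keys + (\<Sum>u\<leftarrow>us. cost2 A B u + 1))"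
  have two_pal: "pal (two A B) u = (if u \<in> set us then set (R A B u) else pal st u)" for A B u
    unfolding two_def assign_def by (rule fold_assign_colors(1)[OF us(1) pick])
  have two_col: "u \<notin> set us \<Longrightarrow> col (two A B) u = col st u"
    "X A B u = [] \<Longrightarrow> col (two A B) u = col st u"
    "u \<in> set us \<Longrightarrow> X A B u \<noteq> [] \<Longrightarrow> \<exists>c\<in>set (X A B u). col (two A B) u = Some c" for A B u
    unfolding two_def assign_def using fold_assign_colors(2-4)[OF us(1) pick, where u = u] by blast+
  have R_sub: "set (R A B u) \<subseteq> pal st u" for A B u
    using validD(2)[OF valid_st, of u] by (auto simp: R_def C_def)
  have two_sub: "pal (two A B) u \<subseteq> pal st u" for A B u
    using R_sub by (auto simp: two_pal)
  have two_fin: "finite (pal (two A B) u)" for A B u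
    using finite_subset[OF two_sub] validD(2)[OF valid_st] by blast
  have two_card: "card (pal (two A B) u) \<le> K" for A B u
    using card_mono[OF validD(2)[OF valid_st] two_sub] validD(3)[OF valid_st] le_trans by blast
  let ?three = "\<lambda>A B t' R k. phase_three E 7 d' s' us (two A B) t' =
       return_spmf (fold (\<lambda>u st'. st'\<lparr>pal := (pal st')(u := R u)\<rparr>) us (two A B), t' + k) \<and>
       k \<le> length us * (\<Delta> + 2 * (K * (\<Delta> + 1)) + 1) \<and> (\<forall>u. R u \<subseteq> pal (two A B) u) \<and>
       (\<forall>u c. c \<in> pal (two A B) u \<longrightarrow>
          real (card {v \<in> free_nbs E (two A B) u. c \<in> pal (two A B) v}) < 7 * d' \<longrightarrow> c \<in> R u)"
  define Q where "Q = (\<lambda>A B R k. ?three A B (t + k2 A B) R k)"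
  have "\<exists>R k. ?three A B t' R k" for A B t'
  proof (rule phase_three_eval[where E = E and us = us and \<Delta> = \<Delta> and st = "two A B" and K = K
        and q = 7 and d' = d' and s' = s' and t = t'])
    show "finite {v. E u v}" "card {v. E u v} \<le> \<Delta>" for u by (rule finite_E degree_bound)+
    show "finite (pal (two A B) u)" "card (pal (two A B) u) \<le> K" for u by (rule two_fin two_card)+
    fix R k assume *: "phase_three E 7 d' s' us (two A B) t' =
       return_spmf (fold (\<lambda>u st'. st'\<lparr>pal := (pal st')(u := R u)\<rparr>) us (two A B), t' + k)"
      "k \<le> length us * (\<Delta> + 2 * (K * (\<Delta> + 1)) + 1)" "\<And>u. R u \<subseteq> pal (two A B) u"
      "\<And>u c. c \<in> pal (two A B) u \<Longrightarrow>
          real (card {v \<in> free_nbs E (two A B) u. c \<in> pal (two A B) v}) < 7 * d' \<Longrightarrow> c \<in> R u"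
    have "?three A B t' R k" using * by blast
    then show "\<exists>R k. ?three A B t' R k" by blast
  qed (use us(1) d' in auto)
  then have "\<exists>R k. Q A B R k" for A B
    unfolding Q_def by this
  then obtain R3 k3 where Q: "\<And>A B. Q A B (R3 A B) (k3 A B)" by metis
  have three: "phase_three E 7 d' s' us (two A B) (t + k2 A B) =
       return_spmf (fold (\<lambda>u st'. st'\<lparr>pal := (pal st')(u := R3 A B u)\<rparr>) us (two A B), t + k2 A B + k3 A B)" for A B
    using Q[of A B] unfolding Q_def by (rule conjunct1)
  have k3: "k3 A B \<le> length us * (\<Delta> + 2 * (K * (\<Delta> + 1)) + 1)" for A B
    using Q[of A B] unfolding Q_def by (elim conjE)
  have R3_sub: "\<forall>u. R3 A B u \<subseteq> pal (two A B) u" for A B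
    using Q[of A B] unfolding Q_def by (elim conjE)
  have R3_sup: "\<forall>u c. c \<in> pal (two A B) u \<longrightarrow>
        real (card {v \<in> free_nbs E (two A B) u. c \<in> pal (two A B) v}) < 7 * d' \<longrightarrow> c \<in> R3 A B u" for A B
    using Q[of A B] unfolding Q_def by (elim conjE)
  define h' where "h' = (\<lambda>A B. (fold (\<lambda>u st'. st'\<lparr>pal := (pal st')(u := R3 A B u)\<rparr>) us (two A B))\<lparr>eta := \<eta>', dd := d', ss := s'\<rparr>)"
  define k' where "k' = (\<lambda>A B. t + k2 A B + k3 A B)"
  let ?PA = "Pi_pmf keys False (\<lambda>_. bernoulli_pmf p)" and ?PB = "Pi_pmf keys False (\<lambda>i. bernoulli_pmf (coin i))"
  have "round_timed V E 7 pick p \<delta> \<eta>' d' s' st t =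
      bind_pmf ?PA (\<lambda>A. bind_pmf ?PB (\<lambda>B. return_spmf (h' A B, k' A B)))"
  proof -
    have idx: "attempts_index V st = keys" by (auto simp: attempts_index_def keys_def in_uncolored)
    have draw: "bind_timed (draw k M) F t' = bind_pmf M (\<lambda>A. F A (t' + k))"
      for k t' and M :: "(nat \<times> nat \<Rightarrow> bool) pmf" and F :: "_ \<Rightarrow> state timed"
      by (rule bind_timed_pmf) (simp add: draw_def map_spmf_conv_bind_spmf)
    have two: "bind_timed (phase_two V E pick p \<delta> us A st) F (t + card V + card keys) =
        bind_pmf ?PB (\<lambda>B. F (two A B) (t + k2 A B))" for A and F :: "state \<Rightarrow> state timed"
      by (rule bind_timed_pmf) (simp add: phase_two_eval[OF us(1) equalityD1[OF us(2)], unfolded keys_un] two_def k2_def add_ac)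
    have "bind_timed (phase_three E 7 d' s' us (two A B)) F (t + k2 A B) =
        F (fold (\<lambda>u st'. st'\<lparr>pal := (pal st')(u := R3 A B u)\<rparr>) us (two A B)) (k' A B)"
      for A B and F :: "state \<Rightarrow> state timed"
      by (rule bind_timed_eval) (simp add: three k'_def)
    then show ?thesis
      unfolding round_timed_def bind_timed_eval[OF select_eval] us_def[symmetric] draw idx attempts_eq
      using finite_V by (simp add: two h'_def ret_eval)
  qed
  also have "\<dots> = bind_pmf (pair_pmf ?PA ?PB) (\<lambda>(A, B). return_spmf (h' A B, k' A B))"
    by (simp add: pair_pmf_def bind_assoc_pmf bind_return_pmf)
  also have "\<dots> = bind_pmf (Pi_pmf J False P) (\<lambda>\<omega>. return_spmf (h' (\<omega> \<circ> Inl) (\<omega> \<circ> Inr), k' (\<omega> \<circ> Inl) (\<omega> \<circ> Inr)))"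
    unfolding J_def P_def Pi_pmf_Plus[OF finite_keys finite_keys]
    by (simp add: map_pmf_def bind_assoc_pmf bind_return_pmf case_prod_beta' o_def)
  finally have 1: "round_timed V E 7 pick p \<delta> \<eta>' d' s' st t = \<dots>" .
  have 2: "reached \<omega> d' (h' (\<omega> \<circ> Inl) (\<omega> \<circ> Inr))" if \<omega>: "\<omega> \<in> set_pmf (Pi_pmf J False P)" for \<omega>
  proof -
    let ?A = "\<omega> \<circ> Inl" and ?B = "\<omega> \<circ> Inr"
    have "\<not> \<omega> j" if "j \<notin> J" for j
      using that set_Pi_pmf_subset[OF finite_J, of False P] \<omega> by blast
    then have "Inl (v, c) \<in> J" if "\<omega> (Inl (v, c))" for v c using that by blast
    then have supp: "c \<in> pal st v" if "\<omega> (Inl (v, c))" for v c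
      using that by (fastforce simp: J_def keys_def)
    \<comment> \<open>on the support of the law, colors are tried only at vertices that have them, so conflicts are those counted by \<open>nbc\<close>\<close>
    have Rk: "set (R ?A ?B u) = {c. keeps \<omega> u c}" for u
      using finite_E validD(2)[OF valid_st, of u] supp
      by (auto simp: R_def C_def N_def keeps_def nb_eq free_nbs_def filter_empty_conv)
    have Xk: "X ?A ?B u = [] \<longleftrightarrow> stays \<omega> u" for u
      using Rk[of u] by (auto simp: X_def stays_def filter_empty_conv)
    have hp: "pal (h' ?A ?B) u = (if u \<in> uncolored then R3 ?A ?B u else pal st u)" for u
      using fold_set_palettes(1)[OF us(1)] us(2) by (simp add: h'_def two_pal)
    have hc: "col (h' ?A ?B) = col (two ?A ?B)"
      using fold_set_palettes(2)[OF us(1)] by (simp add: h'_def)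
    have c1: "col (two ?A ?B) u = None" if "u \<in> uncolored" "stays \<omega> u" for u
      using two_col(2)[of ?A ?B u] that Xk by (simp add: in_uncolored)
    have c2: "\<exists>c. col (two ?A ?B) u = Some c \<and> keeps \<omega> u c \<and> \<omega> (Inl (u, c))" if "u \<in> uncolored" "\<not> stays \<omega> u" for u
      using two_col(3)[of u ?A ?B] that Xk Rk[of u] us(2) by (auto simp: X_def)
    have k1: "keeps \<omega> u c" if "u \<in> uncolored" "c \<in> R3 ?A ?B u" for u c
      using R3_sub[rule_format, of ?A ?B u] that Rk us(2) by (auto simp: two_pal)
    have k2: "c \<in> R3 ?A ?B u"
      if "u \<in> uncolored" "keeps \<omega> u c" "real (card {v \<in> nbc u c. stays \<omega> v \<and> keeps \<omega> v c}) < 7 * d'" for u c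
    proof (rule R3_sup[rule_format])
      show "c \<in> pal (two ?A ?B) u" using that Rk us(2) by (simp add: two_pal)
      have "{v \<in> free_nbs E (two ?A ?B) u. c \<in> pal (two ?A ?B) v} \<subseteq> {v \<in> nbc u c. stays \<omega> v \<and> keeps \<omega> v c}"
      proof clarify
        fix v assume v: "v \<in> free_nbs E (two ?A ?B) u" "c \<in> pal (two ?A ?B) v"
        then have E: "E u v" "col (two ?A ?B) v = None" by (auto simp: free_nbs_def)
        have vu: "v \<in> uncolored" using E two_col(1)[of v ?A ?B] us(2) E_V
          by (cases "v \<in> uncolored") (auto simp: in_uncolored)
        then have "stays \<omega> v" using c2[of v] E by auto
        moreover have "keeps \<omega> v c" using v vu us(2) Rk by (simp add: two_pal)
        moreover have "v \<in> nbc u c" using E vu \<open>keeps \<omega> v c\<close> by (auto simp: nbc_def nb_def keeps_def)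
        ultimately show "v \<in> nbc u c \<and> stays \<omega> v \<and> keeps \<omega> v c" by blast
      qed
      then have "card {v \<in> free_nbs E (two ?A ?B) u. c \<in> pal (two ?A ?B) v} \<le> card {v \<in> nbc u c. stays \<omega> v \<and> keeps \<omega> v c}"
        by (intro card_mono) auto
      then show "real (card {v \<in> free_nbs E (two ?A ?B) u. c \<in> pal (two ?A ?B) v}) < 7 * d'"
        using that(3) by linarith
    qed
    show ?thesis
      unfolding reached_def hc hp
      using two_col(1)[of _ ?A ?B] us(2) c1 c2 k1 k2 by simp
  qed
  have 3: "eta (h' A B) = \<eta>' \<and> dd (h' A B) = d' \<and> ss (h' A B) = s'" for A B
    by (simp add: h'_def)
  have 4: "k' A B \<le> t + card V * (2 * \<Delta> + K * (4 * \<Delta> + 7) + 3)" for A B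
  proof -
    have "(\<Sum>u\<leftarrow>us. cost2 A B u + 1) \<le> (\<Sum>u\<leftarrow>us. \<Delta> + K * (2 * \<Delta> + 4) + 1)"
      by (intro sum_list_mono cost2_le)
    also have "\<dots> = length us * (\<Delta> + K * (2 * \<Delta> + 4) + 1)" by (simp add: sum_list_triv)
    also have "\<dots> \<le> card V * (\<Delta> + K * (2 * \<Delta> + 4) + 1)" by (intro mult_le_mono1 us(3))
    finally have "k2 A B \<le> card V + card V * K + card V * (\<Delta> + K * (2 * \<Delta> + 4) + 1)"
      unfolding k2_def using card_keys by linarith
    moreover have "k3 A B \<le> card V * (\<Delta> + 2 * (K * (\<Delta> + 1)) + 1)"
      using le_trans[OF k3 mult_le_mono1[OF us(3)]] .
    ultimately show ?thesis by (simp add: k'_def algebra_simps)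
  qed
  show ?thesis by (rule that[OF 1 2 3 4])
qed

end


section \<open>One round and the greedy stage preserve what is needed\<close>

definition balanced :: "nat set \<Rightarrow> (nat \<Rightarrow> nat \<Rightarrow> bool) \<Rightarrow> real \<Rightarrow> state \<Rightarrow> bool" where
  "balanced V E x st \<longleftrightarrow> (\<forall>u\<in>V. col st u = None \<longrightarrow>
     real (card (free_nbs E st u)) \<le> x * eta st \<and>
     6 * x * dd st * ss st \<le>
       (\<Sum>c\<in>pal st u. max 0 (7 * dd st - real (card {v \<in> free_nbs E st u. c \<in> pal st v}))))"

context coloring_round
begin

lemma reached_cases:
  assumes r: "reached \<omega> d' st'" and u: "u \<in> V"
  obtains (old) c where "col st u = Some c" "col st' u = Some c"
  | (new) c where "u \<in> uncolored" "col st u = None" "col st' u = Some c" "keeps \<omega> u c" "\<omega> (Inl (u, c))"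
  | (none) "u \<in> uncolored" "col st u = None" "col st' u = None" "stays \<omega> u"
proof (cases "u \<in> uncolored")
  case False
  then obtain c where "col st u = Some c" using u by (auto simp: in_uncolored)
  moreover have "col st' u = col st u" using r False unfolding reached_def by blast
  ultimately show thesis using old by simp
next
  case True
  then have n: "col st u = None" by (simp add: in_uncolored)
  show thesis
  proof (cases "stays \<omega> u")
    case st: True
    then have "col st' u = None" using r True unfolding reached_def by blast
    then show thesis using none True n st by blast
  next
    case False
    then obtain c where "col st' u = Some c" "keeps \<omega> u c" "\<omega> (Inl (u, c))"
      using r True unfolding reached_def by blast
    then show thesis using new True n by blast
  qed
qed

lemma keeps_pal: "keeps \<omega> u c \<Longrightarrow> c \<in> pal st u"
  by (simp add: keeps_def)

lemma reached_pal: "reached \<omega> d' st' \<Longrightarrow> pal st' u \<subseteq> pal st u"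
  unfolding reached_def using keeps_pal by (cases "u \<in> uncolored") blast+

lemma reached_keeps: "reached \<omega> d' st' \<Longrightarrow> u \<in> uncolored \<Longrightarrow> c \<in> pal st' u \<Longrightarrow> keeps \<omega> u c"
  unfolding reached_def by blast

text \<open>A color that survives at \<open>u\<close> was not tried at any uncolored neighbor of \<open>u\<close>.\<close>

lemma keeps_conflict:
  assumes "keeps \<omega> u c" "E u v" "v \<in> uncolored" "keeps \<omega> v c"
  shows "\<not> \<omega> (Inl (v, c))"
proof -
  have "v \<in> nbc u c" using assms by (simp add: nbc_def nb_def keeps_def)
  then show ?thesis using assms(1) by (simp add: keeps_def)
qed

lemma reached_valid:
  assumes r: "reached \<omega> d' st'"
  shows "valid E K st'"
  unfolding valid_def
proof (intro conjI allI impI)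
  show "pal st' u \<subseteq> {1..K}" for u
    using reached_pal[OF r, of u] validD(1)[OF valid_st, of u] by (rule order_trans)
next
  fix u v c assume E: "E u v" and uc: "col st' u = Some c"
  have V: "u \<in> V" "v \<in> V" and E': "E v u" using E_V E by blast+
  have valid1: "c' \<notin> pal st w'" if "E w w'" "col st w = Some c'" "col st w' = None" for w w' c'
    using valid_st that unfolding valid_def by auto
  have valid2: "col st w' \<noteq> Some c'" if "E w w'" "col st w = Some c'" for w w' c'
    using valid_st that unfolding valid_def by auto
  show "col st' v \<noteq> Some c"
  proof
    assume vc: "col st' v = Some c"
    from r V(1) show False
    proof (cases rule: reached_cases)
      case (old cu)
      note u = this
      from r V(2) show False
      proof (cases rule: reached_cases)
        case (old cv) then show False using u uc vc valid2[OF E] by auto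
      next
        case (new cv) then show False using u uc vc valid1[OF E] keeps_pal by auto
      qed (use vc in auto)
    next
      case (new cu)
      note u = this
      from r V(2) show False
      proof (cases rule: reached_cases)
        case (old cv) then show False using u uc vc valid1[OF E'] keeps_pal by auto
      next
        case (new cv) then show False using u uc vc keeps_conflict[OF _ E] by auto
      qed (use vc in auto)
    qed (use uc in auto)
  qed
  assume vn: "col st' v = None"
  from r V(2) vn have v: "v \<in> uncolored" "col st v = None" by (cases rule: reached_cases; simp)+
  show "c \<notin> pal st' v"
  proof
    assume c: "c \<in> pal st' v"
    from r V(1) show False
    proof (cases rule: reached_cases)
      case (old cu) then show False using uc c v(2) valid1[OF E] reached_pal[OF r, of v] by auto
    next
      case (new cu) then show False
        using uc reached_keeps[OF r v(1) c] keeps_conflict[OF _ E', of \<omega> c] by auto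
    qed (use uc in auto)
  qed
qed

lemma reached_free_nbs:
  assumes r: "reached \<omega> d' st'" and u: "u \<in> uncolored"
  shows "free_nbs E st' u = {v \<in> nb u. stays \<omega> v}"
proof (intro set_eqI iffI)
  fix v assume "v \<in> free_nbs E st' u"
  then have v: "E u v" "col st' v = None" "v \<in> V" using E_V by (auto simp: free_nbs_def)
  from r v(3) show "v \<in> {v \<in> nb u. stays \<omega> v}"
    by (cases rule: reached_cases) (use v in \<open>auto simp: nb_def\<close>)
next
  fix v assume "v \<in> {v \<in> nb u. stays \<omega> v}"
  then have v: "E u v" "v \<in> uncolored" "stays \<omega> v" by (auto simp: nb_def)
  then have "col st' v = None" using r unfolding reached_def by blast
  then show "v \<in> free_nbs E st' u" using v by (simp add: free_nbs_def)
qed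

text \<open>
  Colors lost in the cleanup have term zero on the left, and the cleanup only shrinks the sets that
  are counted on the right.
\<close>

lemma reached_weight:
  assumes r: "reached \<omega> d' st'" and u: "u \<in> uncolored"
  shows "(\<Sum>c\<in>pal st u. of_bool (keeps \<omega> u c) * max 0 (7 * d' - real (card {v\<in>nbc u c. stays \<omega> v \<and> keeps \<omega> v c})))
    \<le> (\<Sum>c\<in>pal st' u. max 0 (7 * d' - real (card {v \<in> free_nbs E st' u. c \<in> pal st' v})))"
    (is "(\<Sum>c\<in>_. ?f c) \<le> (\<Sum>c\<in>_. ?g c)")
proof -
  have zero: "?f c = 0" if "c \<in> pal st u - pal st' u" for c
  proof (cases "keeps \<omega> u c")
    case True
    then have "\<not> real (card {v\<in>nbc u c. stays \<omega> v \<and> keeps \<omega> v c}) < 7 * d'"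
      using r u that unfolding reached_def by blast
    then show ?thesis by simp
  qed simp
  have "(\<Sum>c\<in>pal st u. ?f c) = (\<Sum>c\<in>pal st' u. ?f c)"
    using zero reached_pal[OF r] validD(2)[OF valid_st] by (intro sum.mono_neutral_right) auto
  also have "\<dots> \<le> (\<Sum>c\<in>pal st' u. ?g c)"
  proof (rule sum_mono)
    fix c assume c: "c \<in> pal st' u"
    have "{v \<in> free_nbs E st' u. c \<in> pal st' v} \<subseteq> {v\<in>nbc u c. stays \<omega> v \<and> keeps \<omega> v c}"
      unfolding reached_free_nbs[OF r u]
      using reached_keeps[OF r] reached_pal[OF r] by (auto simp: nbc_def nb_def)
    then have "card {v \<in> free_nbs E st' u. c \<in> pal st' v} \<le> card {v\<in>nbc u c. stays \<omega> v \<and> keeps \<omega> v c}"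
      by (intro card_mono) auto
    then show "?f c \<le> ?g c" by (auto simp: of_bool_def)
  qed
  finally show ?thesis .
qed

lemma round_achieves:
  fixes d s \<eta> a x e e' H :: real
  assumes nr: "nibble_round uncolored E (pal st) p \<delta> d s \<eta> (real K) a x e e' H"
  shows "achieves (round_timed V E 7 pick p \<delta> (\<eta> * (1 - a)) (d * (1 - a) * \<delta>) (s * \<delta>) st) t
    (\<lambda>st' t'. valid E K st' \<and> balanced V E (x - e') st' \<and> eta st' = \<eta> * (1 - a) \<and>
       dd st' = d * (1 - a) * \<delta> \<and> ss st' = s * \<delta> \<and> t' \<le> t + card V * (2 * \<Delta> + K * (4 * \<Delta> + 7) + 3))
    (card V * ((\<eta> + K + 3) * exp (- H)))"
proof -
  interpret nr: nibble_round uncolored E "pal st" p \<delta> d s \<eta> "real K" a x e e' H by (rule nr)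
  have d': "0 \<le> d * (1 - a) * \<delta>" by (rule nr.d'_bounds)
  obtain h k where hk: "round_timed V E 7 pick p \<delta> (\<eta> * (1 - a)) (d * (1 - a) * \<delta>) (s * \<delta>) st t =
       bind_pmf (Pi_pmf J False P) (\<lambda>\<omega>. return_spmf (h \<omega>, k \<omega>))"
    and h: "\<And>\<omega>. \<omega> \<in> set_pmf (Pi_pmf J False P) \<Longrightarrow> reached \<omega> (d * (1 - a) * \<delta>) (h \<omega>)"
    and h': "\<And>\<omega>. eta (h \<omega>) = \<eta> * (1 - a) \<and> dd (h \<omega>) = d * (1 - a) * \<delta> \<and> ss (h \<omega>) = s * \<delta>"
    and k: "\<And>\<omega>. k \<omega> \<le> t + card V * (2 * \<Delta> + K * (4 * \<Delta> + 7) + 3)"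
    using round_eval[OF d', of "\<eta> * (1 - a)" "s * \<delta>" t] by blast
  let ?Q = "\<lambda>st' t'. valid E K st' \<and> balanced V E (x - e') st' \<and> eta st' = \<eta> * (1 - a) \<and>
       dd st' = d * (1 - a) * \<delta> \<and> ss st' = s * \<delta> \<and> t' \<le> t + card V * (2 * \<Delta> + K * (4 * \<Delta> + 7) + 3)"
  have ok: "?Q (h \<omega>) (k \<omega>)" if \<omega>: "\<omega> \<in> set_pmf (Pi_pmf J False P)" and s: "\<forall>u\<in>uncolored. nr.succeeds u \<omega>" for \<omega>
  proof -
    have "balanced V E (x - e') (h \<omega>)"
      unfolding balanced_def
    proof (intro ballI impI)
      fix u assume u: "u \<in> V" and "col (h \<omega>) u = None"
      with h[OF \<omega>] have unc: "u \<in> uncolored" by (cases rule: reached_cases[OF h[OF \<omega>] u]) auto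
      show "real (card (free_nbs E (h \<omega>) u)) \<le> (x - e') * eta (h \<omega>) \<and>
         6 * (x - e') * dd (h \<omega>) * ss (h \<omega>) \<le> (\<Sum>c\<in>pal (h \<omega>) u.
            max 0 (7 * dd (h \<omega>) - real (card {v \<in> free_nbs E (h \<omega>) u. c \<in> pal (h \<omega>) v})))"
        using s[rule_format, OF unc] reached_weight[OF h[OF \<omega>] unc] h'[of \<omega>] reached_free_nbs[OF h[OF \<omega>] unc]
        unfolding nr.succeeds_def by simp
    qed
    then show ?thesis using reached_valid[OF h[OF \<omega>]] h' k by simp
  qed
  show ?thesis
  proof (rule achieves_pmf[where h = h and k = k and M = "Pi_pmf J False P"], rule hk)
    have "measure_pmf.prob (Pi_pmf J False P) {\<omega>. \<not> ?Q (h \<omega>) (k \<omega>)} \<le>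
        measure_pmf.prob (Pi_pmf J False P) {\<omega>. \<exists>u\<in>uncolored. \<not> nr.succeeds u \<omega>}"
      using ok by (intro measure_pmf.finite_measure_mono_AE) (auto simp: AE_measure_pmf_iff)
    also have "\<dots> \<le> card uncolored * ((\<eta> + K + 3) * exp (- H))"
      using nr.prob_round_fails by simp
    also have "\<dots> \<le> card V * ((\<eta> + K + 3) * exp (- H))"
    proof (intro mult_right_mono)
      show "real (card uncolored) \<le> real (card V)"
        by (intro of_nat_mono card_mono finite_V) (auto simp: in_uncolored)
    qed (use nr.pos in auto)
    finally show "measure_pmf.prob (Pi_pmf J False P) {\<omega>. \<not> ?Q (h \<omega>) (k \<omega>)} \<le>
        card V * ((\<eta> + K + 3) * exp (- H))" .
  qed
qed

end

text \<open>
  The list in the invariant is the part of the loop already executed.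
\<close>

lemma for_each_rule:
  assumes "\<And>ys x zs s t. xs = ys @ x # zs \<Longrightarrow> Inv ys s \<Longrightarrow>
      \<exists>s' t'. f x s t = return_spmf (s', t') \<and> t' \<le> t + k \<and> Inv (ys @ [x]) s'"
    and "Inv [] s"
  shows "\<exists>s' t'. for_each xs f s t = return_spmf (s', t') \<and> t' \<le> t + length xs * (k + 1) \<and> Inv xs s'"
proof -
  have "\<exists>s' t'. for_each zs f s t = return_spmf (s', t') \<and> t' \<le> t + length zs * (k + 1) \<and> Inv xs s'"
    if "xs = ys @ zs" "Inv ys s" for ys zs s t
    using that
  proof (induction zs arbitrary: ys s t)
    case (Cons x zs)
    obtain s' t' where 1: "f x s (t + 1) = return_spmf (s', t')" "t' \<le> t + 1 + k" "Inv (ys @ [x]) s'"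
      using assms(1)[OF Cons.prems] by blast
    obtain s'' t'' where 2: "for_each zs f s' t' = return_spmf (s'', t'')" "t'' \<le> t' + length zs * (k + 1)" "Inv xs s''"
      using Cons.IH[of "ys @ [x]" s' t'] Cons.prems 1 by auto
    have "for_each (x # zs) f s t = return_spmf (s'', t'')"
      using 1 2 by (simp add: bind_timed_def charge_eval)
    then show ?case using 1 2 by (intro exI[of _ s''] exI[of _ t'']) simp
  qed (simp add: ret_eval)
  from this[of "[]" xs s t] assms(2) show ?thesis by simp
qed

text \<open>
  Colors of neighbors that were colored before this stage are missing from the palette of \<open>u\<close>, so only
  the neighbors colored by the stage itself compete, and there are fewer of these than colors.
\<close>

lemma greedy_stage_completes:
  assumes graph: "simple_graph V E" and pick: "choice_rule pick" and valid: "valid E K st"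
    and room: "\<And>u. u \<in> V \<Longrightarrow> col st u = None \<Longrightarrow> card (free_nbs E st u) < card (pal st u)"
    and deg: "\<And>u. card {v. E u v} \<le> \<Delta>"
  shows "\<exists>st' t'. greedy_stage V E pick st t = return_spmf (st', t') \<and> proper_coloring V E (col st') \<and>
     t' \<le> t + card V * (K * (\<Delta> + 1) + 2)"
proof -
  have finV: "finite V" and E_sym: "\<And>u v. E u v \<Longrightarrow> E v u" and E_irr: "\<And>u. \<not> E u u"
    and E_V: "\<And>u v. E u v \<Longrightarrow> v \<in> V"
    using graph unfolding simple_graph_def by blast+
  have finE: "finite {v. E u v}" for u by (rule finite_subset[OF _ finV]) (use E_V in auto)
  define us where "us = filter (\<lambda>u. col st u = None) (enum V)"
  have us: "distinct us" "set us = {u \<in> V. col st u = None}" "length us \<le> card V"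
    using finV length_filter_le[of _ "enum V"] by (auto simp: us_def)
  define Inv :: "nat list \<Rightarrow> state \<Rightarrow> bool" where "Inv = (\<lambda>ys s. pal s = pal st \<and>
     (\<forall>v. v \<notin> set ys \<longrightarrow> col s v = col st v) \<and> (\<forall>v\<in>set ys. col s v \<noteq> None) \<and>
     (\<forall>u v c. E u v \<longrightarrow> col s u = Some c \<longrightarrow> col s v \<noteq> Some c))"
  let ?f = "\<lambda>u s. bind_timed (filter_timed (\<lambda>c. bind_timed
      (select (\<lambda>v. col s v = Some c) (enum {v. E u v})) (\<lambda>X. ret (X = []))) (enum (pal s u)))
      (\<lambda>C. ret (if C = [] then s else s\<lparr>col := (col s)(u := Some (pick s u (set C)))\<rparr>))"
  have "\<exists>s' t'. for_each us ?f st (t + card V) = return_spmf (s', t') \<and>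
      t' \<le> t + card V + length us * (K * (\<Delta> + 1) + 1) \<and> Inv us s'"
  proof (rule for_each_rule)
    show "Inv [] st" using valid by (simp add: Inv_def valid_def)
  next
    fix ys u zs s t assume split: "us = ys @ u # zs" and inv: "Inv ys s"
    have u: "u \<in> V" "col st u = None" "u \<notin> set ys" using split us by auto
    have s: "pal s = pal st" and old: "\<And>v. v \<notin> set ys \<Longrightarrow> col s v = col st v"
      and new: "\<And>v. v \<in> set ys \<Longrightarrow> col s v \<noteq> None"
      and proper: "\<And>u v c. E u v \<Longrightarrow> col s u = Some c \<Longrightarrow> col s v \<noteq> Some c"
      using inv unfolding Inv_def by blast+
    define C where "C = filter (\<lambda>c. filter (\<lambda>v. col s v = Some c) (enum {v. E u v}) = []) (enum (pal st u))"
    have setC: "set C = {c \<in> pal st u. \<forall>v. E u v \<longrightarrow> col s v \<noteq> Some c}"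
      using finE[of u] validD(2)[OF valid, of u] by (auto simp: C_def filter_empty_conv)
    have free: "col st v = None" if "v \<in> set ys" for v
    proof -
      have "v \<in> set us" using that split by simp
      then show ?thesis using us(2) by blast
    qed
    have "C \<noteq> []"
    proof
      assume "C = []"
      then have C0: "set C = {}" by simp
      have "pal st u \<subseteq> (\<lambda>v. the (col s v)) ` free_nbs E st u"
      proof
        fix c assume c: "c \<in> pal st u"
        then obtain v where v: "E u v" "col s v = Some c" using C0 unfolding setC by blast
        have "col st v = None"
        proof (rule ccontr)
          assume "col st v \<noteq> None"
          then have "col st v = Some c" using old[of v] free[of v] v by metis
          then show False using valid E_sym[OF v(1)] u(2) c unfolding valid_def by blast
        qed
        then show "c \<in> (\<lambda>v. the (col s v)) ` free_nbs E st u"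
          using v by (intro image_eqI[of _ _ v]) (auto simp: free_nbs_def)
      qed
      then have "card (pal st u) \<le> card (free_nbs E st u)"
        using surj_card_le[of "free_nbs E st u"] finite_subset[OF _ finE[of u]]
        by (auto simp: free_nbs_def)
      then show False using room[OF u(1,2)] by simp
    qed
    then have pc: "pick s u (set C) \<in> set C" using pick by (auto simp: choice_rule_def)
    define c0 where "c0 = pick s u (set C)"
    have c0: "c0 \<in> pal st u" "\<And>v. E u v \<Longrightarrow> col s v \<noteq> Some c0"
      using pc setC by (simp_all add: c0_def)
    define s' where "s' = s\<lparr>col := (col s)(u := Some c0)\<rparr>"
    have "?f u s t = return_spmf (s', t + length (enum (pal st u)) * (length (enum {v. E u v}) + 1))"
    proof -
      have "filter_timed (\<lambda>c. bind_timed (select (\<lambda>v. col s v = Some c) (enum {v. E u v})) (\<lambda>X. ret (X = [])))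
          (enum (pal s u)) t = return_spmf (C, t + length (enum (pal st u)) * (length (enum {v. E u v}) + 1))"
        unfolding C_def s by (rule filter_timed_det) (simp add: bind_timed_eval[OF select_eval] ret_eval)
      then have "?f u s t = ret (if C = [] then s else s\<lparr>col := (col s)(u := Some (pick s u (set C)))\<rparr>)
          (t + length (enum (pal st u)) * (length (enum {v. E u v}) + 1))"
        by (rule bind_timed_eval)
      then show ?thesis using \<open>C \<noteq> []\<close> by (simp add: ret_eval s'_def c0_def)
    qed
    moreover have "length (enum (pal st u)) * (length (enum {v. E u v}) + 1) \<le> K * (\<Delta> + 1)"
      using validD(3)[OF valid, of u] deg[of u] by (intro mult_le_mono) (simp_all only: length_sorted_list_of_set add_le_mono1)
    moreover have "Inv (ys @ [u]) s'"
    proof -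
      have "col s' w \<noteq> Some c" if "E v w" "col s' v = Some c" for v w c
        using that c0 proper[of v w c] E_sym[of v w] E_irr
        by (auto simp: s'_def split: if_splits)
      then show ?thesis using s old new u by (auto simp: Inv_def s'_def)
    qed
    ultimately show "\<exists>s' t'. ?f u s t = return_spmf (s', t') \<and> t' \<le> t + K * (\<Delta> + 1) \<and> Inv (ys @ [u]) s'"
      by (intro exI conjI) auto
  qed
  then obtain s' t' where res: "for_each us ?f st (t + card V) = return_spmf (s', t')"
    "t' \<le> t + card V + length us * (K * (\<Delta> + 1) + 1)" "Inv us s'" by blast
  have "greedy_stage V E pick st t = return_spmf (s', t')"
  proof -
    have "greedy_stage V E pick st t = for_each us ?f st (t + card V)"
      unfolding greedy_stage_def
      by (rule trans[OF bind_timed_eval[OF select_eval]]) (simp only: us_def length_sorted_list_of_set)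
    then show ?thesis using res(1) by simp
  qed
  moreover have "proper_coloring V E (col s')"
    unfolding proper_coloring_def
  proof (intro conjI ballI impI)
    show "col s' u \<noteq> None" if "u \<in> V" for u
    proof (cases "u \<in> set us")
      case False
      then have "col s' u = col st u" "col st u \<noteq> None" using res(3) us(2) that by (auto simp: Inv_def)
      then show ?thesis by simp
    qed (use res(3) in \<open>auto simp: Inv_def\<close>)
    then show "col s' u \<noteq> col s' v" if "u \<in> V" "v \<in> V" "E u v" for u v
      using res(3) that unfolding Inv_def by (metis not_None_eq)
  qed
  moreover have "length us * (K * (\<Delta> + 1) + 1) \<le> card V * (K * (\<Delta> + 1) + 1)"
    using us(3) by (rule mult_le_mono1)
  ultimately show ?thesis using res(2) by (intro exI conjI) (auto simp: algebra_simps)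
qed


section \<open>Iterating the rounds\<close>

text \<open>
  The amount by which \<open>d\<^sub>t / s\<^sub>t\<close> decreases in each round of the first stage.
\<close>

definition \<beta> :: real where "\<beta> = 3/343 * exp (- 1/7)"

lemma \<beta>_bounds: "1/140 \<le> \<beta>" "\<beta> \<le> 3/343" "0 < \<beta>"
proof -
  have "6/7 \<le> exp (- 1/7 :: real)" using exp_ge_add_one_self[of "- 1/7 :: real"] by simp
  then show "1/140 \<le> \<beta>" "0 < \<beta>" by (auto simp: \<beta>_def)
  show "\<beta> \<le> 3/343" by (simp add: \<beta>_def)
qed

text \<open>
  The first stage takes at most \<open>T\<close> rounds and the second at most \<open>18 T + 1\<close>; \<open>s1\<close> is the value of
  \<open>s\<^sub>t\<close> after \<open>T\<close> rounds of the first stage, and \<open>s\<^sub>t\<close> does not fall below \<open>s1 / 2\<close> later. The three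
  error conditions express, in this order, that a round loses at most \<open>e'\<close> of the weight, that this
  is less than the slack in the degrees, and that \<open>x\<close> stays above \<open>95/100\<close> for all rounds. The
  numbers \<open>r\<close> and \<open>cost\<close> bound the failure probability and the running time of one round.
\<close>

locale coloring_run =
  fixes V :: "nat set" and E :: "nat \<Rightarrow> nat \<Rightarrow> bool" and K \<Delta> :: nat and pick :: choice_rule
    and T :: nat and e e' s1 H r :: real and cost :: nat
  assumes graph: "simple_graph V E" "triangle_free E" and pick: "choice_rule pick"
    and deg: "\<And>u. card {v. E u v} \<le> \<Delta>"
    and K: "1 \<le> K" "K \<le> \<Delta>" and T: "\<Delta> / (K * \<beta>) \<le> T"
    and s1: "s1 = K * exp (- (T / 7))" and e: "0 < e"
    and err: "K / s1\<^sup>2 + 4 * e * K / s1 \<le> e'" "e + e' \<le> \<beta> * K / (20 * real \<Delta>)"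
      "(19 * T + 1) * e' \<le> 1 / 20"
    and H: "H = e\<^sup>2 * s1\<^sup>2 / (200 * real K)"
    and cost: "cost = card V * (2 * \<Delta> + K * (4 * \<Delta> + 7) + 3)"
    and r: "r = card V * ((\<Delta> + K + 3) * exp (- H))"
begin

lemma pos: "0 < s1" "s1 \<le> K" "0 < e'" "0 \<le> r" "0 < real K" "0 < real \<Delta>"
proof -
  show "0 < real K" "0 < real \<Delta>" using K by auto
  then show s: "0 < s1" "s1 \<le> K" by (auto simp: s1)
  have "0 < K / s1\<^sup>2 + 4 * e * K / s1" using s e \<open>0 < real K\<close> by (intro add_pos_pos divide_pos_pos mult_pos_pos) auto
  then show "0 < e'" using err(1) by linarith
  show "0 \<le> r" by (simp add: r)
qed

lemma x_bounds:
  assumes "i \<le> 19 * T" shows "95/100 \<le> 1 - real i * e'" "1 - real i * e' \<le> 1"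
proof -
  have "real i * e' \<le> (19 * T + 1) * e'" using assms pos by (intro mult_right_mono) auto
  then show "95/100 \<le> 1 - real i * e'" using err(3) by linarith
  show "1 - real i * e' \<le> 1" using pos by simp
qed

abbreviation round_post :: "nat \<Rightarrow> real \<Rightarrow> real \<Rightarrow> real \<Rightarrow> nat \<Rightarrow> state \<Rightarrow> nat \<Rightarrow> bool" where
  "round_post i \<eta>' d' s' t \<equiv> \<lambda>st' t'. valid E K st' \<and> balanced V E (1 - real (Suc i) * e') st' \<and>
     eta st' = \<eta>' \<and> dd st' = d' \<and> ss st' = s' \<and> t' \<le> t + cost"

text \<open>
  Every round that is entered, in either stage, satisfies these bounds in terms of \<open>s1\<close>.
\<close>

lemma round_step:
  assumes st: "valid E K st" "balanced V E (1 - real i * e') st" and i: "i \<le> 19 * T"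
    and s: "s1 / 2 \<le> ss st" "ss st \<le> K" and \<eta>: "s1 / 49 \<le> eta st" "eta st \<le> \<Delta>"
    and d: "s1\<^sup>2 / (49 * real K) \<le> dd st"
    and pp: "0 < p" "p \<le> K / s1\<^sup>2" "p * dd st \<le> 1/49" "p * ss st \<le> 1"
    and \<delta>_eq: "\<delta> = exp (- 7 * p * dd st)" and a: "a = 3/7 * \<delta> * p * ss st" "\<beta> * K / \<Delta> \<le> a"
  shows "achieves (round_timed V E 7 pick p \<delta> (eta st * (1 - a)) (dd st * (1 - a) * \<delta>) (ss st * \<delta>) st) t
    (round_post i (eta st * (1 - a)) (dd st * (1 - a) * \<delta>) (ss st * \<delta>) t) r"
proof -
  have "0 < s1\<^sup>2 / (49 * real K)" using pos by simp
  then have dpos: "0 < dd st" using d by linarith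
  have "K / s1\<^sup>2 \<le> e'"
  proof -
    have "0 \<le> 4 * e * K / s1" using e pos by simp
    then show ?thesis using err(1) by linarith
  qed
  moreover have "e' \<le> 1/20"
  proof -
    have "1 * e' \<le> (19 * T + 1) * e'" using pos by (intro mult_right_mono) auto
    then show ?thesis using err(3) by linarith
  qed
  ultimately have p_half: "p \<le> 1/2" using pp by linarith
  have \<delta>01: "0 < \<delta>" "\<delta> \<le> 1" using pp dpos by (auto simp: \<delta>_eq)
  interpret coloring_round V E K st p \<delta> pick \<Delta>
    using graph pick st(1) pp p_half \<delta>01 deg by unfold_locales auto
  have "nibble_round uncolored E (pal st) p \<delta> (dd st) (ss st) (eta st) (real K) a (1 - real i * e') e e' H"
  proof unfold_locales
    show "0 < dd st" by (rule dpos)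
    show "0 < ss st" "0 < eta st" using s \<eta> pos by linarith+
    show "ss st \<le> real K" "0 < e" "p \<le> 1/2" "p * dd st \<le> 1/49" "p * ss st \<le> 1"
      "\<delta> = exp (- 7 * p * dd st)" "a = 3/7 * \<delta> * p * ss st"
      by (rule s e p_half pp \<delta>_eq a)+
    show "95/100 \<le> 1 - real i * e'" "1 - real i * e' \<le> 1" using x_bounds[OF i] by auto
    have "2 * e * K / ss st \<le> 2 * e * K / (s1 / 2)"
      using s pos e by (intro divide_left_mono mult_pos_pos) auto
    then show "p + 2 * e * K / ss st \<le> e'" using err(1) pp(2) by simp
    have "\<beta> * K / (20 * real \<Delta>) = \<beta> * K / \<Delta> / 20" by simp
    then show "e + e' \<le> a / 20" using err(2) a(2) by simp
    have s2: "s1\<^sup>2 / 4 \<le> (ss st)\<^sup>2"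
      using power_mono[OF s(1), of 2] pos by (simp add: power_divide)
    show "H \<le> 2 * e\<^sup>2 * (ss st)\<^sup>2 / (49 * real K)"
    proof -
      have "H = e\<^sup>2 * (s1\<^sup>2 / 4) / (50 * real K)" by (simp add: H)
      also have "\<dots> \<le> e\<^sup>2 * (ss st)\<^sup>2 / (50 * real K)"
        using s2 pos by (intro divide_right_mono mult_left_mono) auto
      also have "\<dots> \<le> 2 * e\<^sup>2 * (ss st)\<^sup>2 / (49 * real K)"
        using pos by (intro frac_le) auto
      finally show ?thesis .
    qed
    have H': "H = e\<^sup>2 * (s1\<^sup>2 / (49 * real K)) * (49 / 200)" by (simp add: H)
    show "H \<le> 2 * e\<^sup>2 * dd st / 7"
    proof -
      have "H \<le> e\<^sup>2 * dd st * (49 / 200)"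
        unfolding H' using d by (intro mult_right_mono mult_left_mono) auto
      also have "\<dots> \<le> e\<^sup>2 * dd st * (2 / 7)" using dpos by (intro mult_left_mono) auto
      finally show ?thesis by simp
    qed
    show "H \<le> 2 * e\<^sup>2 * eta st"
    proof -
      have "s1\<^sup>2 / (49 * real K) \<le> s1 / 49"
        using pos mult_left_mono[OF pos(2), of s1] by (simp add: field_simps power2_eq_square)
      then have "s1\<^sup>2 / (49 * real K) \<le> eta st" using \<eta> by linarith
      then have "H \<le> e\<^sup>2 * eta st * (49 / 200)"
        unfolding H' by (intro mult_right_mono mult_left_mono) auto
      also have "\<dots> \<le> e\<^sup>2 * eta st * 2" using \<eta> pos by (intro mult_left_mono) auto
      finally show ?thesis by simp
    qed
    fix v assume v: "v \<in> uncolored"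
    show "real (card (pal st v)) \<le> real K" using validD(3)[OF st(1)] by simp
    show "6 * (1 - real i * e') * dd st * ss st \<le> (\<Sum>c\<in>pal st v. max 0 (7 * dd st - real (card (nbc v c))))"
      "real (card (nb v)) \<le> (1 - real i * e') * eta st"
      using st(2) v unfolding balanced_def nb_eq by (auto simp: in_uncolored)
  qed
  from round_achieves[OF this, of t] show ?thesis
  proof (rule achieves_mono)
    have x: "1 - real i * e' - e' = 1 - real (Suc i) * e'" by (simp add: algebra_simps)
    fix st' t' assume "valid E K st' \<and> balanced V E (1 - real i * e' - e') st' \<and>
       eta st' = eta st * (1 - a) \<and> dd st' = dd st * (1 - a) * \<delta> \<and> ss st' = ss st * \<delta> \<and>
       t' \<le> t + card V * (2 * \<Delta> + K * (4 * \<Delta> + 7) + 3)"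
    then show "round_post i (eta st * (1 - a)) (dd st * (1 - a) * \<delta>) (ss st * \<delta>) t st' t'"
      unfolding x cost by simp
  next
    show "card V * ((eta st + K + 3) * exp (- H)) \<le> r"
      unfolding r using \<eta> by (intro mult_left_mono mult_right_mono) auto
  qed
qed

text \<open>
  The ratio \<open>d\<^sub>t / s\<^sub>t\<close> after \<open>i\<close> rounds of the first stage.
\<close>

definition \<rho>1 :: "nat \<Rightarrow> real" where "\<rho>1 i = \<Delta> / K - i * \<beta>"

definition first_inv :: "nat \<Rightarrow> nat \<Rightarrow> state \<Rightarrow> nat \<Rightarrow> bool" where
  "first_inv t0 i st t \<longleftrightarrow> valid E K st \<and> balanced V E (1 - real i * e') st \<and>
     ss st = K * exp (- (i / 7)) \<and> eta st = K * \<rho>1 i \<and> dd st = ss st * \<rho>1 i \<and> 0 < \<rho>1 i \<and>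
     t \<le> t0 + i * (cost + 1)"

lemma first_inv_bound:
  assumes "0 < \<rho>1 i" shows "i < T"
proof -
  have "i * \<beta> < \<Delta> / K" using assms by (simp add: \<rho>1_def)
  then have "i < \<Delta> / (K * \<beta>)" using \<beta>_bounds pos by (simp add: field_simps)
  then show ?thesis using T by linarith
qed

lemma first_step:
  assumes inv: "first_inv t0 i st t" and g: "\<not> dd st / ss st < 1 / 7\<^sup>2"
  shows "achieves (first_stage_round V E 7 pick st) (t + 1) (first_inv t0 (Suc i)) r"
proof -
  let ?\<rho> = "\<rho>1 i"
  have st: "valid E K st" "balanced V E (1 - real i * e') st" and s: "ss st = K * exp (- (i / 7))"
    and \<eta>: "eta st = K * ?\<rho>" and d: "dd st = ss st * ?\<rho>" and \<rho>0: "0 < ?\<rho>" and t: "t \<le> t0 + i * (cost + 1)"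
    using inv unfolding first_inv_def by blast+
  have spos: "0 < ss st" using s pos by simp
  have \<rho>: "1/49 \<le> ?\<rho>" using g d spos by simp
  have iT: "i < T" by (rule first_inv_bound[OF \<rho>0])
  have s1s: "s1 \<le> ss st" unfolding s s1 using iT pos by simp
  have "K * exp (- (i / 7)) \<le> real K * 1" by (intro mult_left_mono) auto
  then have sK: "ss st \<le> K" by (simp add: s)
  have dpos: "0 < dd st" using d spos \<rho>0 by simp
  define p where "p = 1 / (49 * dd st)"
  define \<delta> where "\<delta> = exp (- 1/7 :: real)"
  define a where "a = 3/343 * \<delta> * (ss st / dd st)"
  have a_eq: "a = \<beta> / ?\<rho>" using d spos by (simp add: a_def \<beta>_def \<delta>_def)
  have ds: "s1 / 49 \<le> dd st"
  proof -
    have "s1 * (1/49) \<le> ss st * ?\<rho>" using s1s \<rho> pos by (intro mult_mono) auto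
    then show ?thesis using d by simp
  qed
  have s1K: "s1\<^sup>2 / K \<le> s1"
    using pos mult_left_mono[OF pos(2), of s1] by (simp add: field_simps power2_eq_square)
  have "achieves (round_timed V E 7 pick p \<delta> (eta st * (1 - a)) (dd st * (1 - a) * \<delta>) (ss st * \<delta>) st) (t + 1)
    (round_post i (eta st * (1 - a)) (dd st * (1 - a) * \<delta>) (ss st * \<delta>) (t + 1)) r"
  proof (rule round_step[OF st])
    show "i \<le> 19 * T" using iT by simp
    show "s1 / 2 \<le> ss st" "ss st \<le> K" using s1s sK pos by auto
    have "K * (1/49) \<le> K * ?\<rho>" using \<rho> by (intro mult_left_mono) auto
    then show "s1 / 49 \<le> eta st" using pos(2) unfolding \<eta> by linarith
    have "K * ?\<rho> \<le> K * (\<Delta> / K)" using \<beta>_bounds by (intro mult_left_mono) (auto simp: \<rho>1_def)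
    then show "eta st \<le> \<Delta>" using pos by (simp add: \<eta>)
    have "s1\<^sup>2 / (49 * real K) = s1\<^sup>2 / K / 49" by simp
    then show "s1\<^sup>2 / (49 * real K) \<le> dd st" using s1K ds by linarith
    show "0 < p" using dpos by (simp add: p_def)
    show "p \<le> K / s1\<^sup>2"
    proof -
      have "p \<le> 1 / s1" using ds pos dpos by (simp add: p_def field_simps)
      also have "\<dots> \<le> K / s1\<^sup>2" using pos by (simp add: field_simps power2_eq_square)
      finally show ?thesis .
    qed
    show "p * dd st \<le> 1/49" using dpos by (simp add: p_def)
    show "p * ss st \<le> 1" using d \<rho> spos \<rho>0 by (simp add: p_def field_simps)
    show "\<delta> = exp (- 7 * p * dd st)" using dpos by (simp add: \<delta>_def p_def)
    show "a = 3/7 * \<delta> * p * ss st" by (simp add: a_def p_def)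
    show "\<beta> * K / \<Delta> \<le> a"
    proof -
      have "?\<rho> \<le> \<Delta> / K" using \<beta>_bounds by (simp add: \<rho>1_def)
      then have "\<beta> / (\<Delta> / K) \<le> \<beta> / ?\<rho>" using \<rho>0 \<beta>_bounds pos by (intro divide_left_mono mult_pos_pos) auto
      then show ?thesis by (simp add: a_eq)
    qed
  qed
  moreover have "first_stage_round V E 7 pick st =
      round_timed V E 7 pick p \<delta> (eta st * (1 - a)) (dd st * (1 - a) * \<delta>) (ss st * \<delta>) st"
    by (simp add: first_stage_round_def Let_def p_def \<delta>_def a_def)
  moreover have "first_inv t0 (Suc i) st' t'"
    if "round_post i (eta st * (1 - a)) (dd st * (1 - a) * \<delta>) (ss st * \<delta>) (t + 1) st' t'" for st' t'
  proof -
    have "?\<rho> * (1 - a) = ?\<rho> - \<beta>" using \<rho>0 by (simp add: a_eq right_diff_distrib)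
    then have \<rho>': "?\<rho> * (1 - a) = \<rho>1 (Suc i)" by (simp add: \<rho>1_def algebra_simps)
    have "exp (- (Suc i / 7)) = exp (- (i / 7)) * exp (- 1/7 :: real)"
      by (subst exp_add[symmetric]) (simp add: field_simps)
    then have "K * exp (- (i / 7)) * \<delta> = K * exp (- (Suc i / 7))"
      by (simp add: \<delta>_def)
    moreover have "dd st * (1 - a) * \<delta> = ss st * \<delta> * (?\<rho> * (1 - a))" by (simp add: d)
    moreover have "eta st * (1 - a) = K * (?\<rho> * (1 - a))" by (simp add: \<eta>)
    moreover have "0 < \<rho>1 (Suc i)" using \<rho> \<beta>_bounds by (simp add: \<rho>1_def algebra_simps)
    ultimately show ?thesis using that t unfolding first_inv_def \<rho>' s by auto
  qed
  ultimately show ?thesis by (auto intro: achieves_mono)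
qed

text \<open>
  The first stage took \<open>j\<close> rounds and the second \<open>m\<close> so far. In one round \<open>s\<close> shrinks by the factor
  \<open>exp (- \<rho> / 7)\<close>, while \<open>\<rho> = d\<^sub>t / s\<^sub>t\<close> drops by at least \<open>\<rho> / 120 \<ge> \<rho> / (7 * 18)\<close>. Hence \<open>s exp (- 18 \<rho>)\<close> does
  not decrease, which is how \<open>s\<close> is bounded below over all rounds.
\<close>

definition second_inv :: "nat \<Rightarrow> nat \<Rightarrow> nat \<Rightarrow> state \<Rightarrow> nat \<Rightarrow> bool" where
  "second_inv t0 j m st t \<longleftrightarrow> valid E K st \<and> balanced V E (1 - real (j + m) * e') st \<and> j \<le> T \<and>
     (\<exists>\<rho>::real. 0 < \<rho> \<and> eta st = K * \<rho> \<and> dd st = ss st * \<rho> \<and> \<rho> \<le> (119/120) ^ m / 49 \<and>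
        s1 * exp (18 * \<rho> - 18/49) \<le> ss st \<and> ss st \<le> K) \<and> t \<le> t0 + m * (cost + 1)"

lemma half_le_exp: "0 \<le> \<rho> \<Longrightarrow> s1 / 2 \<le> s1 * exp (18 * \<rho> - 18/49)"
proof -
  assume "0 \<le> \<rho>"
  then have "1 / 2 \<le> exp (18 * \<rho> - 18/49)" using exp_ge_add_one_self[of "18 * \<rho> - 18/49"] by linarith
  then show ?thesis using pos mult_left_mono[of "1/2" "exp (18 * \<rho> - 18/49)" s1] by simp
qed

lemma second_inv_bound:
  assumes inv: "second_inv t0 j m st t" and g: "\<not> eta st < (7 - 1) / 7 * ss st"
  shows "m < 18 * T + 1"
proof -
  obtain \<rho> :: real where \<rho>: "0 < \<rho>" "eta st = K * \<rho>" "\<rho> \<le> (119/120) ^ m / 49"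
      "s1 * exp (18 * \<rho> - 18/49) \<le> ss st"
    using inv unfolding second_inv_def by (elim exE conjE, intro that)
  \<comment> \<open>while the stage runs, \<open>\<rho>\<close> is at least of the order \<open>s / K\<close>, but it decays geometrically\<close>
  have "6/7 * ss st \<le> K * \<rho>" using g \<rho>(2) by simp
  moreover have "s1 / 2 \<le> ss st" using \<rho>(1,4) half_le_exp[of \<rho>] by linarith
  ultimately have "3/7 * s1 \<le> K * \<rho>" by linarith
  then have "3/7 * exp (- (T / 7)) \<le> \<rho>" using pos by (simp add: s1)
  also have "\<dots> \<le> (119/120) ^ m / 49" by (rule \<rho>)
  also have "(119/120 :: real) ^ m \<le> exp (- 1/120) ^ m"
    using exp_ge_add_one_self[of "- 1/120 :: real"] by (intro power_mono) auto
  also have "exp (- 1/120 :: real) ^ m = exp (- (m / 120))" by (simp flip: exp_of_nat_mult)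
  finally have "21 * exp (- (T / 7)) \<le> exp (- (m / 120))" by simp
  moreover have "1 * exp (- (T / 7)) \<le> 21 * exp (- (T / 7))" by (intro mult_right_mono) auto
  ultimately have "exp (- (T / 7)) \<le> exp (- (m / 120))" by linarith
  then have "7 * real m \<le> 120 * real T" by simp
  then show ?thesis by linarith
qed

lemma second_step:
  assumes inv: "second_inv t0 j m st t" and g: "\<not> eta st < (7 - 1) / 7 * ss st"
  shows "achieves (second_stage_round V E 7 pick st) (t + 1) (second_inv t0 j (Suc m)) r"
proof -
  obtain \<rho> :: real where \<rho>0: "0 < \<rho>" and \<eta>: "eta st = K * \<rho>" and d: "dd st = ss st * \<rho>"
      and \<rho>m: "\<rho> \<le> (119/120) ^ m / 49" and s: "s1 * exp (18 * \<rho> - 18/49) \<le> ss st" and sK: "ss st \<le> K"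
    using inv unfolding second_inv_def by (elim exE conjE, intro that)
  have st: "valid E K st" "balanced V E (1 - real (j + m) * e') st" and j: "j \<le> T"
    and t: "t \<le> t0 + m * (cost + 1)"
    using inv unfolding second_inv_def by simp_all
  have mT: "m < 18 * T + 1" by (rule second_inv_bound[OF inv g])
  have s1s: "s1 / 2 \<le> ss st" using half_le_exp[of \<rho>] \<rho>0 s by simp
  then have spos: "0 < ss st" using pos by linarith
  have "(119/120 :: real) ^ m \<le> 1" by (intro power_le_one) auto
  then have \<rho>1: "\<rho> \<le> 1/49" using \<rho>m by linarith
  have dpos: "0 < dd st" using d spos \<rho>0 by simp
  define p where "p = 1 / (49 * ss st)"
  define \<delta> where "\<delta> = exp (- 1/7 * (dd st / ss st))"
  define a where "a = 3/343 * \<delta>"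
  have \<delta>_eq: "\<delta> = exp (- (\<rho> / 7))" using spos by (simp add: \<delta>_def d)
  have "342/343 \<le> \<delta>" using exp_ge_add_one_self[of "- (\<rho> / 7)"] \<rho>1 unfolding \<delta>_eq by linarith
  then have a: "1/120 \<le> a" by (simp add: a_def)
  have a1: "a \<le> 3/343" using \<rho>0 by (simp add: a_def \<delta>_eq)
  have \<eta>s: "6/7 * ss st \<le> eta st" using g by simp
  have "achieves (round_timed V E 7 pick p \<delta> (eta st * (1 - a)) (dd st * (1 - a) * \<delta>) (ss st * \<delta>) st) (t + 1)
    (round_post (j + m) (eta st * (1 - a)) (dd st * (1 - a) * \<delta>) (ss st * \<delta>) (t + 1)) r"
  proof (rule round_step[OF st])
    show "j + m \<le> 19 * T" using j mT by simp
    show "s1 / 2 \<le> ss st" "ss st \<le> K" by (rule s1s sK)+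
    show "s1 / 49 \<le> eta st" using \<eta>s s1s pos by linarith
    have "K * \<rho> \<le> real K * 1" using \<rho>1 by (intro mult_left_mono) auto
    moreover have "real K \<le> real \<Delta>" using K by simp
    ultimately show "eta st \<le> \<Delta>" unfolding \<eta> by linarith
    show "s1\<^sup>2 / (49 * real K) \<le> dd st"
    proof -
      have "s1 / 2 * (6/7 * (s1 / 2)) \<le> ss st * (6/7 * ss st)"
        using s1s pos by (intro mult_mono) auto
      also have "\<dots> \<le> ss st * eta st" using \<eta>s spos by (intro mult_left_mono) auto
      also have "\<dots> = K * dd st" by (simp add: \<eta> d)
      finally have "3/14 * s1\<^sup>2 \<le> K * dd st" by (simp add: power2_eq_square)
      moreover have "1/49 * s1\<^sup>2 \<le> 3/14 * s1\<^sup>2" by (intro mult_right_mono) auto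
      ultimately have "1/49 * s1\<^sup>2 \<le> K * dd st" by linarith
      then show ?thesis using pos by (simp add: field_simps)
    qed
    show "0 < p" using spos by (simp add: p_def)
    show "p \<le> K / s1\<^sup>2"
    proof -
      have "p \<le> 1 / s1" using s1s pos spos by (simp add: p_def field_simps)
      also have "\<dots> \<le> K / s1\<^sup>2" using pos by (simp add: field_simps power2_eq_square)
      finally show ?thesis .
    qed
    show "p * dd st \<le> 1/49" "p * ss st \<le> 1" using spos \<rho>1 by (auto simp: p_def d)
    show "\<delta> = exp (- 7 * p * dd st)" using spos by (simp add: \<delta>_def p_def)
    show "a = 3/7 * \<delta> * p * ss st" using spos by (simp add: a_def p_def)
    show "\<beta> * K / \<Delta> \<le> a"
    proof -
      have "\<beta> \<le> a" using \<rho>1 by (simp add: \<beta>_def a_def \<delta>_eq)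
      moreover have "\<beta> * (K / \<Delta>) \<le> \<beta> * 1" using K pos \<beta>_bounds by (intro mult_left_mono) auto
      ultimately show ?thesis by simp
    qed
  qed
  moreover have "second_stage_round V E 7 pick st =
      round_timed V E 7 pick p \<delta> (eta st * (1 - a)) (dd st * (1 - a) * \<delta>) (ss st * \<delta>) st"
    by (simp add: second_stage_round_def Let_def p_def \<delta>_def a_def)
  moreover have "second_inv t0 j (Suc m) st' t'"
    if post: "round_post (j + m) (eta st * (1 - a)) (dd st * (1 - a) * \<delta>) (ss st * \<delta>) (t + 1) st' t'" for st' t'
  proof -
    let ?\<rho>' = "\<rho> * (1 - a)"
    have "0 < ?\<rho>'" using \<rho>0 a1 by simp
    moreover have "?\<rho>' \<le> (119/120) ^ Suc m / 49"
    proof -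
      have "?\<rho>' \<le> (119/120) ^ m / 49 * (119/120)" using \<rho>m a a1 \<rho>0 by (intro mult_mono) auto
      then show ?thesis by simp
    qed
    moreover have "s1 * exp (18 * ?\<rho>' - 18/49) \<le> ss st * \<delta>"
    proof -
      have "1/126 * \<rho> \<le> a * \<rho>" using a \<rho>0 by (intro mult_right_mono) auto
      then have "18 * ?\<rho>' - 18/49 \<le> 18 * \<rho> - 18/49 + - (\<rho> / 7)" by (simp add: algebra_simps)
      then have "s1 * exp (18 * ?\<rho>' - 18/49) \<le> s1 * exp (18 * \<rho> - 18/49 + - (\<rho> / 7))"
        using pos by simp
      also have "\<dots> = s1 * exp (18 * \<rho> - 18/49) * \<delta>" by (simp only: \<delta>_eq exp_add mult.assoc)
      also have "\<dots> \<le> ss st * \<delta>" using s by (intro mult_right_mono) (auto simp: \<delta>_eq)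
      finally show ?thesis .
    qed
    moreover have "ss st * \<delta> \<le> K"
    proof -
      have "ss st * \<delta> \<le> real K * 1" using sK \<rho>0 by (intro mult_mono) (auto simp: \<delta>_eq)
      then show ?thesis by simp
    qed
    moreover have "eta st' = K * ?\<rho>'" "dd st' = ss st' * ?\<rho>'" "ss st' = ss st * \<delta>"
      using post by (auto simp: \<eta> d)
    ultimately have "\<exists>\<rho>::real. 0 < \<rho> \<and> eta st' = K * \<rho> \<and> dd st' = ss st' * \<rho> \<and> \<rho> \<le> (119/120) ^ Suc m / 49 \<and>
        s1 * exp (18 * \<rho> - 18/49) \<le> ss st' \<and> ss st' \<le> K" by (intro exI[of _ ?\<rho>']) simp
    moreover have "t' \<le> t0 + Suc m * (cost + 1)" using post t by simp
    moreover have "valid E K st'" "balanced V E (1 - real (j + Suc m) * e') st'" using post by auto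
    ultimately show ?thesis using j unfolding second_inv_def by blast
  qed
  ultimately show ?thesis by (auto intro: achieves_mono)
qed

definition total_cost :: nat where
  "total_cost = card V * (K + 1) + (19 * T + 1) * (cost + 1) + 2 + card V * (K * (\<Delta> + 1) + 2)"

lemma coloring_algorithm_achieves:
  "achieves (coloring_algorithm V E \<Delta> K 7 pick) 0
     (\<lambda>f t. proper_coloring V E f \<and> t \<le> total_cost) ((19 * T + 1) * r)"
proof -
  let ?t0 = "card V * (K + 1)"
  let ?init = "\<lparr>eta = real \<Delta>, dd = real \<Delta>, ss = real K, col = (\<lambda>_. None), pal = (\<lambda>_. {1..K})\<rparr>"
  let ?P1 = "\<lambda>st t. \<exists>i\<le>T. \<exists>t1. first_inv ?t0 i st t1 \<and> \<not> \<not> dd st / ss st < 1 / 7\<^sup>2 \<and> t = t1 + 1"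
  have init: "first_inv ?t0 0 ?init ?t0"
  proof -
    have "balanced V E 1 ?init"
      unfolding balanced_def
    proof (intro ballI impI)
      fix u
      have le: "card (free_nbs E ?init u) \<le> \<Delta>" using deg[of u] by (simp add: free_nbs_def)
      have "(\<Sum>c\<in>{1..K}. 6 * real \<Delta>) \<le> (\<Sum>c\<in>{1..K}. max 0 (7 * real \<Delta> - real (card {v \<in> free_nbs E ?init u. c \<in> {1..K}})))"
      proof (rule sum_mono)
        fix c assume "c \<in> {1..K}"
        then have "{v \<in> free_nbs E ?init u. c \<in> {1..K}} = free_nbs E ?init u" by auto
        then show "6 * real \<Delta> \<le> max 0 (7 * real \<Delta> - real (card {v \<in> free_nbs E ?init u. c \<in> {1..K}}))"
          using le by (simp del: of_nat_Suc)
      qed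
      then show "real (card (free_nbs E ?init u)) \<le> 1 * eta ?init \<and>
         6 * 1 * dd ?init * ss ?init \<le> (\<Sum>c\<in>pal ?init u. max 0 (7 * dd ?init - real (card {v \<in> free_nbs E ?init u. c \<in> pal ?init v})))"
        using le by (simp add: mult_ac)
    qed
    then show ?thesis using pos K by (simp add: first_inv_def \<rho>1_def valid_def)
  qed
  have first: "achieves (while_timed (\<lambda>st. \<not> dd st / ss st < 1 / 7\<^sup>2) (first_stage_round V E 7 pick) ?init) ?t0 ?P1 (T * r)"
    using achieves_while[where T = T and Inv = "first_inv ?t0" and g = "\<lambda>st. \<not> dd st / ss st < 1 / 7\<^sup>2"
        and f = "first_stage_round V E 7 pick" and r = r, OF _ _ pos(4) init]
      first_step first_inv_bound by (auto simp: first_inv_def)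
  let ?P2 = "\<lambda>st t. valid E K st \<and> (\<forall>u\<in>V. col st u = None \<longrightarrow> card (free_nbs E st u) < card (pal st u)) \<and>
      t \<le> ?t0 + (19 * T + 1) * (cost + 1) + 2"
  have second: "achieves (while_timed (\<lambda>st. \<not> eta st < (7 - 1) / 7 * ss st) (second_stage_round V E 7 pick) st) t ?P2
      ((18 * T + 1) * r)" if P1: "?P1 st t" for st t
  proof -
    obtain i t1 where i: "i \<le> T" "first_inv ?t0 i st t1" "dd st / ss st < 1 / 7\<^sup>2" "t = t1 + 1"
      using P1 by blast
    have s: "ss st = K * exp (- (i / 7))" and d: "dd st = ss st * \<rho>1 i" and \<rho>0: "0 < \<rho>1 i"
      and t1: "t1 \<le> ?t0 + i * (cost + 1)"
      using i(2) unfolding first_inv_def by blast+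
    have spos: "0 < ss st" using s pos by simp
    have \<rho>: "\<rho>1 i < 1/49" using i(3) d spos by simp
    have "s1 * exp (18 * \<rho>1 i - 18/49) \<le> ss st"
    proof -
      have "s1 * exp (18 * \<rho>1 i - 18/49) \<le> s1 * 1" using \<rho> pos by (intro mult_left_mono) auto
      also have "\<dots> \<le> ss st" unfolding s s1 using i(1) pos by simp
      finally show ?thesis .
    qed
    moreover have "ss st \<le> K"
    proof -
      have "K * exp (- (i / 7)) \<le> real K * 1" by (intro mult_left_mono) auto
      then show ?thesis by (simp add: s)
    qed
    ultimately have "\<exists>\<rho>::real. 0 < \<rho> \<and> eta st = K * \<rho> \<and> dd st = ss st * \<rho> \<and> \<rho> \<le> (119/120) ^ 0 / 49 \<and>
        s1 * exp (18 * \<rho> - 18/49) \<le> ss st \<and> ss st \<le> K"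
      using i(2) \<rho>0 \<rho> unfolding first_inv_def by (intro exI[of _ "\<rho>1 i"]) simp
    then have inv: "second_inv t i 0 st t"
      using i(1,2) unfolding second_inv_def first_inv_def by simp
    have "achieves (while_timed (\<lambda>st. \<not> eta st < (7 - 1) / 7 * ss st) (second_stage_round V E 7 pick) st) t
       (\<lambda>st' t'. \<exists>m\<le>18 * T + 1. \<exists>t2. second_inv t i m st' t2 \<and> \<not> \<not> eta st' < (7 - 1) / 7 * ss st' \<and> t' = t2 + 1)
       (real (18 * T + 1 - 0) * r)"
      using second_step second_inv_bound
      by (intro achieves_while[where Inv = "second_inv t i"] pos inv) auto
    then show ?thesis
    proof (rule achieves_mono)
      fix st' t'
      assume "\<exists>m\<le>18 * T + 1. \<exists>t2. second_inv t i m st' t2 \<and> \<not> \<not> eta st' < (7 - 1) / 7 * ss st' \<and> t' = t2 + 1"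
      then obtain m t2 where m: "m \<le> 18 * T + 1" "second_inv t i m st' t2" "eta st' < 6 / 7 * ss st'" "t' = t2 + 1"
        by auto
      obtain \<rho> :: real where \<rho>: "0 < \<rho>" "dd st' = ss st' * \<rho>" "s1 * exp (18 * \<rho> - 18/49) \<le> ss st'"
        and bal: "balanced V E (1 - real (i + m) * e') st'" and v: "valid E K st'"
        and t2: "t2 \<le> t + m * (cost + 1)"
        using m(2) unfolding second_inv_def by (elim exE conjE, intro that)
      have "0 < ss st'" using half_le_exp[of \<rho>] \<rho> pos by linarith
      then have dpos: "0 < dd st'" using \<rho> by simp
      define x where "x = 1 - real (i + m) * e'"
      have x: "0 < x"
      proof -
        have "real (i + m) * e' \<le> (19 * T + 1) * e'" using i(1) m(1) pos by (intro mult_right_mono) auto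
        then show ?thesis using err(3) unfolding x_def by linarith
      qed
      have "card (free_nbs E st' u) < card (pal st' u)" if u: "u \<in> V" "col st' u = None" for u
      proof -
        have deg': "real (card (free_nbs E st' u)) \<le> x * eta st'"
          and w: "6 * x * dd st' * ss st' \<le>
            (\<Sum>c\<in>pal st' u. max 0 (7 * dd st' - real (card {v \<in> free_nbs E st' u. c \<in> pal st' v})))"
          using bal u unfolding balanced_def x_def by blast+
        have "6 * x * dd st' * ss st' \<le> (\<Sum>c\<in>pal st' u. 7 * dd st')"
          using dpos by (intro order_trans[OF w] sum_mono) auto
        then have "dd st' * (6 * x * ss st') \<le> dd st' * (7 * card (pal st' u))" by (simp add: mult_ac)
        then have "6 / 7 * x * ss st' \<le> card (pal st' u)" using dpos by simp
        moreover have "x * eta st' < x * (6 / 7 * ss st')" using m(3) x by (rule mult_strict_left_mono)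
        ultimately show ?thesis using deg' by (simp add: mult_ac)
      qed
      moreover have "t' \<le> ?t0 + (19 * T + 1) * (cost + 1) + 2"
      proof -
        have "i * (cost + 1) + m * (cost + 1) \<le> (19 * T + 1) * (cost + 1)"
          unfolding add_mult_distrib[symmetric] using i(1) m(1) by (intro mult_le_mono1) simp
        then show ?thesis using m(4) t2 i(4) t1 by linarith
      qed
      ultimately show "?P2 st' t'" using v by blast
    qed simp
  qed
  have greedy: "achieves (greedy_stage V E pick st) t (\<lambda>st' t'. proper_coloring V E (col st') \<and> t' \<le> total_cost) 0"
    if P2: "?P2 st t" for st t
  proof -
    obtain st' t' where "greedy_stage V E pick st t = return_spmf (st', t')" "proper_coloring V E (col st')"
      "t' \<le> t + card V * (K * (\<Delta> + 1) + 2)"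
      using greedy_stage_completes[OF graph(1) pick, of K st \<Delta> t] P2 deg by blast
    then show ?thesis using P2 by (intro achieves_return) (auto simp: total_cost_def)
  qed
  have rest: "achieves (bind_timed (while_timed (\<lambda>st. \<not> eta st < (7 - 1) / 7 * ss st) (second_stage_round V E 7 pick) st)
       (\<lambda>st. bind_timed (greedy_stage V E pick st) (\<lambda>st. ret (col st)))) t
     (\<lambda>f t. proper_coloring V E f \<and> t \<le> total_cost) ((18 * T + 1) * r + (0 + 0))" if "?P1 st t" for st t
    by (rule achieves_bind[OF second[OF that]], rule achieves_bind[OF greedy])
       (auto intro: achieves_return[OF ret_eval])
  have "achieves (coloring_algorithm V E \<Delta> K 7 pick) 0
     (\<lambda>f t. proper_coloring V E f \<and> t \<le> total_cost) (T * r + ((18 * T + 1) * r + (0 + 0)))"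
    using achieves_bind[OF first rest] pos(4)
    unfolding achieves_def coloring_algorithm_def bind_timed_eval[OF charge_eval] by simp
  then show ?thesis by (rule achieves_mono) (auto simp: algebra_simps)
qed

end


section \<open>The parameters for large maximum degree\<close>

text \<open>
  What the choices \<open>e = \<Delta> powr (- 2 \<kappa>)\<close>, \<open>e' = \<Delta> powr (- \<kappa> / 2)\<close> and \<open>c = 40 / \<kappa>\<close> require of \<open>\<Delta>\<close>. The
  last condition makes \<open>exp H\<close> exceed \<open>n\<^sup>2\<close> times the number of bad events per vertex, over all rounds.
\<close>

definition large :: "real \<Rightarrow> real \<Rightarrow> real \<Rightarrow> bool" where
  "large \<kappa> c x \<longleftrightarrow> 1 \<le> x \<and> 1 \<le> ln x \<and> 2 \<le> c * x / ln x \<and> c / ln x \<le> 1 \<and>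
     8 * ln x * x powr (2 * \<kappa> - 1) / c + 8 * x powr (- \<kappa>) \<le> x powr (- (\<kappa> / 2)) \<and>
     x powr (- 2 * \<kappa>) + x powr (- (\<kappa> / 2)) \<le> c / (5600 * ln x) \<and>
     (19 * (7 * \<kappa> * ln x + 1) + 1) * x powr (- (\<kappa> / 2)) \<le> 1 / 20 \<and>
     2 * x powr (1 - 12 * \<kappa>) + ln ((133 * \<kappa> * ln x + 20) * (2 * x + 3)) \<le>
       c * x powr (1 - 6 * \<kappa>) / (1600 * ln x)"

lemma eventually_large:
  fixes \<kappa> c :: real
  assumes "0 < \<kappa>" "\<kappa> < 1/12" "0 < c"
  shows "eventually (large \<kappa> c) at_top"
  unfolding large_def using assms by (intro eventually_conj; real_asymp)

text \<open>
  With \<open>c = 40 / \<kappa>\<close> the first stage has \<open>T \<le> 7 \<kappa> ln \<Delta> + 1\<close> rounds, so \<open>s1\<close> is at least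
  \<open>K \<Delta> powr (- \<kappa>) / 2\<close> and \<open>H\<close> at least of order \<open>\<Delta> powr (1 - 6 \<kappa>) / ln \<Delta>\<close>, which exceeds any multiple of \<open>ln n\<close>.
\<close>

lemma coloring_run_large:
  fixes \<kappa> c :: real and V :: "nat set" and \<Delta> :: nat
  assumes \<kappa>: "0 < \<kappa>" "\<kappa> < 1/12" and c: "c = 40 / \<kappa>" and large: "large \<kappa> c \<Delta>"
    and graph: "simple_graph V E" "triangle_free E" and pick: "choice_rule pick"
    and deg: "\<And>u. card {v. E u v} \<le> \<Delta>"
    and n: "V \<noteq> {}" "ln (card V) \<le> \<Delta> powr (1 - 12 * \<kappa>)"
  shows "achieves (coloring_algorithm V E \<Delta> (nat \<lfloor>c * \<Delta> / ln \<Delta>\<rfloor>) 7 pick) 0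
     (\<lambda>f t. proper_coloring V E f \<and> t \<le> 50000 * (real (card V) * (real \<Delta>)\<^sup>2 * ln \<Delta>)) (1 / card V)"
proof -
  define x where "x = real \<Delta>"
  define L where "L = ln x"
  have x1: "1 \<le> x" and L: "1 \<le> L" and c2: "2 \<le> c * x / L" and cL: "c / L \<le> 1"
    and A1: "8 * L * x powr (2 * \<kappa> - 1) / c + 8 * x powr (- \<kappa>) \<le> x powr (- (\<kappa> / 2))"
    and A2: "x powr (- 2 * \<kappa>) + x powr (- (\<kappa> / 2)) \<le> c / (5600 * L)"
    and A3: "(19 * (7 * \<kappa> * L + 1) + 1) * x powr (- (\<kappa> / 2)) \<le> 1 / 20"
    and A4: "2 * x powr (1 - 12 * \<kappa>) + ln ((133 * \<kappa> * L + 20) * (2 * x + 3)) \<le> c * x powr (1 - 6 * \<kappa>) / (1600 * L)"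
    using large unfolding large_def x_def L_def by blast+
  have x0: "0 < x" and c0: "0 < c" using x1 \<kappa> by (auto simp: c)
  define K where "K = nat \<lfloor>c * \<Delta> / ln \<Delta>\<rfloor>"
  have K_def': "K = nat \<lfloor>c * x / L\<rfloor>" by (simp add: K_def x_def L_def)
  have K_up: "K \<le> c * x / L" unfolding K_def' using c2 by linarith
  have "c * x / L - 1 \<le> K" unfolding K_def' using c2 by linarith
  then have K_lo: "c * x / (2 * L) \<le> K" using c2 by simp
  have "1 \<le> real K" using K_lo c2 by simp
  then have K1: "1 \<le> K" and Kpos: "0 < real K" by auto
  have "c / L * x \<le> 1 * x" using cL x0 by (intro mult_right_mono) auto
  then have "real K \<le> real \<Delta>" using K_up by (simp add: x_def)
  then have K\<Delta>: "K \<le> \<Delta>" by simp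
  have Kx: "real K \<le> x" using K\<Delta> by (simp add: x_def)
  define T where "T = nat \<lceil>x / (K * \<beta>)\<rceil>"
  have pos: "0 < x / (K * \<beta>)" using x0 Kpos \<beta>_bounds by simp
  have T_lo: "x / (K * \<beta>) \<le> T" unfolding T_def by linarith
  have T_up: "T \<le> x / (K * \<beta>) + 1" unfolding T_def using pos by linarith
  have T1: "1 \<le> real T" using T_lo pos by (simp add: T_def)
  have TL: "T \<le> 7 * \<kappa> * L + 1"
  proof -
    have "c * x / (2 * L) * (1/140) \<le> K * \<beta>"
      using K_lo \<beta>_bounds c0 x0 L by (intro mult_mono) auto
    then have "x / (K * \<beta>) \<le> x / (c * x / (2 * L) * (1/140))"
      using x0 c0 L Kpos \<beta>_bounds by (intro divide_left_mono mult_pos_pos divide_pos_pos) auto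
    also have "\<dots> = 7 * \<kappa> * L" using x0 c0 L \<kappa> by (simp add: c field_simps)
    finally show ?thesis using T_up by linarith
  qed
  define s1 where "s1 = K * exp (- (T / 7))"
  have s1_lo: "K * x powr (- \<kappa>) / 2 \<le> s1"
  proof -
    have "1/2 \<le> exp (- (1/7) :: real)" using exp_ge_add_one_self[of "- (1/7) :: real"] by linarith
    then have "x powr (- \<kappa>) * (1/2) \<le> exp (- (\<kappa> * L)) * exp (- (1/7))"
      using x0 by (intro mult_mono) (auto simp: powr_def L_def)
    also have "\<dots> \<le> exp (- (T / 7))" using TL by (simp flip: exp_add)
    finally have "K * (x powr (- \<kappa>) * (1/2)) \<le> K * exp (- (T / 7))"
      using Kpos by (intro mult_left_mono) auto
    then show ?thesis by (simp add: s1_def)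
  qed
  have s1_pos: "0 < s1" using Kpos by (simp add: s1_def)
  define e where "e = x powr (- 2 * \<kappa>)"
  define e' where "e' = x powr (- (\<kappa> / 2))"
  define H where "H = e\<^sup>2 * s1\<^sup>2 / (200 * real K)"
  define cost where "cost = card V * (2 * \<Delta> + K * (4 * \<Delta> + 7) + 3)"
  define r where "r = card V * ((\<Delta> + K + 3) * exp (- H))"
  have e0: "0 < e" using x0 by (simp add: e_def)
  have s1sq: "(K * x powr (- \<kappa>) / 2)\<^sup>2 \<le> s1\<^sup>2"
    using s1_lo Kpos x0 by (intro power_mono) auto
  have sq: "(K * x powr (- \<kappa>) / 2)\<^sup>2 = K\<^sup>2 * x powr (- 2 * \<kappa>) / 4"
    using x0 by (simp add: power_divide power_mult_distrib powr_power)
  interpret coloring_run V E K \<Delta> pick T e e' s1 H r cost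
  proof unfold_locales
    show "K / s1\<^sup>2 + 4 * e * K / s1 \<le> e'"
    proof -
      have "K / s1\<^sup>2 \<le> K / (K\<^sup>2 * x powr (- 2 * \<kappa>) / 4)"
        using s1sq sq Kpos x0 s1_pos by (intro divide_left_mono mult_pos_pos) auto
      also have "\<dots> = 4 * x powr (2 * \<kappa>) / K"
        using Kpos x0 by (simp add: power2_eq_square powr_minus field_simps)
      also have "\<dots> \<le> 4 * x powr (2 * \<kappa>) / (c * x / (2 * L))"
        using K_lo Kpos x0 c0 L by (intro divide_left_mono mult_pos_pos divide_pos_pos) auto
      also have "\<dots> = 8 * L * x powr (2 * \<kappa> - 1) / c"
        using x0 c0 L by (simp add: powr_diff field_simps)
      finally have 1: "K / s1\<^sup>2 \<le> 8 * L * x powr (2 * \<kappa> - 1) / c" .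
      have "4 * e * K / s1 \<le> 4 * e * K / (K * x powr (- \<kappa>) / 2)"
        using s1_lo Kpos x0 s1_pos e0 by (intro divide_left_mono mult_pos_pos) auto
      also have "\<dots> = 8 * (e * x powr \<kappa>)" using Kpos x0 by (simp add: powr_minus field_simps)
      also have "e * x powr \<kappa> = x powr (- \<kappa>)" using x0 by (simp add: e_def flip: powr_add)
      finally show ?thesis using 1 A1 by (simp add: e'_def)
    qed
    show "e + e' \<le> \<beta> * K / (20 * real \<Delta>)"
    proof -
      have "1/140 * (c * x / (2 * L)) \<le> \<beta> * K"
        using K_lo \<beta>_bounds c0 x0 L by (intro mult_mono) auto
      then have "1/140 * (c * x / (2 * L)) / (20 * x) \<le> \<beta> * K / (20 * x)"
        using x0 by (intro divide_right_mono) auto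
      moreover have "1/140 * (c * x / (2 * L)) / (20 * x) = c / (5600 * L)"
        using x0 L by (simp add: field_simps)
      ultimately show ?thesis using A2 by (simp add: e_def e'_def x_def)
    qed
    show "(19 * T + 1) * e' \<le> 1 / 20"
    proof -
      have "(19 * T + 1) * e' \<le> (19 * (7 * \<kappa> * L + 1) + 1) * e'"
        using TL by (intro mult_right_mono) (auto simp: e'_def)
      then show ?thesis using A3 by (simp add: e'_def)
    qed
  qed (use graph pick deg K1 K\<Delta> T_lo e0 in \<open>auto simp: s1_def H_def cost_def r_def x_def\<close>)
  have n1: "1 \<le> card V" using n(1) graph(1) by (simp add: simple_graph_def Suc_le_eq card_gt_0_iff)
  then have npos: "0 < real (card V)" by simp
  from coloring_algorithm_achieves show ?thesis
    unfolding K_def[symmetric]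
  proof (rule achieves_mono)
    have "real total_cost \<le> 50000 * (card V * x\<^sup>2 * L)"
    proof -
      let ?N = "card V * (K * \<Delta>)"
      have \<Delta>1: "1 \<le> \<Delta>" using K1 K\<Delta> by simp
      have T1': "1 \<le> T" using T1 by simp
      have K\<Delta>1: "1 \<le> K * \<Delta>" "K \<le> K * \<Delta>" "\<Delta> \<le> K * \<Delta>" using K1 \<Delta>1 by auto
      have nN: "card V * m \<le> k * ?N" if "m \<le> k * (K * \<Delta>)" for m k
        using mult_le_mono2[OF that, of "card V"] by (simp add: mult_ac)
      have N1: "1 \<le> ?N" using n1 K\<Delta>1(1) by (simp add: Suc_le_eq)
      have dist: "K * (4 * \<Delta> + 7) = 4 * (K * \<Delta>) + 7 * K" "K * (\<Delta> + 1) = K * \<Delta> + K"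
        by (simp_all add: algebra_simps)
      have "cost \<le> 16 * ?N" unfolding cost_def dist by (intro nN) (use K\<Delta>1 in linarith)
      then have "cost + 1 \<le> 17 * ?N" using N1 by linarith
      moreover have "19 * T + 1 \<le> 20 * T" using T1' by linarith
      ultimately have "(19 * T + 1) * (cost + 1) \<le> (20 * T) * (17 * ?N)"
        by (intro mult_le_mono)
      moreover have "card V * (K + 1) \<le> 2 * ?N" by (intro nN) (use K\<Delta>1 in linarith)
      moreover have "card V * (K * (\<Delta> + 1) + 2) \<le> 4 * ?N"
        unfolding dist by (intro nN) (use K\<Delta>1 in linarith)
      moreover have "?N \<le> T * ?N" using T1' by simp
      ultimately have "total_cost \<le> 348 * (T * ?N)"
        unfolding total_cost_def using N1 by linarith
      then have "real total_cost \<le> real (348 * (T * ?N))" by (rule of_nat_mono)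
      also have "\<dots> = 348 * (card V * x) * (real T * real K)" by (simp add: x_def)
      also have "\<dots> \<le> 348 * (card V * x) * (141 * x)"
      proof (intro mult_left_mono)
        have "real T * real K \<le> (x / (K * \<beta>) + 1) * K" using T_up by (intro mult_right_mono) auto
        also have "\<dots> = x * (1 / \<beta>) + K" using Kpos \<beta>_bounds by (simp add: field_simps)
        also have "\<dots> \<le> x * 140 + x"
          using \<beta>_bounds x0 Kx by (intro add_mono mult_left_mono) (auto simp: field_simps)
        finally show "real T * real K \<le> 141 * x" by simp
      qed (use x0 in auto)
      also have "\<dots> \<le> 50000 * (card V * x\<^sup>2)" using x0 by (simp add: power2_eq_square)
      also have "\<dots> = 50000 * (card V * x\<^sup>2) * 1" by simp
      also have "\<dots> \<le> 50000 * (card V * x\<^sup>2) * L" using L by (intro mult_left_mono) auto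
      finally show ?thesis by (simp add: mult_ac)
    qed
    then show "proper_coloring V E f \<and> t \<le> 50000 * (real (card V) * (real \<Delta>)\<^sup>2 * ln \<Delta>)"
      if "proper_coloring V E f \<and> t \<le> total_cost" for f t
      using that unfolding x_def L_def by (meson of_nat_mono order_trans)
  next
    let ?n = "real (card V)"
    have H_lo: "c * x powr (1 - 6 * \<kappa>) / (1600 * L) \<le> H"
    proof -
      have "c * x / (2 * L) * (x powr (- 6 * \<kappa>) / 800) \<le> K * (x powr (- 6 * \<kappa>) / 800)"
        using K_lo by (intro mult_right_mono) auto
      also have "\<dots> = e\<^sup>2 * (K\<^sup>2 * x powr (- 2 * \<kappa>) / 4) / (200 * real K)"
      proof -
        have "e\<^sup>2 * x powr (- 2 * \<kappa>) = x powr (- 6 * \<kappa>)"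
          using x0 by (simp add: e_def powr_power flip: powr_add)
        then show ?thesis using Kpos by (simp add: power2_eq_square field_simps)
      qed
      also have "\<dots> \<le> H" unfolding H_def using s1sq unfolding sq
        using Kpos by (intro divide_right_mono mult_left_mono) auto
      finally have "c * x / (2 * L) * (x powr (- 6 * \<kappa>) / 800) \<le> H" .
      moreover have "x powr (1 - 6 * \<kappa>) = x * x powr (- 6 * \<kappa>)"
        using x0 by (simp add: powr_diff powr_minus field_simps)
      ultimately show ?thesis using L by (simp add: field_simps)
    qed
    define B where "B = (133 * \<kappa> * L + 20) * (2 * x + 3)"
    have B: "0 < B" using \<kappa> L x0 by (auto simp: B_def intro!: mult_pos_pos add_pos_pos)
    have "2 * ln ?n + ln B \<le> H" using A4 n(2) H_lo by (simp add: x_def B_def)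
    then have "exp (2 * ln ?n + ln B) \<le> exp H" by simp
    moreover have "exp (2 * ln ?n + ln B) = ?n\<^sup>2 * B"
      using npos B by (simp add: exp_add exp_double)
    ultimately have "?n\<^sup>2 * B \<le> exp H" by linarith
    then have nB: "?n\<^sup>2 * B * exp (- H) \<le> 1"
      by (simp add: exp_minus field_simps)
    have "(19 * real T + 1) * (x + real K + 3) \<le> B"
      unfolding B_def using TL Kx x0 by (intro mult_mono) auto
    then have "(19 * real T + 1) * (x + real K + 3) * (?n\<^sup>2 * exp (- H)) \<le> B * (?n\<^sup>2 * exp (- H))"
      by (intro mult_right_mono) auto
    moreover have "B * (?n\<^sup>2 * exp (- H)) \<le> 1" using nB by (simp add: mult_ac)
    moreover have "(19 * T + 1) * r * ?n = (19 * real T + 1) * (x + real K + 3) * (?n\<^sup>2 * exp (- H))"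
      by (simp add: r_def x_def power2_eq_square mult_ac add_ac)
    ultimately have "(19 * T + 1) * r * ?n \<le> 1" by linarith
    then show "(19 * T + 1) * r \<le> 1 / ?n" using npos by (simp add: field_simps)
  qed
qed

theorem theorem1:
  fixes \<epsilon> :: real
  assumes "\<epsilon> > 0"
  shows "\<exists>c_eps > 0. \<exists>M > 0. \<exists>M' > 0. \<forall>(V :: nat set) E pick.
    let n = card V; \<Delta> = max_degree V E in
    V \<noteq> {} \<longrightarrow> simple_graph V E \<longrightarrow> triangle_free E \<longrightarrow>
    real \<Delta> \<ge> ln (real n) powr (1 + \<epsilon>) \<longrightarrow> choice_rule pick \<longrightarrow>
    measure (measure_spmf (run (coloring_algorithm V E \<Delta>
               (nat \<lfloor>c_eps * real \<Delta> / ln (real \<Delta>)\<rfloor>) 7 pick)))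
      {(f, time). proper_coloring V E f \<and> real time \<le> M * (real n * (real \<Delta>)\<^sup>2 * ln (real \<Delta>))}
    \<ge> 1 - M' / real n"
proof -
  define \<kappa> where "\<kappa> = \<epsilon> / (12 * (1 + \<epsilon>))"
  have \<kappa>: "0 < \<kappa>" "\<kappa> < 1/12" using assms by (auto simp: \<kappa>_def field_simps)
  \<comment> \<open>this \<open>\<kappa>\<close> turns the hypothesis on \<open>\<Delta>\<close> into \<open>ln n \<le> \<Delta> powr (1 - 12 \<kappa>)\<close>\<close>
  have \<kappa>_eq: "1 - 12 * \<kappa> = 1 / (1 + \<epsilon>)" using assms by (simp add: \<kappa>_def field_simps)
  define c where "c = 40 / \<kappa>"
  have c: "0 < c" using \<kappa> by (simp add: c_def)
  obtain x0 where x0: "\<And>x. x0 \<le> x \<Longrightarrow> large \<kappa> c x"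
    using eventually_large[OF \<kappa> c] unfolding eventually_at_top_linorder by blast
  \<comment> \<open>below the threshold \<open>x0\<close> on \<open>\<Delta>\<close> the number of vertices is bounded, and \<open>M'\<close> makes the claim trivial\<close>
  define M' where "M' = exp (max 0 x0 powr (1 - 12 * \<kappa>)) + 1"
  have M': "0 < M'" "1 \<le> M'" by (auto simp: M'_def add_pos_pos)
  have main: "1 - M' / card V \<le> measure (measure_spmf (run (coloring_algorithm V E (max_degree V E)
               (nat \<lfloor>c * real (max_degree V E) / ln (real (max_degree V E))\<rfloor>) 7 pick)))
      {(f, time). proper_coloring V E f \<and>
         real time \<le> 50000 * (real (card V) * (real (max_degree V E))\<^sup>2 * ln (real (max_degree V E)))}"
    if V: "V \<noteq> {}" and graph: "simple_graph V E" "triangle_free E"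
      and big: "ln (card V) powr (1 + \<epsilon>) \<le> max_degree V E" and pick: "choice_rule pick"
    for V :: "nat set" and E pick
  proof -
    let ?\<Delta> = "max_degree V E"
    have fin: "finite V" using graph(1) by (simp add: simple_graph_def)
    have n1: "1 \<le> real (card V)" using V fin by (simp add: Suc_le_eq card_gt_0_iff)
    have "(ln (card V) powr (1 + \<epsilon>)) powr (1 - 12 * \<kappa>) \<le> ?\<Delta> powr (1 - 12 * \<kappa>)"
      using big \<kappa> by (intro powr_mono2) auto
    then have ln_n: "ln (card V) \<le> ?\<Delta> powr (1 - 12 * \<kappa>)"
      using n1 assms by (simp add: powr_powr \<kappa>_eq)
    show ?thesis
    proof (cases "x0 \<le> ?\<Delta>")
      case True
      have deg: "card {v. E u v} \<le> ?\<Delta>" for u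
      proof (cases "u \<in> V")
        case True
        then show ?thesis unfolding max_degree_def using fin by (intro Max_ge) auto
      next
        case False
        then have "{v. E u v} = {}" using graph(1) unfolding simple_graph_def by blast
        then show ?thesis by simp
      qed
      have "1 - M' / card V \<le> 1 - 1 / card V" using M' n1 by (simp add: divide_right_mono)
      also have "\<dots> \<le> measure (measure_spmf (run (coloring_algorithm V E ?\<Delta> (nat \<lfloor>c * ?\<Delta> / ln ?\<Delta>\<rfloor>) 7 pick)))
          {(f, time). proper_coloring V E f \<and> real time \<le> 50000 * (real (card V) * (real ?\<Delta>)\<^sup>2 * ln ?\<Delta>)}"
        using coloring_run_large[OF \<kappa> c_def x0[OF True] graph pick deg V ln_n]
        unfolding achieves_def run_def .
      finally show ?thesis .
    next
      case False
      have "?\<Delta> powr (1 - 12 * \<kappa>) \<le> max 0 x0 powr (1 - 12 * \<kappa>)"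
        using False \<kappa> by (intro powr_mono2) auto
      then have "exp (ln (card V)) \<le> exp (max 0 x0 powr (1 - 12 * \<kappa>))" using ln_n by simp
      then have "card V \<le> M'" using n1 by (simp add: M'_def)
      then have "1 - M' / card V \<le> 0" using n1 by (simp add: field_simps)
      also have "0 \<le> measure (measure_spmf (run (coloring_algorithm V E ?\<Delta> (nat \<lfloor>c * ?\<Delta> / ln ?\<Delta>\<rfloor>) 7 pick)))
          {(f, time). proper_coloring V E f \<and> real time \<le> 50000 * (real (card V) * (real ?\<Delta>)\<^sup>2 * ln ?\<Delta>)}"
        by simp
      finally show ?thesis .
    qed
  qed
  show ?thesis
    unfolding Let_def
    by (intro exI[of _ c] exI[of _ 50000] exI[of _ M'] conjI allI impI main c M'(1)) auto
qed

end
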